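(* Let $\Bbbk$ be a field. Suppose that for every $n$ and every balanced degree triplet $(A,B,C)$ of type $n$ there exists a triplet of pure free squarefree complexes over the polynomial ring $\Bbbk[x_1,\ldots,x_n]$ whose degree triplet is $(A,B,C)$. Then for every $n$ and every balanced degree triplet $(A,B,C)$ of type $n$, the Betti numbers of triplets of pure free squarefree complexes over $\Bbbk[x_1,\ldots,x_n]$ with degree triplet $(A,B,C)$ are uniquely determined up to a common scalar multiple: if $F^\bullet$ and $F'^\bullet$ are the first members of two such triplets, with Betti numbers $(\alpha_i),(\beta_i),(\gamma_i)$ of $F^\bullet,\ \mathbb A\circ\mathbb D(F^\bullet),\ (\mathbb A\circ\mathbb D)^2(F^\bullet)$ and $(\alpha'_i),(\beta'_i),(\gamma'_i)$ of $F'^\bullet,\ \mathbb A\circ\mathbb D(F'^\bullet),\ (\mathbb A\circ\mathbb D)^2(F'^\bullet)$ respectively, then there is a rational number $\lambda$ with $\alpha'_i=\lambda\alpha_i$, $\beta'_i=\lambda\beta_i$, $\gamma'_i=\lambda\gamma_i$ for all $i$.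
   Context: Let $S=\Bbbk[x_1,\ldots,x_n]$, $\mathbb Z^n$-graded, with $\epsilon_i$ the $i$-th unit vector and $\mathbf 1=(1,\ldots,1)$. Subsets $R\subseteq[n]$ are identified with their $0/1$-vectors; $R^c=[n]\setminus R$. A finitely generated $\mathbb N^n$-graded $S$-module $M$ is squarefree if $x_i:M_{\mathbf b}\to M_{\mathbf b+\epsilon_i}$ is an isomorphism whenever $b_i\ge1$. Finite direct sums of modules $S(-R)$, $R\subseteq[n]$, are the free squarefree modules. Complexes are cohomologically graded. Every bounded complex $X^\bullet$ of squarefree modules has a minimal free squarefree resolution $\mathrm{res}(X^\bullet)\to X^\bullet$ (a quasi-isomorphism from a bounded complex $F^\bullet$ of free squarefree modules with zero differentials in $F^\bullet\otimes_S\Bbbk$), unique up to isomorphism. The Alexander dual $\mathbf A(M)$ of a squarefree module $M$ is the squarefree module with $\mathbf A(M)_R=\mathrm{Hom}_\Bbbk(M_{R^c},\Bbbk)$, multiplication by $x_v$ ($v\notin R$) being dual to $x_v:M_{(R\cup\{v\})^c}\to M_{R^c}$; it is applied to complexes by $\mathbf A(X^\bullet)^i=\mathbf A(X^{-i})$. For bounded complexes $F^\bullet$ of free squarefree modules put $\mathbb A(F^\bullet)=\mathrm{res}(\mathbf A(F^\bullet))$ and $\mathbb D(F^\bullet)=\mathrm{Hom}_S(F^\bullet,S(-\mathbf 1))$. A bounded complex of free squarefree modules is pure if, as a singly graded complex, it has the form $S(-d_0)^{\beta_0}\leftarrow S(-d_1)^{\beta_1}\leftarrow\cdots\leftarrow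 S(-d_r)^{\beta_r}$ (consecutive cohomological positions) with $d_0<\cdots<d_r$ and all $\beta_i\ge1$; the $d_i$ are its degrees and the $\beta_i$ its Betti numbers. A triplet of pure free squarefree complexes is $F^\bullet,\ \mathbb A\circ\mathbb D(F^\bullet),\ (\mathbb A\circ\mathbb D)^2(F^\bullet)$ with all three complexes pure; its degree triplet is $(A,B,C)$, the sets of degrees of the three complexes in this order. For an integer $d$ put $\overline d=n-d$, and $\overline D=\{\overline d: d\in D\}$ for a set $D$ of integers. A triplet of nonempty subsets $(A,B,C)$ of $\mathbb N_0$ is a balanced degree triplet of type $n$ if there are integers $0\le a,b,c\le n$ such that: (1) $A\subseteq[c,\overline b]$, $B\subseteq[a,\overline c]$, $C\subseteq[b,\overline a]$ and the endpoints of each interval lie in the respective subset; (2) with $e_A=|[c,\overline b]\setminus A|$, $e_B=|[a,\overline c]\setminus B|$, $e_C=|[b,\overline a]\setminus C|$ one has $n=a+b+c+e_A+e_B+e_C$; (3) for each $c\le v\le n$ the number of elements of $[c,v]$ in $A$ is greater than the number of elements of $[c,v]$ not in $\overline B$; likewise for $B$ and $\overline C$ with respect to $a$ (intervals $[a,v]$, $a\le v\le n$), and for $C$ and $\overline A$ with respect to $b$ (intervals $[b,v]$, $b\le v\le n$). *)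

theory Defs
  imports
    Complex_Main
    "HOL-Library.Poly_Mapping"
    "HOL-Library.Function_Algebras"
    "HOL-Algebra.Module"
    "HOL-Algebra.AbelCoset"
begin

section \<open>The polynomial ring and graded modules\<close>

text \<open>
  Polynomials are finitely supported maps from exponents to coefficients.  The
  ring $\Bbbk[x_1,\ldots,x_n]$ consists of those that only involve variables with
  index in \<open>{1..n}\<close>.  Multidegrees are integer functions vanishing
  outside \<open>{1..n}\<close>.
\<close>

type_synonym 'k mpoly = "(nat \<Rightarrow>\<^sub>0 nat) \<Rightarrow>\<^sub>0 'k"

type_synonym mdeg = "nat \<Rightarrow> int"

definition polyring :: "nat \<Rightarrow> 'k::field mpoly ring" where
  "polyring n = \<lparr>carrier = {p. \<forall>a\<in>Poly_Mapping.keys p. Poly_Mapping.keys a \<subseteq> {1..n}},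
     monoid.mult = (*), one = 1, ring.zero = 0, ring.add = (+)\<rparr>"

definition const_poly :: "'k::field \<Rightarrow> 'k mpoly" where
  "const_poly c = Poly_Mapping.single 0 c"

definition var :: "nat \<Rightarrow> 'k::field mpoly" where
  "var i = Poly_Mapping.single (Poly_Mapping.single i 1) 1"

definition sqfree_monom :: "nat set \<Rightarrow> 'k::field mpoly" where
  "sqfree_monom R = (\<Prod>i\<in>R. var i)"

definition mdeg_set :: "nat \<Rightarrow> mdeg set" where
  "mdeg_set n = {b. \<forall>i. i \<notin> {1..n} \<longrightarrow> b i = 0}"

definition nonneg_mdeg_set :: "nat \<Rightarrow> mdeg set" where
  "nonneg_mdeg_set n = {b \<in> mdeg_set n. \<forall>i. b i \<ge> 0}"

definition mdeg_of :: "(nat \<Rightarrow>\<^sub>0 nat) \<Rightarrow> mdeg" where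
  "mdeg_of a = (\<lambda>i. int (Poly_Mapping.lookup a i))"

definition ind :: "nat set \<Rightarrow> mdeg" where
  "ind R = (\<lambda>i. if i \<in> R then 1 else 0)"

definition supp :: "mdeg \<Rightarrow> nat set" where
  "supp b = {i. b i \<noteq> 0}"

record ('r, 'm) gr_module = "('r, 'm) module" +
  piece :: "mdeg \<Rightarrow> 'm set"

text \<open>The direct sum of the modules \<open>S(-R)\<close>, with \<open>R\<close> ranging over a list of subsets of \<open>{1..n}\<close>.\<close>

definition free_module :: "nat \<Rightarrow> nat set list \<Rightarrow> ('k::field mpoly, nat \<Rightarrow> 'k mpoly) gr_module" where
  "free_module n Rs =
     (let V = {f. (\<forall>j<length Rs. f j \<in> carrier (polyring n)) \<and> (\<forall>j\<ge>length Rs. f j = 0)} in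
      \<lparr>carrier = V, monoid.mult = undefined, one = undefined, ring.zero = (\<lambda>_. 0),
       ring.add = (\<lambda>f g j. f j + g j), smult = (\<lambda>p f j. p * f j),
       piece = (\<lambda>b. {f \<in> V. \<forall>j<length Rs. \<forall>a\<in>Poly_Mapping.keys (f j). mdeg_of a + ind (Rs ! j) = b})\<rparr>)"

definition lin_maps :: "nat \<Rightarrow> ('k::field mpoly, 'm) gr_module \<Rightarrow> ('k mpoly, 'n) gr_module
    \<Rightarrow> ('m \<Rightarrow> 'n) set" where
  "lin_maps n M N = {f \<in> carrier M \<rightarrow> carrier N.
     (\<forall>x\<in>carrier M. \<forall>y\<in>carrier M. f (x \<oplus>\<^bsub>M\<^esub> y) = f x \<oplus>\<^bsub>N\<^esub> f y) \<and>
     (\<forall>p\<in>carrier (polyring n). \<forall>x\<in>carrier M. f (p \<odot>\<^bsub>M\<^esub> x) = p \<odot>\<^bsub>N\<^esub> f x)}"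

definition graded_maps :: "nat \<Rightarrow> ('k::field mpoly, 'm) gr_module \<Rightarrow> ('k mpoly, 'n) gr_module
    \<Rightarrow> ('m \<Rightarrow> 'n) set" where
  "graded_maps n M N = {f \<in> lin_maps n M N. \<forall>b. f ` piece M b \<subseteq> piece N b}"

text \<open>
  Maps in \<open>hom_module\<close> are normalised to be zero off the carrier of the source.
  For finitely generated \<open>M\<close> every linear map is a sum of homogeneous ones, so
  that this is the usual graded Hom.
\<close>

definition hom_module :: "nat \<Rightarrow> ('k::field mpoly, 'm) gr_module \<Rightarrow> ('k mpoly, 'n) gr_module
    \<Rightarrow> ('k mpoly, 'm \<Rightarrow> 'n) gr_module" where
  "hom_module n M N =
     (let H = {f \<in> lin_maps n M N. \<forall>x. x \<notin> carrier M \<longrightarrow> f x = \<zero>\<^bsub>N\<^esub>} in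
      \<lparr>carrier = H, monoid.mult = undefined, one = undefined, ring.zero = (\<lambda>_. \<zero>\<^bsub>N\<^esub>),
       ring.add = (\<lambda>f g x. f x \<oplus>\<^bsub>N\<^esub> g x), smult = (\<lambda>p f x. p \<odot>\<^bsub>N\<^esub> f x),
       piece = (\<lambda>b. {f \<in> H. \<forall>c. f ` piece M c \<subseteq> piece N (c + b)})\<rparr>)"

text \<open>The \<open>\<Bbbk>\<close>-dual of a graded piece, functionals being zero off the piece.\<close>

definition piece_dual :: "('k::field mpoly, 'm) gr_module \<Rightarrow> mdeg \<Rightarrow> ('m \<Rightarrow> 'k) set" where
  "piece_dual M b = {f.
     (\<forall>x\<in>piece M b. \<forall>y\<in>piece M b. f (x \<oplus>\<^bsub>M\<^esub> y) = f x + f y) \<and>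
     (\<forall>c. \<forall>x\<in>piece M b. f (const_poly c \<odot>\<^bsub>M\<^esub> x) = c * f x) \<and>
     (\<forall>x. x \<notin> piece M b \<longrightarrow> f x = 0)}"

text \<open>
  The squarefree module $\mathbf A(M)$ has $\mathbf A(M)_b = \mathbf A(M)_{\mathrm{supp}(b)}
  = \mathrm{Hom}_\Bbbk(M_{\mathrm{supp}(b)^c},\Bbbk)$ for $b\in\mathbb N^n$, and its elements are the
  finitely supported families \<open>g\<close> with \<open>g b\<close> in the piece of degree \<open>b\<close>.
  If $b-a$ has support $R'\subseteq R=\mathrm{supp}(b)$, then $x^a$ maps the piece of degree $b-a$ to
  the piece of degree $b$ as the dual of $x^{R\setminus R'}: M_{R^c}\to M_{R'^c}$; in particular it is
  the identity if $R'=R$.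
\<close>

definition alexander_dual :: "nat \<Rightarrow> ('k::field mpoly, 'm) gr_module
    \<Rightarrow> ('k mpoly, mdeg \<Rightarrow> 'm \<Rightarrow> 'k) gr_module" where
  "alexander_dual n M =
     (let P = (\<lambda>b. ind ({1..n} - supp b));
          V = {g. finite {b. g b \<noteq> (\<lambda>_. 0)} \<and>
                  (\<forall>b\<in>nonneg_mdeg_set n. g b \<in> piece_dual M (P b)) \<and>
                  (\<forall>b. b \<notin> nonneg_mdeg_set n \<longrightarrow> g b = (\<lambda>_. 0))} in
      \<lparr>carrier = V, monoid.mult = undefined, one = undefined, ring.zero = (\<lambda>_ _. 0),
       ring.add = (\<lambda>g h b m. g b m + h b m),
       smult = (\<lambda>p g b m. if m \<in> piece M (P b)
          then \<Sum>a\<in>Poly_Mapping.keys p. Poly_Mapping.lookup p a *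
            g (b - mdeg_of a) (sqfree_monom (supp b - supp (b - mdeg_of a)) \<odot>\<^bsub>M\<^esub> m)
          else 0),
       piece = (\<lambda>b. {g \<in> V. \<forall>c. c \<noteq> b \<longrightarrow> g c = (\<lambda>_. 0)})\<rparr>)"


section \<open>Complexes\<close>

record ('r, 'm) cochain =
  cmod :: "int \<Rightarrow> ('r, 'm) gr_module"
  cdiff :: "int \<Rightarrow> 'm \<Rightarrow> 'm"

definition bounded_complex :: "nat \<Rightarrow> ('k::field mpoly, 'm) cochain \<Rightarrow> bool" where
  "bounded_complex n X \<longleftrightarrow>
     (\<forall>i. cdiff X i \<in> graded_maps n (cmod X i) (cmod X (i + 1))) \<and>
     (\<forall>i. \<forall>x\<in>carrier (cmod X i). cdiff X (i + 1) (cdiff X i x) = \<zero>\<^bsub>cmod X (i + 2)\<^esub>) \<and>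
     finite {i. carrier (cmod X i) \<noteq> {\<zero>\<^bsub>cmod X i\<^esub>}}"

definition cocycles :: "('k::field mpoly, 'm) cochain \<Rightarrow> int \<Rightarrow> 'm set" where
  "cocycles X i = {x \<in> carrier (cmod X i). cdiff X i x = \<zero>\<^bsub>cmod X (i + 1)\<^esub>}"

definition coboundaries :: "('k::field mpoly, 'm) cochain \<Rightarrow> int \<Rightarrow> 'm set" where
  "coboundaries X i = cdiff X (i - 1) ` carrier (cmod X (i - 1))"

definition cohomology :: "('k::field mpoly, 'm) cochain \<Rightarrow> int \<Rightarrow> 'm set monoid" where
  "cohomology X i = (cmod X i)\<lparr>carrier := cocycles X i\<rparr> A_Mod coboundaries X i"

definition quasi_iso :: "nat \<Rightarrow> ('k::field mpoly, 'm) cochain \<Rightarrow> ('k mpoly, 'l) cochain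
    \<Rightarrow> (int \<Rightarrow> 'm \<Rightarrow> 'l) \<Rightarrow> bool" where
  "quasi_iso n X Y \<phi> \<longleftrightarrow>
     (\<forall>i. \<phi> i \<in> graded_maps n (cmod X i) (cmod Y i)) \<and>
     (\<forall>i. \<forall>x\<in>carrier (cmod X i). \<phi> (i + 1) (cdiff X i x) = cdiff Y i (\<phi> i x)) \<and>
     (\<forall>i. (\<lambda>Q. \<phi> i ` Q <+>\<^bsub>cmod Y i\<^esub> coboundaries Y i) \<in> iso (cohomology X i) (cohomology Y i))"

text \<open>A free squarefree complex is given by the degrees of the summands in each position and its differentials.\<close>

record 'r free_cochain =
  gens :: "int \<Rightarrow> nat set list"
  fdiff :: "int \<Rightarrow> (nat \<Rightarrow> 'r) \<Rightarrow> nat \<Rightarrow> 'r"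

definition cochain_of :: "nat \<Rightarrow> 'k::field mpoly free_cochain \<Rightarrow> ('k mpoly, nat \<Rightarrow> 'k mpoly) cochain" where
  "cochain_of n F = \<lparr>cmod = (\<lambda>i. free_module n (gens F i)), cdiff = fdiff F\<rparr>"

definition free_sqfree_complex :: "nat \<Rightarrow> 'k::field mpoly free_cochain \<Rightarrow> bool" where
  "free_sqfree_complex n F \<longleftrightarrow>
     (\<forall>i. \<forall>R\<in>set (gens F i). R \<subseteq> {1..n}) \<and> bounded_complex n (cochain_of n F)"

text \<open>
  $M\otimes_S\Bbbk = M/(x_1,\ldots,x_n)M$, so the differentials of $F\otimes_S\Bbbk$ vanish iff
  those of \<open>F\<close> take values in $(x_1,\ldots,x_n)F$.
\<close>

definition irrelevant_submodule :: "nat \<Rightarrow> ('k::field mpoly, 'm) gr_module \<Rightarrow> 'm set" where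
  "irrelevant_submodule n M = {\<Oplus>\<^bsub>M\<^esub>i\<in>{1..n}. var i \<odot>\<^bsub>M\<^esub> f i | f. f \<in> {1..n} \<rightarrow> carrier M}"

definition minimal :: "nat \<Rightarrow> 'k::field mpoly free_cochain \<Rightarrow> bool" where
  "minimal n F \<longleftrightarrow> (\<forall>i. \<forall>x\<in>carrier (free_module n (gens F i)).
     fdiff F i x \<in> irrelevant_submodule n (free_module n (gens F (i + 1))))"

definition minimal_free_resolution :: "nat \<Rightarrow> 'k::field mpoly free_cochain \<Rightarrow> ('k mpoly, 'm) cochain \<Rightarrow> bool" where
  "minimal_free_resolution n G X \<longleftrightarrow>
     free_sqfree_complex n G \<and> minimal n G \<and> (\<exists>\<phi>. quasi_iso n (cochain_of n G) X \<phi>)"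

definition std_dual_complex :: "nat \<Rightarrow> 'k::field mpoly free_cochain
    \<Rightarrow> ('k mpoly, (nat \<Rightarrow> 'k mpoly) \<Rightarrow> nat \<Rightarrow> 'k mpoly) cochain" where
  "std_dual_complex n F =
     \<lparr>cmod = (\<lambda>i. hom_module n (free_module n (gens F (-i))) (free_module n [{1..n}])),
      cdiff = (\<lambda>i f x. if x \<in> carrier (free_module n (gens F (-i - 1)))
                then f (fdiff F (-i - 1) x) else (\<lambda>_. 0))\<rparr>"

definition alexander_dual_complex :: "nat \<Rightarrow> ('k::field mpoly, 'm) cochain
    \<Rightarrow> ('k mpoly, mdeg \<Rightarrow> 'm \<Rightarrow> 'k) cochain" where
  "alexander_dual_complex n X =
     \<lparr>cmod = (\<lambda>i. alexander_dual n (cmod X (-i))),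
      cdiff = (\<lambda>i g b m. if m \<in> piece (cmod X (-i - 1)) (ind ({1..n} - supp b))
                then g b (cdiff X (-i - 1) m) else 0)\<rparr>"


section \<open>Pure complexes and triplets\<close>

text \<open>
  The functor \<open>res\<close> is only determined up to isomorphism, so that $\mathbb A\circ\mathbb D$ is rendered
  as a relation: \<open>is_AD n F G\<close> says that \<open>G\<close> represents $\mathbb A(\mathbb D(F))$.
\<close>

definition is_AD :: "nat \<Rightarrow> 'k::field mpoly free_cochain \<Rightarrow> 'k mpoly free_cochain \<Rightarrow> bool" where
  "is_AD n F G \<longleftrightarrow>
     minimal_free_resolution n G (alexander_dual_complex n (std_dual_complex n F))"

text \<open>
  \<open>F\<close> is pure with degree set \<open>D\<close> and Betti numbers \<open>\<beta> 0, \<dots>, \<beta> r\<close>.  Since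
  differentials raise the cohomological position, the summand generated in the \<open>i\<close>-th
  degree \<open>d i\<close> sits \<open>i\<close> positions below the one generated in the smallest degree.
  The module \<open>S(-R)\<close> becomes \<open>S(-|R|)\<close> in the single grading.
\<close>

definition pure_complex :: "'k::field mpoly free_cochain \<Rightarrow> nat set \<Rightarrow> (nat \<Rightarrow> nat) \<Rightarrow> bool" where
  "pure_complex F D \<beta> \<longleftrightarrow> (\<exists>(p::int) r d.
     strict_mono_on {..r} d \<and> D = d ` {..r} \<and>
     (\<forall>i\<le>r. \<beta> i \<ge> 1 \<and> length (gens F (p - int i)) = \<beta> i \<and>
        (\<forall>R\<in>set (gens F (p - int i)). card R = d i)) \<and>
     (\<forall>j. j \<notin> {p - int r..p} \<longrightarrow> gens F j = []))"

definition pure_triplet :: "nat \<Rightarrow> nat set \<Rightarrow> nat set \<Rightarrow> nat set \<Rightarrow> 'k::field mpoly free_cochain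
    \<Rightarrow> 'k mpoly free_cochain \<Rightarrow> 'k mpoly free_cochain \<Rightarrow> bool" where
  "pure_triplet n A B C F G H \<longleftrightarrow>
     free_sqfree_complex n F \<and> is_AD n F G \<and> is_AD n G H \<and>
     (\<exists>\<alpha>. pure_complex F A \<alpha>) \<and> (\<exists>\<beta>. pure_complex G B \<beta>) \<and> (\<exists>\<gamma>. pure_complex H C \<gamma>)"

definition bar :: "nat \<Rightarrow> nat set \<Rightarrow> nat set" where
  "bar n D = (\<lambda>d. n - d) ` D"

text \<open>The truncated subtractions are harmless: all numbers involved are at most \<open>n\<close>.\<close>

definition balanced_degree_triplet :: "nat \<Rightarrow> nat set \<Rightarrow> nat set \<Rightarrow> nat set \<Rightarrow> bool" where
  "balanced_degree_triplet n A B C \<longleftrightarrow>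
     A \<noteq> {} \<and> B \<noteq> {} \<and> C \<noteq> {} \<and>
     (\<exists>a b c. a \<le> n \<and> b \<le> n \<and> c \<le> n \<and>
        A \<subseteq> {c..n - b} \<and> c \<in> A \<and> n - b \<in> A \<and>
        B \<subseteq> {a..n - c} \<and> a \<in> B \<and> n - c \<in> B \<and>
        C \<subseteq> {b..n - a} \<and> b \<in> C \<and> n - a \<in> C \<and>
        n = a + b + c + card ({c..n - b} - A) + card ({a..n - c} - B) + card ({b..n - a} - C) \<and>
        (\<forall>v\<in>{c..n}. card ({c..v} \<inter> A) > card ({c..v} - bar n B)) \<and>
        (\<forall>v\<in>{a..n}. card ({a..v} \<inter> B) > card ({a..v} - bar n C)) \<and>
        (\<forall>v\<in>{b..n}. card ({b..v} \<inter> C) > card ({b..v} - bar n A)))"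

end

theory Submission
  imports Defs "HOL-Computational_Algebra.Polynomial"
begin

text \<open>
  Record a complex $F$ by its degree polynomial $f(t)=\sum_i(-1)^i\sum_R t^{|R|}$, the inner sum
  being over the generator degrees $R$ in position $i$.  Comparing Euler characteristics in the
  squarefree degrees shows that the duality functor $\mathbb A\circ\mathbb D$ acts on degree
  polynomials by $(Tf)(t)=(1-t)^n f(1/(1-t))$, and $T^3=(-1)^n$.  So a triplet with degrees
  $(A,B,C)$ gives an $f$ with $f$, $Tf$, $T^2f$ supported in $A$, $B$, $C$, and it suffices that
  these $f$ form a space of dimension at most one.

  This goes by induction on the number of gaps $e_A+e_B+e_C$.  Without gaps, $f$ is a multiple of
  $t^c(t-1)^a$.  Otherwise, up to rotating the triplet, $A$ or $B$ has a gap.  If the solution space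
  had dimension at least two, it would contain some $h\ne0$ with vanishing coefficient at $t^c$, so
  that also the top coefficient of $Th$ vanishes.  Dropping these two endpoints and filling a suitable
  gap gives a balanced triplet with one gap less, for which $h$ is still a solution.  But by
  assumption that triplet has a solution with all coefficients nonzero, while the coefficient of
  $h$ (or of $Th$) at the filled gap is zero: a contradiction to uniqueness for the smaller problem.
\<close>

section \<open>Balanced degree triplets\<close>

text \<open>The order three comes from the substitution: s -> 1/(1-s) permutes 0, 1 and infinity
  cyclically, and (1-s)^n clears denominators up to a sign. The shape of T comes from one summand:
  A(D(S(-R))) is one-dimensional in the squarefree degrees contained in R and zero in the others,
  like S/(x_i : i not in R), whose Hilbert numerator is (1-t)^(n-|R|). Only dimensions enter, so
  rational polynomials serve every field. The obstacle in the induction is condition (3): filling an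
  arbitrary gap may violate it, or the shortened intervals may miss their new endpoints. The right
  gap is one met first when \<open>A\<close> and the reflection of \<open>B\<close> are read upwards
  from \<open>c\<close> in parallel. The three conditions of the cycle then react differently: one
  is shifted, one trades an element for a smaller one, and one loses an element, which is paid for
  by a surplus that condition (2) grants exactly when there is a gap. The existence hypothesis is
  applied to these altered triplets, not only to the given one: it excludes that all their solutions
  vanish at the filled place.\<close>

text \<open>
  Condition (3) on a balanced degree triplet, rewritten so that it is visibly symmetric in the two
  sets: \<open>X\<close> is one of the degree sets and \<open>Y\<close> the reflection of the next one.
\<close>

definition ahead :: "nat \<Rightarrow> nat \<Rightarrow> nat set \<Rightarrow> nat set \<Rightarrow> bool" where
  "ahead n c X Y \<longleftrightarrow> (\<forall>v\<in>{c..n}. card ({c..v} \<inter> X) + card ({c..v} \<inter> Y) > Suc v - c)"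

lemma ahead_commute: "ahead n c X Y \<longleftrightarrow> ahead n c Y X"
  by (simp add: ahead_def add.commute)

lemma ahead_iff:
  "ahead n c X Y \<longleftrightarrow> (\<forall>v\<in>{c..n}. card ({c..v} \<inter> X) > card ({c..v} - Y))"
proof -
  have "card ({c..v} \<inter> Y) + card ({c..v} - Y) = Suc v - c" for v
    by (metis card_Int_Diff card_atLeastAtMost finite_atLeastAtMost)
  then show ?thesis
    unfolding ahead_def by (metis add.commute add_less_cancel_right)
qed

section \<open>Reflection of degree sets, and the counting condition under elementary
  changes\<close>

lemma mem_bar_iff:
  assumes "D \<subseteq> {..n}"
  shows "v \<in> bar n D \<longleftrightarrow> v \<le> n \<and> n - v \<in> D"
proof
  assume "v \<in> bar n D"
  then show "v \<le> n \<and> n - v \<in> D"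
    using assms unfolding bar_def by auto
next
  assume "v \<le> n \<and> n - v \<in> D"
  moreover then have "v = n - (n - v)" by simp
  ultimately show "v \<in> bar n D"
    unfolding bar_def by blast
qed

lemma subset_atMost: "(D :: nat set) \<subseteq> {a..n - c} \<Longrightarrow> D \<subseteq> {..n}"
  by (rule order_trans) auto

lemma bar_subset:
  assumes "D \<subseteq> {a..n - c}" "c \<le> n"
  shows "bar n D \<subseteq> {c..n - a}"
proof
  fix v assume "v \<in> bar n D"
  then obtain d where "d \<in> D" "v = n - d" unfolding bar_def by blast
  moreover then have "d \<in> {a..n - c}" using assms by blast
  ultimately show "v \<in> {c..n - a}" using assms by auto
qed

lemma card_bar:
  assumes "D \<subseteq> {..n}"
  shows "card (bar n D) = card D"
  unfolding bar_def
proof (rule card_image, rule inj_onI)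
  fix x y assume "x \<in> D" "y \<in> D" and eq: "n - x = n - y"
  then have "x \<le> n" "y \<le> n" using assms by blast+
  then show "x = y" using eq by simp
qed

text \<open>Below the gap \<open>x\<close> the new first set has no holes in the shifted interval,
  and \<open>Suc c\<close> in \<open>Y\<close> supplies the one extra element. From \<open>x\<close>
  on, the first set has traded \<open>c\<close> for \<open>x\<close>, the second has lost
  \<open>c\<close>, and the required bound has dropped by one with the later start.\<close>

lemma ahead_Suc:
  assumes ah: "ahead n c X Y" and c: "c \<in> X" "c \<in> Y" "Suc c \<in> Y"
    and X: "{c..<x} \<subseteq> X" "x \<notin> X" and cx: "c < x"
  shows "ahead n (Suc c) (insert x (X - {c})) (Y - {c})"
  unfolding ahead_def
proof
  fix v assume v: "v \<in> {Suc c..n}"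
  have Y': "card ({Suc c..v} \<inter> (Y - {c})) = card ({c..v} \<inter> Y) - 1"
  proof -
    have "{Suc c..v} \<inter> (Y - {c}) = ({c..v} \<inter> Y) - {c}" by auto
    then show ?thesis using v c by simp
  qed
  show "Suc v - Suc c < card ({Suc c..v} \<inter> insert x (X - {c})) + card ({Suc c..v} \<inter> (Y - {c}))"
  proof (cases "v < x")
    case True
    have "{Suc c..v} \<inter> insert x (X - {c}) = {Suc c..v}" using X True by auto
    moreover have "card {c, Suc c} \<le> card ({c..v} \<inter> Y)"
      by (rule card_mono) (use v c in auto)
    ultimately show ?thesis using Y' by simp
  next
    case False
    have "{Suc c..v} \<inter> insert x (X - {c}) = insert x (({c..v} \<inter> X) - {c})"
      using False cx v by auto
    then have "card ({Suc c..v} \<inter> insert x (X - {c})) = Suc (card (({c..v} \<inter> X) - {c}))"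
      using X by simp
    moreover have "card (({c..v} \<inter> X) - {c}) = card ({c..v} \<inter> X) - 1"
      using v c by simp
    moreover have "c \<in> {c..v} \<inter> X" "c \<in> {c..v} \<inter> Y"
      using v c by auto
    then have "card ({c..v} \<inter> X) > 0" "card ({c..v} \<inter> Y) > 0"
      by (metis card_gt_0_iff empty_iff finite_Int finite_atLeastAtMost)+
    moreover have "card ({c..v} \<inter> X) + card ({c..v} \<inter> Y) > Suc v - c"
      using ah v unfolding ahead_def by auto
    ultimately show ?thesis using Y' v by auto
  qed
qed

text \<open>This secures the shifted endpoint. At \<open>v = x\<close> the set \<open>X\<close> has
  exactly \<open>x - c\<close> elements, so the strict inequality asks for two elements of
  \<open>Y\<close> up to \<open>x\<close>. If \<open>Suc c\<close> were missing, at most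
  \<open>c\<close> would be left: either \<open>x = Suc c\<close>, or \<open>gap\<close> pushes
  \<open>Suc c\<close> beyond the maximum \<open>m\<close> of \<open>Y\<close>.\<close>

lemma ahead_Suc_mem:
  assumes ah: "ahead n c X Y" and Y: "Y \<subseteq> {c..m}" "m \<in> Y"
    and X: "{c..<x} \<subseteq> X" "x \<notin> X" and cx: "c < x" and xn: "x \<le> n"
    and gap: "{c..<x} \<inter> {..m} \<subseteq> Y"
  shows "Suc c \<in> Y"
proof (rule ccontr)
  assume S: "Suc c \<notin> Y"
  have lt: "\<not> (Suc c < x \<and> Suc c \<le> m)"
  proof
    assume "Suc c < x \<and> Suc c \<le> m"
    then have "Suc c \<in> {c..<x} \<inter> {..m}" by auto
    then show False using gap S by blast
  qed
  have "card ({c..x} \<inter> X) + card ({c..x} \<inter> Y) > Suc x - c"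
    using ah xn cx unfolding ahead_def by auto
  moreover have "{c..x} \<inter> X = {c..<x}" using X by (auto simp: le_less)
  moreover have "card ({c..x} \<inter> Y) \<le> 1"
  proof (cases "Suc c < x")
    case True
    then have "Y \<subseteq> {c}" using lt Y by force
    then have "{c..x} \<inter> Y \<subseteq> {c}" by auto
    then have "card ({c..x} \<inter> Y) \<le> card {c}" by (rule card_mono[rotated]) simp
    then show ?thesis by simp
  next
    case False
    then have "x = Suc c" using cx by simp
    then have "{c..x} \<inter> Y \<subseteq> {c}" using S by (auto simp: le_Suc_eq)
    then have "card ({c..x} \<inter> Y) \<le> card {c}" by (rule card_mono[rotated]) simp
    then show ?thesis by simp
  qed
  ultimately show False using cx by auto
qed

lemma card_le_Suc_card_Diff: "card X \<le> Suc (card (X - {w}))"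
  by (cases "w \<in> X"; cases "finite X") (simp_all add: card_Diff_singleton_if)

text \<open>The loss at \<open>w\<close> is felt only in initial segments that already count the
  smaller \<open>m\<close>, so no initial count decreases.\<close>

lemma ahead_swap:
  assumes ah: "ahead n c X Y" and "m \<notin> X" "m < w" "c \<le> m"
  shows "ahead n c (insert m (X - {w})) Y"
  unfolding ahead_def
proof
  fix v assume v: "v \<in> {c..n}"
  have "card ({c..v} \<inter> X) \<le> card ({c..v} \<inter> insert m (X - {w}))"
  proof (cases "m \<in> {c..v}")
    case True
    then have "{c..v} \<inter> insert m (X - {w}) = insert m (({c..v} \<inter> X) - {w})" by auto
    then have "card ({c..v} \<inter> insert m (X - {w})) = Suc (card (({c..v} \<inter> X) - {w}))"
      using assms by simp
    then show ?thesis using card_le_Suc_card_Diff by simp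
  next
    case False
    then show ?thesis
      using assms by (intro card_mono) auto
  qed
  then show "Suc v - c < card ({c..v} \<inter> insert m (X - {w})) + card ({c..v} \<inter> Y)"
    using ah v unfolding ahead_def by (meson add_le_mono1 less_le_trans)
qed

text \<open>Removing the upper bound \<open>w\<close> is felt only for \<open>v\<close> at least
  \<open>w\<close>, where \<open>X\<close> is already exhausted. Up to there \<open>Y\<close> lacks
  at most \<open>n - v\<close> of its elements, so a surplus of two at \<open>n\<close> is still a
  surplus of two at \<open>v\<close>, and one of it may be spent.\<close>

lemma ahead_remove:
  assumes ah: "ahead n c X Y" and X: "X \<subseteq> {..w}"
    and tot: "card ({c..n} \<inter> X) + card ({c..n} \<inter> Y) > Suc (Suc n - c)"
  shows "ahead n c (X - {w}) Y"
  unfolding ahead_def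
proof
  fix v assume v: "v \<in> {c..n}"
  have a: "card ({c..v} \<inter> X) + card ({c..v} \<inter> Y) > Suc v - c"
    using ah v unfolding ahead_def by auto
  have eq: "{c..v} \<inter> (X - {w}) = ({c..v} \<inter> X) - {w}" by auto
  show "Suc v - c < card ({c..v} \<inter> (X - {w})) + card ({c..v} \<inter> Y)"
  proof (cases "v < w")
    case True
    then have "({c..v} \<inter> X) - {w} = {c..v} \<inter> X" by auto
    then show ?thesis using a eq by simp
  next
    case False
    then have "{c..n} \<inter> X = {c..v} \<inter> X" using X v by auto
    moreover have "card ({c..n} \<inter> Y) \<le> card (({c..v} \<inter> Y) \<union> {Suc v..n})"
      by (rule card_mono) auto
    moreover have "card (({c..v} \<inter> Y) \<union> {Suc v..n}) \<le> card ({c..v} \<inter> Y) + (n - v)"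
      by (rule order_trans[OF card_Un_le]) simp
    moreover have "card ({c..v} \<inter> X) \<le> Suc (card (({c..v} \<inter> X) - {w}))"
      by (rule card_le_Suc_card_Diff)
    ultimately show ?thesis using tot v eq by auto
  qed
qed

section \<open>Triplets with explicit endpoints, and the move that closes one gap\<close>

definition balanced_at :: "nat \<Rightarrow> nat \<Rightarrow> nat \<Rightarrow> nat \<Rightarrow> nat set \<Rightarrow> nat set \<Rightarrow> nat set \<Rightarrow> bool" where
  "balanced_at n a b c A B C \<longleftrightarrow>
     a \<le> n \<and> b \<le> n \<and> c \<le> n \<and>
     A \<subseteq> {c..n - b} \<and> c \<in> A \<and> n - b \<in> A \<and>
     B \<subseteq> {a..n - c} \<and> a \<in> B \<and> n - c \<in> B \<and>
     C \<subseteq> {b..n - a} \<and> b \<in> C \<and> n - a \<in> C \<and>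
     n = a + b + c + card ({c..n - b} - A) + card ({a..n - c} - B) + card ({b..n - a} - C) \<and>
     ahead n c A (bar n B) \<and> ahead n a B (bar n C) \<and> ahead n b C (bar n A)"

lemma balanced_degree_triplet_iff:
  "balanced_degree_triplet n A B C \<longleftrightarrow> (\<exists>a b c. balanced_at n a b c A B C)"
  unfolding balanced_degree_triplet_def balanced_at_def ahead_iff by blast

lemma balanced_at_rotate: "balanced_at n a b c A B C \<Longrightarrow> balanced_at n b c a B C A"
  unfolding balanced_at_def by simp

lemma bar_Diff_singleton: "D \<subseteq> {..n} \<Longrightarrow> c \<le> n \<Longrightarrow> bar n (D - {c}) = bar n D - {n - c}"
  by (force simp: bar_def)

lemma bar_insert: "bar n (insert x D) = insert (n - x) (bar n D)"
  by (simp add: bar_def)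

lemma first_gap:
  fixes X :: "nat set"
  assumes "{c..m} - X \<noteq> {}"
  obtains x where "c \<le> x" "x \<le> m" "x \<notin> X" "{c..<x} \<subseteq> X"
proof
  define x where "x = (LEAST x. x \<in> {c..m} - X)"
  have "\<exists>x. x \<in> {c..m} - X" using assms by auto
  then have x: "x \<in> {c..m} - X" unfolding x_def by (rule LeastI_ex)
  then show "c \<le> x" "x \<le> m" "x \<notin> X" by auto
  show "{c..<x} \<subseteq> X"
  proof
    fix z assume z: "z \<in> {c..<x}"
    then have "z \<notin> {c..m} - X" unfolding x_def using not_less_Least by auto
    then show "z \<in> X" using z x by auto
  qed
qed

text \<open>Counting both sets by their gaps and inserting condition (2) shows that the surplus of
  the pair \<open>B\<close>, \<open>bar n C\<close> at \<open>v = n\<close> is one plus the gap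
  number \<open>e\<close> of the third set. This is why a gap in \<open>A\<close> allows that pair
  to lose an element.\<close>

lemma total_card:
  assumes B: "B \<subseteq> {a..n - c}" and C: "C \<subseteq> {b..n - a}"
    and n: "n = a + b + c + e + card ({a..n - c} - B) + card ({b..n - a} - C)"
  shows "card ({a..n} \<inter> B) + card ({a..n} \<inter> bar n C) = Suc n - a + Suc e"
proof -
  have complement: "card D + card ({i..j} - D) = Suc j - i" if "D \<subseteq> {i..j}" for D and i j :: nat
    using card_Int_Diff[of "{i..j}" D] that by (simp add: Int_absorb1)
  have le: "a + b + c \<le> n" using n by linarith
  have "B \<subseteq> {a..n}" using B by (rule order_trans) auto
  then have 1: "card ({a..n} \<inter> B) = card B" by (simp add: Int_absorb1)
  have "bar n C \<subseteq> {a..n - b}" using bar_subset[OF C] le by simp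
  then have "bar n C \<subseteq> {a..n}" by (rule order_trans) auto
  then have 2: "card ({a..n} \<inter> bar n C) = card C"
    using card_bar[OF subset_atMost[OF C]] by (simp add: Int_absorb1)
  define gB gC where "gB = card ({a..n - c} - B)" and "gC = card ({b..n - a} - C)"
  have "card B + gB = Suc (n - c) - a" "card C + gC = Suc (n - a) - b"
    using complement[OF B] complement[OF C] by (simp_all only: gB_def gC_def)
  moreover have n': "n = a + b + c + e + gB + gC" using n by (simp only: gB_def gC_def)
  have "n - c = a + b + e + gB + gC" "n - a = b + c + e + gB + gC" by (subst n', simp)+
  ultimately have "card B = Suc (b + e + gC)" "card C = Suc (c + e + gB)" by simp_all
  moreover have "Suc n - a = Suc (b + c + e + gB + gC)" by (subst n', simp)
  ultimately show ?thesis by (simp add: 1 2)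
qed

text \<open>Each counting condition has its own reason: \<open>A\<close> and \<open>bar n B\<close>
  get a shifted start and a filled gap; \<open>B\<close> and \<open>bar n C\<close> pay for the loss
  of the maximum \<open>n - c\<close> from the surplus due to the gap in \<open>A\<close>; and
  \<open>bar n A\<close> trades \<open>n - c\<close> for the smaller \<open>n - x\<close>. Condition
  (2) survives because \<open>c\<close> grows by one while one gap of \<open>A\<close>
  disappears.\<close>

lemma balanced_at_move_left:
  assumes bal: "balanced_at n a b c A B C"
    and x: "c < x" "x \<le> n - b" "x \<notin> A" "{c..<x} \<subseteq> A"
    and gap: "{c..<x} \<inter> {..n - a} \<subseteq> bar n B"
  shows "balanced_at n a b (Suc c) (insert x (A - {c})) (B - {n - c}) C"
proof -
  define eA where "eA = card ({c..n - b} - A)"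
  have A: "A \<subseteq> {c..n - b}" "c \<in> A" "n - b \<in> A" and B: "B \<subseteq> {a..n - c}" "a \<in> B" "n - c \<in> B"
    and C: "C \<subseteq> {b..n - a}" "b \<in> C" "n - a \<in> C" and le: "a \<le> n" "b \<le> n" "c \<le> n"
    and n: "n = a + b + c + eA + card ({a..n - c} - B) + card ({b..n - a} - C)"
    and ah: "ahead n c A (bar n B)" "ahead n a B (bar n C)" "ahead n b C (bar n A)"
    using bal unfolding balanced_at_def eA_def by - (elim conjE, assumption)+
  have sub: "A \<subseteq> {..n}" "B \<subseteq> {..n}" "C \<subseteq> {..n}" using subset_atMost A B C by blast+
  have eA: "eA = Suc (card ({Suc c..n - b} - insert x (A - {c})))"
  proof -
    have "{c..n - b} - A = insert x ({Suc c..n - b} - insert x (A - {c}))"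
      using x A by (auto simp: le_eq_less_or_eq)
    then show ?thesis unfolding eA_def by simp
  qed
  have barB: "c \<in> bar n B" "n - a \<in> bar n B" "bar n B \<subseteq> {c..n - a}"
    using B le bar_subset[OF B(1)] by (auto simp: mem_bar_iff[OF sub(2)])
  \<comment> \<open>Reflected, this says that \<open>n - Suc c\<close> lies in \<open>B\<close>; it
    becomes the new upper endpoint.\<close>
  have Sc: "Suc c \<in> bar n B"
    by (rule ahead_Suc_mem[OF ah(1) barB(3,2) x(4,3,1) _ gap]) (use x in simp)
  then have Sc': "Suc c \<le> n" "n - Suc c \<in> B" by (auto simp: mem_bar_iff[OF sub(2)])
  then have ac: "a \<le> n - Suc c" using B by auto
  have "ahead n (Suc c) (insert x (A - {c})) (bar n B - {c})"
    by (rule ahead_Suc) (use ah x A barB Sc in auto)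
  then have 1: "ahead n (Suc c) (insert x (A - {c})) (bar n (B - {n - c}))"
    using le by (simp add: bar_Diff_singleton[OF sub(2)])
  have 2: "ahead n a (B - {n - c}) (bar n C)"
  proof (rule ahead_remove[OF ah(2)])
    show "Suc (Suc n - a) < card ({a..n} \<inter> B) + card ({a..n} \<inter> bar n C)"
      using total_card[OF B(1) C(1) n] eA by simp
  qed (use B in auto)
  have "ahead n b (insert (n - x) (bar n A - {n - c})) C"
    by (rule ahead_swap)
      (use ah(3) x le in \<open>auto simp: ahead_commute mem_bar_iff[OF sub(1)]\<close>)
  then have 3: "ahead n b C (bar n (insert x (A - {c})))"
    using le by (simp add: bar_Diff_singleton[OF sub(1)] bar_insert ahead_commute)
  have eB: "{a..n - Suc c} - (B - {n - c}) = {a..n - c} - B"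
    using B(3) Sc'(1) ac by (auto simp: le_eq_less_or_eq)
  have "Suc c \<in> insert x (A - {c})" using x by (cases "x = Suc c") auto
  moreover have "n - b \<in> insert x (A - {c})" using x A by auto
  moreover have "insert x (A - {c}) \<subseteq> {Suc c..n - b}"
  proof -
    have "A - {c} \<subseteq> {Suc c..n - b}" using A(1) by force
    then show ?thesis using x by simp
  qed
  moreover have "B - {n - c} \<subseteq> {a..n - Suc c}"
  proof
    fix z assume "z \<in> B - {n - c}"
    then have "z \<in> {a..n - c}" "z \<noteq> n - c" using B(1) by blast+
    then show "z \<in> {a..n - Suc c}" by auto
  qed
  moreover have "a \<in> B - {n - c}" "n - Suc c \<in> B - {n - c}" using B ac Sc' by auto
  moreover have "n = a + b + Suc c + card ({Suc c..n - b} - insert x (A - {c}))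
      + card ({a..n - Suc c} - (B - {n - c})) + card ({b..n - a} - C)"
    unfolding eB using n eA by simp
  ultimately show ?thesis
    unfolding balanced_at_def using 1 2 3 C le Sc'(1) by - (intro conjI; assumption)
qed

text \<open>Mirror image of the preceding move under exchange of \<open>A\<close> and
  \<open>bar n B\<close>, possible because \<open>ahead\<close> is symmetric in its two sets. Now
  \<open>C\<close> and \<open>bar n A\<close> form the pair that loses an element, with the surplus
  coming from the gap in \<open>B\<close>.\<close>

lemma balanced_at_move_right:
  assumes bal: "balanced_at n a b c A B C"
    and x: "c < x" "x \<le> n - a" "x \<notin> bar n B" "{c..<x} \<subseteq> bar n B"
    and gap: "{c..<x} \<inter> {..n - b} \<subseteq> A"
  shows "balanced_at n a b (Suc c) (A - {c}) (insert (n - x) (B - {n - c})) C"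
proof -
  define eB where "eB = card ({a..n - c} - B)"
  have A: "A \<subseteq> {c..n - b}" "c \<in> A" "n - b \<in> A" and B: "B \<subseteq> {a..n - c}" "a \<in> B" "n - c \<in> B"
    and C: "C \<subseteq> {b..n - a}" "b \<in> C" "n - a \<in> C" and le: "a \<le> n" "b \<le> n" "c \<le> n"
    and n: "n = a + b + c + card ({c..n - b} - A) + eB + card ({b..n - a} - C)"
    and ah: "ahead n c A (bar n B)" "ahead n a B (bar n C)" "ahead n b C (bar n A)"
    using bal unfolding balanced_at_def eB_def by - (elim conjE, assumption)+
  have sub: "A \<subseteq> {..n}" "B \<subseteq> {..n}" "C \<subseteq> {..n}" using subset_atMost A B C by blast+
  have xn: "x \<le> n" "n - x \<notin> B" using x by (auto simp: mem_bar_iff[OF sub(2)])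
  have barB: "c \<in> bar n B" using B le by (auto simp: mem_bar_iff[OF sub(2)])
  have Sc: "Suc c \<in> A"
    by (rule ahead_Suc_mem[where n = n, OF _ A(1,3) x(4,3,1) _ gap]) (use x ah ahead_commute in auto)
  then have cb: "Suc c \<le> n - b" using A by auto
  have nx: "n - x \<in> {a..n - Suc c}" using x le by auto
  have eB: "eB = Suc (card ({a..n - Suc c} - insert (n - x) (B - {n - c})))"
  proof -
    have "{a..n - c} - B = insert (n - x) ({a..n - Suc c} - insert (n - x) (B - {n - c}))"
      using nx xn B(3) x(1) by (auto simp: le_eq_less_or_eq)
    then show ?thesis unfolding eB_def by simp
  qed
  have "ahead n (Suc c) (insert x (bar n B - {c})) (A - {c})"
    by (rule ahead_Suc) (use ah x A barB Sc ahead_commute in auto)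
  then have 1: "ahead n (Suc c) (A - {c}) (bar n (insert (n - x) (B - {n - c})))"
    using le xn by (simp add: bar_Diff_singleton[OF sub(2)] bar_insert ahead_commute)
  have "ahead n b (bar n A - {n - c}) C"
  proof (rule ahead_remove)
    show "ahead n b (bar n A) C" using ah(3) ahead_commute by blast
    show "bar n A \<subseteq> {..n - c}" using bar_subset[OF A(1)] le by auto
    \<comment> \<open>Condition (2) for the rotated triplet, so that the gaps of \<open>B\<close>
      take the place of \<open>e\<close> in \<open>total_card\<close>.\<close>
    have "n = b + c + a + eB + card ({b..n - a} - C) + card ({c..n - b} - A)" using n by simp
    from total_card[OF C(1) A(1) this]
    show "Suc (Suc n - b) < card ({b..n} \<inter> bar n A) + card ({b..n} \<inter> C)"
      using eB by simp
  qed
  then have 3: "ahead n b C (bar n (A - {c}))"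
    using le by (simp add: bar_Diff_singleton[OF sub(1)] ahead_commute)
  have 2: "ahead n a (insert (n - x) (B - {n - c})) (bar n C)"
    by (rule ahead_swap[OF ah(2) xn(2)]) (use x(1,2) le in linarith)+
  have eA: "{Suc c..n - b} - (A - {c}) = {c..n - b} - A"
    using A(2) by (auto simp: le_eq_less_or_eq)
  have "insert (n - x) (B - {n - c}) \<subseteq> {a..n - Suc c}"
  proof
    fix z assume z: "z \<in> insert (n - x) (B - {n - c})"
    show "z \<in> {a..n - Suc c}"
    proof (cases "z = n - x")
      case False
      then have "z \<in> {a..n - c}" "z \<noteq> n - c" using B(1) z by blast+
      then show ?thesis by auto
    qed (use nx in simp)
  qed
  moreover have "A - {c} \<subseteq> {Suc c..n - b}" using A(1) by force
  moreover have "n - Suc c \<in> insert (n - x) (B - {n - c})"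
  proof (cases "x = Suc c")
    case False
    then have "Suc c \<in> bar n B" using x by auto
    then have "Suc c \<le> n" "n - Suc c \<in> B" by (auto simp: mem_bar_iff[OF sub(2)])
    then show ?thesis by auto
  qed simp
  moreover have "a \<in> insert (n - x) (B - {n - c})" using B x le by auto
  moreover have "Suc c \<in> A - {c}" "n - b \<in> A - {c}" using A Sc cb by auto
  moreover have "n = a + b + Suc c + card ({Suc c..n - b} - (A - {c}))
      + card ({a..n - Suc c} - insert (n - x) (B - {n - c})) + card ({b..n - a} - C)"
    unfolding eA using n eB by simp
  moreover have "Suc c \<le> n" using cb by simp
  ultimately show ?thesis
    unfolding balanced_at_def using 1 2 3 C le by - (intro conjI; assumption)
qed

text \<open>The earlier of the first gaps of \<open>A\<close> and of \<open>bar n B\<close> is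
  filled. Below it both sets are complete within their own intervals, which is the last hypothesis
  of either move.\<close>

lemma balanced_at_move:
  assumes bal: "balanced_at n a b c A B C"
    and e: "{c..n - b} - A \<noteq> {} \<or> {a..n - c} - B \<noteq> {}"
  shows "(\<exists>x. x \<notin> A \<and> balanced_at n a b (Suc c) (insert x (A - {c})) (B - {n - c}) C) \<or>
         (\<exists>x. x \<notin> B \<and> balanced_at n a b (Suc c) (A - {c}) (insert x (B - {n - c})) C)"
proof -
  have A: "A \<subseteq> {c..n - b}" "c \<in> A" and B: "B \<subseteq> {a..n - c}" "n - c \<in> B" and le: "c \<le> n" "a \<le> n"
    using bal unfolding balanced_at_def by auto
  have sub: "B \<subseteq> {..n}" using B subset_atMost by blast
  have cB: "c \<in> bar n B" using B le by (auto simp: mem_bar_iff[OF sub])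
  have barB: "{c..n - a} - bar n B \<noteq> {}" if "{a..n - c} - B \<noteq> {}"
  proof -
    from that obtain z where z: "z \<in> {a..n - c} - B" by (metis ex_in_conv)
    then have "n - z \<in> {c..n - a} - bar n B" using le z by (auto simp: mem_bar_iff[OF sub])
    then show ?thesis by blast
  qed
  have L: ?thesis if "c \<le> x" "x \<le> n - b" "x \<notin> A" "{c..<x} \<subseteq> A" "{c..<x} \<inter> {..n - a} \<subseteq> bar n B" for x
  proof -
    have "c < x" using that A by (cases "x = c") auto
    then show ?thesis using balanced_at_move_left[OF bal] that by blast
  qed
  have R: ?thesis if "c \<le> y" "y \<le> n - a" "y \<notin> bar n B" "{c..<y} \<subseteq> bar n B" "{c..<y} \<inter> {..n - b} \<subseteq> A" for y
  proof -
    have "c < y" using that cB by (cases "y = c") auto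
    moreover have "n - y \<notin> B" using that by (auto simp: mem_bar_iff[OF sub])
    ultimately show ?thesis using balanced_at_move_right[OF bal] that by blast
  qed
  show ?thesis
  proof (cases "{c..n - b} - A = {}")
    case True
    then have "{c..n - a} - bar n B \<noteq> {}" using e barB by blast
    then obtain y where "c \<le> y" "y \<le> n - a" "y \<notin> bar n B" "{c..<y} \<subseteq> bar n B" by (rule first_gap)
    then show ?thesis using R[of y] True by fastforce
  next
    case False
    then obtain x where x: "c \<le> x" "x \<le> n - b" "x \<notin> A" "{c..<x} \<subseteq> A" by (rule first_gap)
    show ?thesis
    proof (cases "{c..<x} \<inter> {..n - a} \<subseteq> bar n B")
      case False
      then have "{c..n - a} - bar n B \<noteq> {}" by auto
      then obtain y where y: "c \<le> y" "y \<le> n - a" "y \<notin> bar n B" "{c..<y} \<subseteq> bar n B" by (rule first_gap)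
      have "y < x" using False y by force
      then show ?thesis using R[of y] x y by force
    qed (use L x in blast)
  qed
qed

section \<open>Polynomials with prescribed supports\<close>

definition transf :: "nat \<Rightarrow> rat poly \<Rightarrow> rat poly" where
  "transf n f = (\<Sum>d\<le>n. smult (coeff f d) ([:1, -1:] ^ (n - d)))"

lemma degree_transf: "degree (transf n f) \<le> n"
  unfolding transf_def
proof (rule degree_sum_le)
  fix d assume "d \<in> {..n}"
  have "degree (smult (coeff f d) ([:1, -1:] ^ (n - d))) \<le> degree ([:1, -1:] :: rat poly) * (n - d)"
    by (rule order_trans[OF degree_smult_le degree_power_le])
  then show "degree (smult (coeff f d) ([:1, -1:] ^ (n - d))) \<le> n" by simp
qed simp

lemma transf_diff: "transf n (f - g) = transf n f - transf n g"
  by (simp add: transf_def smult_diff_left sum_subtractf)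

lemma transf_smult: "transf n (smult k f) = smult k (transf n f)"
  by (rule poly_eqI) (simp add: transf_def coeff_sum sum_distrib_left mult.assoc)

lemma poly_eq_sum_le:
  fixes p :: "'a :: {comm_semiring_0, semiring_1} poly"
  assumes "degree p \<le> n"
  shows "poly p x = (\<Sum>i\<le>n. coeff p i * x ^ i)"
  unfolding poly_altdef
  by (rule sum.mono_neutral_left) (use assms in \<open>auto simp: coeff_eq_0\<close>)

text \<open>The degree bound matters: the coefficientwise definition drops everything beyond
  \<open>n\<close>.\<close>

lemma poly_transf:
  assumes "degree f \<le> n" "s \<noteq> 1"
  shows "poly (transf n f) s = (1 - s) ^ n * poly f (1 / (1 - s))"
proof -
  have "poly (transf n f) s = (\<Sum>d\<le>n. coeff f d * (1 - s) ^ (n - d))"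
    by (simp add: transf_def poly_sum)
  also have "\<dots> = (\<Sum>d\<le>n. (1 - s) ^ n * (coeff f d * (1 / (1 - s)) ^ d))"
    by (rule sum.cong) (use assms in \<open>simp_all add: power_diff power_divide\<close>)
  also have "\<dots> = (1 - s) ^ n * poly f (1 / (1 - s))"
    using assms by (simp add: poly_eq_sum_le sum_distrib_left)
  finally show ?thesis .
qed

text \<open>The square of s -> 1/(1-s) is s -> (s-1)/s, and the two factors multiply to (-s)^n.
  Excluding 0 and 1 keeps both substitutions away from the pole.\<close>

lemma poly_transf_transf:
  assumes "degree f \<le> n" "s \<noteq> 0" "s \<noteq> 1"
  shows "poly (transf n (transf n f)) s = (- s) ^ n * poly f ((s - 1) / s)"
proof -
  have "1 / (1 - s) \<noteq> 1" using assms by (simp add: field_simps)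
  moreover have "1 / (1 - 1 / (1 - s)) = (s - 1) / s" using assms by (simp add: field_simps)
  ultimately have "poly (transf n (transf n f)) s
      = ((1 - s) * (1 - 1 / (1 - s))) ^ n * poly f ((s - 1) / s)"
    using assms by (simp add: poly_transf degree_transf power_mult_distrib)
  also have "(1 - s) * (1 - 1 / (1 - s)) = - s" using assms by (simp add: field_simps)
  finally show ?thesis .
qed

text \<open>Allows polynomial identities to be checked away from the poles of the
  substitutions.\<close>

lemma poly_eqI_cofinite:
  fixes p q :: "'a :: {idom, ring_char_0} poly"
  assumes "finite E" "\<And>s. s \<notin> E \<Longrightarrow> poly p s = poly q s"
  shows "p = q"
proof (rule ccontr)
  assume "p \<noteq> q"
  then have "finite {s. poly (p - q) s = 0}" by (intro poly_roots_finite) simp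
  moreover have "- E \<subseteq> {s. poly (p - q) s = 0}" using assms by auto
  ultimately have "finite (- E)" by (rule rev_finite_subset)
  then show False using assms(1) by (metis finite_compl infinite_UNIV_char_0)
qed

text \<open>The substitution returns to s after three rounds, and the bases of the accumulated n-th
  powers multiply to -1.\<close>

lemma transf_transf_transf:
  assumes "degree f \<le> n"
  shows "transf n (transf n (transf n f)) = smult ((- 1) ^ n) f"
proof (rule poly_eqI_cofinite[where E = "{0, 1}"])
  fix s :: rat assume "s \<notin> {0, 1}"
  then have s: "s \<noteq> 0" "s \<noteq> 1" by auto
  have "1 / (1 - s) \<noteq> 0" "1 / (1 - s) \<noteq> 1" using s by (auto simp: field_simps)
  moreover have "(1 / (1 - s) - 1) / (1 / (1 - s)) = s" using s by (simp add: field_simps)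
  ultimately have "poly (transf n (transf n f)) (1 / (1 - s)) = (- (1 / (1 - s))) ^ n * poly f s"
    using poly_transf_transf[OF assms, of "1 / (1 - s)"] by simp
  then have "poly (transf n (transf n (transf n f))) s
      = ((1 - s) * (- (1 / (1 - s)))) ^ n * poly f s"
    by (subst power_mult_distrib) (simp add: poly_transf[OF degree_transf s(2)])
  also have "(1 - s) * (- (1 / (1 - s))) = -1" using s by (simp add: field_simps)
  finally show "poly (transf n (transf n (transf n f))) s = poly (smult ((- 1) ^ n) f) s" by simp
qed simp

text \<open>A monomial of degree \<open>d\<close> contributes a polynomial of degree at most
  \<open>n - d\<close>. Once exponents up to \<open>c\<close> are absent, nothing reaches degree
  \<open>n - c\<close>.\<close>

lemma coeff_transf_eq_0:
  assumes "\<And>d. d \<le> c \<Longrightarrow> coeff f d = 0" "c \<le> n"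
  shows "coeff (transf n f) (n - c) = 0"
proof -
  have "coeff (smult (coeff f d) ([:1, -1:] ^ (n - d))) (n - c) = 0" if "d \<le> n" for d
  proof (cases "d \<le> c")
    case False
    have "degree ([:1, -1:] ^ (n - d) :: rat poly) \<le> degree ([:1, -1:] :: rat poly) * (n - d)"
      by (rule degree_power_le)
    also have "\<dots> < n - c" using False that assms by simp
    finally show ?thesis by (simp add: coeff_eq_0)
  qed (simp add: assms)
  then show ?thesis by (simp add: transf_def coeff_sum del: coeff_smult)
qed

section \<open>Solutions with prescribed supports and their uniqueness up to a factor\<close>

definition sol :: "nat \<Rightarrow> nat set \<Rightarrow> nat set \<Rightarrow> nat set \<Rightarrow> rat poly \<Rightarrow> bool" where
  "sol n A B C f \<longleftrightarrow> degree f \<le> n \<and> (\<forall>i. i \<notin> A \<longrightarrow> coeff f i = 0) \<and>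
     (\<forall>i. i \<notin> B \<longrightarrow> coeff (transf n f) i = 0) \<and>
     (\<forall>i. i \<notin> C \<longrightarrow> coeff (transf n (transf n f)) i = 0)"

lemma sol_diff_smult: "sol n A B C f \<Longrightarrow> sol n A B C g \<Longrightarrow> sol n A B C (g - smult k f)"
  unfolding sol_def by (simp add: transf_diff transf_smult degree_diff_le)

lemma sol_mono: "sol n A B C f \<Longrightarrow> A \<subseteq> A' \<Longrightarrow> B \<subseteq> B' \<Longrightarrow> C \<subseteq> C' \<Longrightarrow> sol n A' B' C' f"
  unfolding sol_def by blast

lemma sol_rotate: "sol n A B C f \<Longrightarrow> sol n B C A (transf n f)"
  unfolding sol_def by (simp add: transf_transf_transf degree_transf)

definition unique_sol :: "nat \<Rightarrow> nat set \<Rightarrow> nat set \<Rightarrow> nat set \<Rightarrow> bool" where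
  "unique_sol n A B C \<longleftrightarrow> (\<forall>f g. sol n A B C f \<and> sol n A B C g \<and> f \<noteq> 0 \<longrightarrow> (\<exists>k. g = smult k f))"

text \<open>Since its cube is a sign, \<open>transf n\<close> is injective in degree at most
  \<open>n\<close>, so proportionality of transforms can be carried back.\<close>

lemma unique_sol_rotate:
  assumes "unique_sol n B C A"
  shows "unique_sol n A B C"
  unfolding unique_sol_def
proof (intro allI impI, elim conjE)
  fix f g assume f: "sol n A B C f" and g: "sol n A B C g" and nz: "f \<noteq> 0"
  have deg: "degree f \<le> n" "degree g \<le> n" using f g by (auto simp: sol_def)
  have "transf n f \<noteq> 0"
  proof
    assume "transf n f = 0"
    then have "transf n (transf n (transf n f)) = 0" by (simp add: transf_def)
    then show False using deg nz by (simp add: transf_transf_transf)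
  qed
  then obtain k where "transf n g = smult k (transf n f)"
    using assms sol_rotate[OF f] sol_rotate[OF g] unfolding unique_sol_def by blast
  then have "transf n (transf n (transf n g)) = smult k (transf n (transf n (transf n f)))"
    by (simp add: transf_smult)
  then have "smult ((-1) ^ n) g = smult ((-1) ^ n) (smult k f)"
    using deg by (simp add: transf_transf_transf mult.commute)
  then have "smult ((-1) ^ n) (g - smult k f) = 0" by (simp add: smult_diff_right)
  then have "g = smult k f" by simp
  then show "\<exists>k. g = smult k f" ..
qed

text \<open>Support of the transform in degrees \<open>a\<close> to \<open>n - c\<close> makes
  \<open>f\<close> divisible by \<open>w\<close>. Support of \<open>f\<close> in degrees up to
  \<open>n - b\<close>, which is now \<open>c + a\<close>, leaves no room for a nonconstant
  cofactor.\<close>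

lemma unique_sol_full:
  assumes bal: "balanced_at n a b c A B C"
    and full: "{c..n - b} - A = {}" "{a..n - c} - B = {}" "{b..n - a} - C = {}"
  shows "unique_sol n A B C"
proof -
  have A: "A \<subseteq> {c..n - b}" and B: "B \<subseteq> {a..n - c}"
    and "n = a + b + c + card ({c..n - b} - A) + card ({a..n - c} - B) + card ({b..n - a} - C)"
    using bal unfolding balanced_at_def by - (elim conjE, assumption)+
  then have n: "n = a + b + c" by (simp only: full card.empty add_0_right)
  define w :: "rat poly" where "w = monom 1 c * [:-1, 1:] ^ a"
  have degw: "degree w = c + a" and w0: "w \<noteq> 0"
    unfolding w_def by (simp_all add: degree_mult_eq degree_monom_eq degree_linear_power)
  have key: "\<exists>k. f = smult k w" if f: "sol n A B C f" for f
  proof -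
    define h where "h = transf n f"
    have hB: "coeff h j = 0" if "j \<notin> {a..n - c}" for j
      using f that B unfolding sol_def h_def by blast
    have deg: "degree f \<le> n" using f by (simp add: sol_def)
    define q where "q = (\<Sum>j\<in>{a..n - c}. smult (coeff h j) (monom 1 (n - c - j) * [:-1, 1:] ^ (j - a)))"
    have "f = w * q"
    proof (rule poly_eqI_cofinite[where E = "{0, 1}"])
      fix s :: rat assume "s \<notin> {0, 1}"
      then have s: "s \<noteq> 0" "s \<noteq> 1" by auto
      \<comment> \<open>Two more applications of the transform lead from \<open>h\<close> back to
        \<open>f\<close> up to a sign, which expresses \<open>f\<close> through the coefficients of
        \<open>h\<close>.\<close>
      have "(-1) ^ n * poly f s = (- s) ^ n * poly h ((s - 1) / s)"
        using poly_transf_transf[OF degree_transf s, of n f] transf_transf_transf[OF deg]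
        by (simp add: h_def)
      then have "(-1) ^ n * poly f s = (-1) ^ n * (s ^ n * poly h ((s - 1) / s))"
        by (simp add: power_minus[of s])
      then have "poly f s = s ^ n * poly h ((s - 1) / s)" by simp
      also have "poly h ((s - 1) / s) = (\<Sum>j\<le>n. coeff h j * ((s - 1) / s) ^ j)"
        by (rule poly_eq_sum_le) (simp add: h_def degree_transf)
      also have "\<dots> = (\<Sum>j\<in>{a..n - c}. coeff h j * ((s - 1) / s) ^ j)"
        by (rule sum.mono_neutral_right) (use hB in auto)
      also have "s ^ n * \<dots> = (\<Sum>j\<in>{a..n - c}. s ^ c * (s - 1) ^ a * (coeff h j * (s ^ (n - c - j) * (s - 1) ^ (j - a))))"
        unfolding sum_distrib_left
      proof (rule sum.cong)
        fix j assume "j \<in> {a..n - c}"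
        \<comment> \<open>The bounds on \<open>j\<close> are what makes every summand s^(n-j)
          (s-1)^j divisible by s^c (s-1)^a.\<close>
        then have "n = c + (n - c - j) + j" "j = a + (j - a)" using n by auto
        then have "s ^ n = s ^ c * s ^ (n - c - j) * s ^ j" "(s - 1) ^ j = (s - 1) ^ a * (s - 1) ^ (j - a)"
          by (metis power_add)+
        then show "s ^ n * (coeff h j * ((s - 1) / s) ^ j) = s ^ c * (s - 1) ^ a * (coeff h j * (s ^ (n - c - j) * (s - 1) ^ (j - a)))"
          using s by (simp add: power_divide)
      qed simp
      also have "\<dots> = poly (w * q) s"
        by (simp add: w_def q_def poly_monom poly_sum sum_distrib_left mult_ac)
      finally show "poly f s = poly (w * q) s" .
    qed simp
    moreover have "degree q = 0"
    proof (rule ccontr)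
      assume q: "degree q \<noteq> 0"
      then have "q \<noteq> 0" by auto
      then have "degree f = c + a + degree q" using \<open>f = w * q\<close> w0 degw by (simp add: degree_mult_eq)
      moreover have "degree f \<notin> A" using calculation q A n by fastforce
      then have "coeff f (degree f) = 0" using f unfolding sol_def by blast
      then have "f = 0" by simp
      ultimately show False using q by simp
    qed
    then obtain k where "q = [:k:]" by (rule degree_eq_zeroE)
    ultimately show ?thesis by auto
  qed
  show ?thesis
    unfolding unique_sol_def
  proof (intro allI impI, elim conjE)
    fix f g assume "sol n A B C f" "sol n A B C g" and nz: "f \<noteq> 0"
    then obtain k l where kl: "f = smult k w" "g = smult l w" using key by meson
    then have "k \<noteq> 0" using nz by auto
    then have "g = smult (l / k) f" using kl by simp
    then show "\<exists>k. g = smult k f" ..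
  qed
qed

lemma unique_sol_step:
  assumes bal: "balanced_at n a b c A B C"
    and gap: "{c..n - b} - A \<noteq> {} \<or> {a..n - c} - B \<noteq> {}"
    and existence: "\<And>A B C. balanced_degree_triplet n A B C \<Longrightarrow>
      \<exists>f. sol n A B C f \<and> (\<forall>i\<in>A. coeff f i \<noteq> 0) \<and> (\<forall>i\<in>B. coeff (transf n f) i \<noteq> 0)"
    and IH: "\<And>A' B'. balanced_at n a b (Suc c) A' B' C \<Longrightarrow> unique_sol n A' B' C"
  shows "unique_sol n A B C"
  unfolding unique_sol_def
proof (intro allI impI, elim conjE, rule ccontr)
  fix f g assume f: "sol n A B C f" and g: "sol n A B C g" and nz: "f \<noteq> 0"
    and np: "\<nexists>k. g = smult k f"
  have A: "A \<subseteq> {c..n - b}" and c: "c \<le> n" using bal by (auto simp: balanced_at_def)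
  have "\<exists>h. sol n A B C h \<and> h \<noteq> 0 \<and> coeff h c = 0"
  proof (cases "coeff f c = 0")
    case False
    let ?k = "coeff g c / coeff f c"
    have "coeff (g - smult ?k f) c = 0" using False by simp
    moreover have "g - smult ?k f \<noteq> 0" using np by auto
    ultimately show ?thesis using sol_diff_smult[OF f g] by blast
  qed (use f nz in blast)
  then obtain h where h: "sol n A B C h" "h \<noteq> 0" "coeff h c = 0" by blast
  have hA: "coeff h i = 0" if "i \<notin> A" for i using h that by (simp add: sol_def)
  have hB: "coeff (transf n h) i = 0" if "i \<notin> B" for i using h that by (simp add: sol_def)
  \<comment> \<open>\<open>c\<close> is the lower end of the support, so its vanishing coefficient
    makes \<open>h\<close> vanish to order greater than \<open>c\<close> at 0, and the top
    coefficient of the transform vanishes as well.\<close>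
  have "coeff h d = 0" if "d \<le> c" for d
    using h(3) hA[of d] A that by (cases "d = c") force+
  then have "coeff (transf n h) (n - c) = 0" using c by (rule coeff_transf_eq_0)
  then have h': "sol n (A - {c}) (B - {n - c}) C h"
    using h unfolding sol_def by auto
  from balanced_at_move[OF bal gap] show False
  proof (elim disjE exE conjE)
    fix x assume x: "x \<notin> A" and bal': "balanced_at n a b (Suc c) (insert x (A - {c})) (B - {n - c}) C"
    then obtain f' where f': "sol n (insert x (A - {c})) (B - {n - c}) C f'" "coeff f' x \<noteq> 0"
      using existence balanced_degree_triplet_iff by (metis insertI1)
    have "sol n (insert x (A - {c})) (B - {n - c}) C h" using h' by (rule sol_mono) auto
    then obtain k where "f' = smult k h" using IH[OF bal'] f' h unfolding unique_sol_def by blast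
    then show False using f' hA[OF x] by simp
  next
    fix x assume x: "x \<notin> B" and bal': "balanced_at n a b (Suc c) (A - {c}) (insert x (B - {n - c})) C"
    then obtain f' where f': "sol n (A - {c}) (insert x (B - {n - c})) C f'" "coeff (transf n f') x \<noteq> 0"
      using existence balanced_degree_triplet_iff by (metis insertI1)
    have "sol n (A - {c}) (insert x (B - {n - c})) C h" using h' by (rule sol_mono) auto
    then obtain k where "f' = smult k h" using IH[OF bal'] f' h unfolding unique_sol_def by blast
    then show False using f' hB[OF x] by (simp add: transf_smult)
  qed
qed

theorem unique_sol_balanced:
  assumes existence: "\<And>A B C. balanced_degree_triplet n A B C \<Longrightarrow>
      \<exists>f. sol n A B C f \<and> (\<forall>i\<in>A. coeff f i \<noteq> 0) \<and> (\<forall>i\<in>B. coeff (transf n f) i \<noteq> 0)"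
    and "balanced_degree_triplet n A B C"
  shows "unique_sol n A B C"
proof -
  obtain a b c where "balanced_at n a b c A B C" using assms(2) balanced_degree_triplet_iff by blast
  then show ?thesis
  \<comment> \<open>By condition (2) this measure is the total number of gaps. Every move raises one
    of the three parameters.\<close>
  proof (induction "n - (a + b + c)" arbitrary: a b c A B C rule: less_induct)
    case less
    have n: "n = a + b + c + card ({c..n - b} - A) + card ({a..n - c} - B) + card ({b..n - a} - C)"
      using less.prems unfolding balanced_at_def by - (elim conjE, assumption)+
    have incr: "m < m + x + y + z" if "x > 0 \<or> y > 0 \<or> z > 0" for m x y z :: nat
      using that by auto
    consider (1) "{c..n - b} - A \<noteq> {} \<or> {a..n - c} - B \<noteq> {}"
      | (2) "{a..n - c} - B \<noteq> {} \<or> {b..n - a} - C \<noteq> {}"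
      | (3) "{c..n - b} - A = {}" "{a..n - c} - B = {}" "{b..n - a} - C = {}" by blast
    then show ?case
    proof cases
      case 1
      then have "card ({c..n - b} - A) > 0 \<or> card ({a..n - c} - B) > 0"
        by (simp add: card_gt_0_iff)
      then have "a + b + c < n" by (subst n, intro incr) blast
      then have "unique_sol n A' B' C" if "balanced_at n a b (Suc c) A' B' C" for A' B'
        using less.hyps[OF _ that] by simp
      then show ?thesis using unique_sol_step[OF less.prems 1 existence] by blast
    next
      \<comment> \<open>A gap in \<open>C\<close> alone is reached by rotating once, which puts
        \<open>C\<close> in the second place.\<close>
      case 2
      then have "card ({a..n - c} - B) > 0 \<or> card ({b..n - a} - C) > 0"
        by (simp add: card_gt_0_iff)
      then have "a + b + c < n" by (subst n, intro incr) blast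
      then have "unique_sol n A' B' A" if "balanced_at n b c (Suc a) A' B' A" for A' B'
        using less.hyps[OF _ that] by simp
      then have "unique_sol n B C A"
        using unique_sol_step[OF balanced_at_rotate[OF less.prems] 2 existence] by blast
      then show ?thesis by (rule unique_sol_rotate)
    next
      case 3
      then show ?thesis by (rule unique_sol_full[OF less.prems])
    qed
  qed
qed

section \<open>Euler characteristics of quasi-isomorphic complexes\<close>

context vector_space
begin

section \<open>Dimensions of subspaces, and maps that are linear only on a subspace\<close>

lemma dim_zero_space: "dim {0} = 0"
  using dim_unique[of "{}" "{0}" 0] independent_empty by simp

lemma independent_finite: "finite T \<Longrightarrow> V \<subseteq> span T \<Longrightarrow> B \<subseteq> V \<Longrightarrow> independent B \<Longrightarrow> finite B"
  using independent_span_bound[of T B] by blast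

text \<open>Such a \<open>\<pi>\<close> replaces the quotient map by \<open>W\<close>, so that cohomology can be handled without quotient spaces.\<close>

lemma subspace_kernel_linear:
  assumes "subspace W"
  obtains \<pi> where "Vector_Spaces.linear scale scale \<pi>" "{x. \<pi> x = 0} = W"
proof -
  interpret vector_space_pair scale scale by unfold_locales
  obtain B where B: "B \<subseteq> W" "independent B" "W \<subseteq> span B" by (rule maximal_independent_subset)
  have W: "span B = W" using B span_minimal[OF _ assms] by blast
  define C where "C = extend_basis B"
  have C: "B \<subseteq> C" "independent C" "span C = UNIV"
    unfolding C_def using extend_basis_superset[OF B(2)] independent_extend_basis[OF B(2)]
      span_extend_basis[OF B(2)] by blast+
  obtain \<pi> where \<pi>: "Vector_Spaces.linear scale scale \<pi>" "\<forall>x\<in>C. \<pi> x = (if x \<in> B then 0 else x)"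
    using linear_independent_extend[OF C(2), of "\<lambda>x. if x \<in> B then 0 else x"] by blast
  interpret \<pi>: Vector_Spaces.linear scale scale \<pi> by fact
  have zero: "\<pi> x = 0" if "x \<in> span B" for x
    by (rule \<pi>.eq_0_on_span[OF _ that]) (use \<pi>(2) C(1) in \<open>simp add: subset_iff\<close>)
  have idt: "\<pi> x = x" if "x \<in> span (C - B)" for x
    by (rule linear_eq_on[OF \<pi>(1) linear_ident that]) (use \<pi>(2) in auto)
  have "x \<in> W" if x: "\<pi> x = 0" for x
  proof -
    have "x \<in> span (B \<union> (C - B))" using C by (simp add: Un_absorb1)
    then obtain a b where ab: "x = a + b" "a \<in> span B" "b \<in> span (C - B)"
      unfolding span_Un by blast
    then have "\<pi> x = b" by (simp add: \<pi>.add zero idt)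
    then show ?thesis using x ab W by simp
  qed
  then have "{x. \<pi> x = 0} = W" using zero W by blast
  with \<pi>(1) show ?thesis by (rule that)
qed

text \<open>A dual basis criterion: duality with \<open>u\<close> makes the family \<open>v\<close>
  independent, the expansion makes it spanning. Linearity of \<open>u\<close> is asked only on
  \<open>V\<close>, which is all that functionals on a graded piece provide.\<close>

lemma dim_eq_card_coordinates:
  assumes J: "finite J" and v: "\<And>j. j \<in> J \<Longrightarrow> v j \<in> V"
    and V: "subspace V"
    and add: "\<And>j x y. j \<in> J \<Longrightarrow> x \<in> V \<Longrightarrow> y \<in> V \<Longrightarrow> u j (x + y) = u j x + u j y"
    and scale: "\<And>j c x. j \<in> J \<Longrightarrow> x \<in> V \<Longrightarrow> u j (scale c x) = c * u j x"
    and dual: "\<And>j k. j \<in> J \<Longrightarrow> k \<in> J \<Longrightarrow> u j (v k) = (if j = k then 1 else 0)"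
    and expand: "\<And>x. x \<in> V \<Longrightarrow> x = (\<Sum>j\<in>J. scale (u j x) (v j))"
  shows "dim V = card J" "V \<subseteq> span (v ` J)"
proof -
  have inj: "inj_on v J"
    by (rule inj_onI) (metis dual zero_neq_one)
  \<comment> \<open>Stated for all subsets \<open>K\<close> of \<open>J\<close>, since the induction
    runs over them and the empty one yields that \<open>u j\<close> vanishes at 0.\<close>
  have u_sum: "u j (\<Sum>k\<in>K. scale (a k) (v k)) = (\<Sum>k\<in>K. a k * u j (v k))"
    if "j \<in> J" "K \<subseteq> J" for j K a
  proof -
    have "finite K" using that J finite_subset by blast
    then show ?thesis using that(2)
    proof (induction K)
      case empty
      have "u j (scale 0 0) = 0 * u j 0" by (rule scale) (use that V subspace_0 in auto)
      then show ?case by simp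
    next
      case (insert k K)
      have "(\<Sum>k\<in>K. scale (a k) (v k)) \<in> V"
        by (rule subspace_sum[OF V], rule subspace_scale[OF V]) (use insert v in auto)
      then show ?case using insert v that V by (simp add: add scale subspace_scale)
    qed
  qed
  have "independent (v ` J)"
  proof (rule independent_if_scalars_zero)
    fix a x assume s: "(\<Sum>x\<in>v ` J. scale (a x) x) = 0" and "x \<in> v ` J"
    then obtain j where j: "j \<in> J" "x = v j" by blast
    have "(\<Sum>k\<in>J. scale (a (v k)) (v k)) = 0" using s inj by (simp add: sum.reindex)
    then have "u j 0 = (\<Sum>k\<in>J. a (v k) * u j (v k))" using u_sum[OF j(1), of J "\<lambda>k. a (v k)"] by simp
    also have "\<dots> = (\<Sum>k\<in>J. if j = k then a (v k) else 0)"
      by (rule sum.cong) (use dual j in auto)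
    also have "\<dots> = a x" using J j by simp
    finally show "a x = 0" using u_sum[OF j(1), of "{}" "\<lambda>_. 0"] by simp
  qed (use J in simp)
  moreover show span: "V \<subseteq> span (v ` J)"
  proof
    fix x assume "x \<in> V"
    then have "x = (\<Sum>j\<in>J. scale (u j x) (v j))" by (rule expand)
    also have "\<dots> \<in> span (v ` J)" by (intro span_sum span_scale span_base) blast
    finally show "x \<in> span (v ` J)" .
  qed
  ultimately show "dim V = card J"
    using dim_unique[of "v ` J" V "card J"] v inj by (auto simp: card_image)
qed

end

text \<open>Differentials and comparison maps are controlled only on carriers inside larger function
  spaces, so linearity has to be relative to a set.\<close>

definition linear_on :: "('a \<Rightarrow> 'b \<Rightarrow> 'b) \<Rightarrow> ('a \<Rightarrow> 'c \<Rightarrow> 'c) \<Rightarrow> 'b set \<Rightarrow> ('b::ab_group_add \<Rightarrow> 'c::ab_group_add) \<Rightarrow> bool"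
  where "linear_on s1 s2 V f \<longleftrightarrow> (\<forall>x\<in>V. \<forall>y\<in>V. f (x + y) = f x + f y) \<and> (\<forall>c. \<forall>x\<in>V. f (s1 c x) = s2 c (f x))"

context vector_space_pair
begin

lemma linear_on_subspaces:
  assumes V: "vs1.subspace V" and f: "linear_on s1 s2 V f"
  shows "f 0 = 0" "vs1.subspace {x \<in> V. f x = 0}" "vs2.subspace (f ` V)"
proof -
  have "f (s1 0 0) = s2 0 (f 0)" using f V vs1.subspace_0 unfolding linear_on_def by blast
  then show 0: "f 0 = 0" by simp
  show "vs1.subspace {x \<in> V. f x = 0}"
    by (rule vs1.subspaceI)
      (use V f 0 in \<open>auto simp: linear_on_def vs1.subspace_0 vs1.subspace_add vs1.subspace_scale\<close>)
  show "vs2.subspace (f ` V)"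
  proof (rule vs2.subspaceI)
    show "0 \<in> f ` V" using 0 V vs1.subspace_0 by (metis image_eqI)
  next
    fix x y assume "x \<in> f ` V" "y \<in> f ` V"
    then obtain x' y' where "x' \<in> V" "y' \<in> V" "x = f x'" "y = f y'" by blast
    then have "x + y = f (x' + y')" "x' + y' \<in> V"
      using f V vs1.subspace_add unfolding linear_on_def by auto
    then show "x + y \<in> f ` V" by blast
  next
    fix c x assume "x \<in> f ` V"
    then obtain x' where "x' \<in> V" "x = f x'" by blast
    then have "s2 c x = f (s1 c x')" "s1 c x' \<in> V"
      using f V vs1.subspace_scale unfolding linear_on_def by auto
    then show "s2 c x \<in> f ` V" by blast
  qed
qed

text \<open>A basis of the kernel is extended to one of \<open>V\<close>. As \<open>f\<close> is
  arbitrary off \<open>V\<close>, it is replaced by a globally linear \<open>g\<close> that agrees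
  with it on \<open>V\<close>; this \<open>g\<close> is injective on the span of the added basis
  vectors.\<close>

lemma rank_nullity:
  assumes V: "vs1.subspace V" and T: "finite T" "V \<subseteq> vs1.span T" and f: "linear_on s1 s2 V f"
  shows "vs1.dim V = vs1.dim {x \<in> V. f x = 0} + vs2.dim (f ` V)"
proof -
  let ?K = "{x \<in> V. f x = 0}"
  have K: "vs1.subspace ?K" by (rule linear_on_subspaces[OF V f])
  obtain B where B: "B \<subseteq> ?K" "vs1.independent B" "?K \<subseteq> vs1.span B"
    by (rule vs1.maximal_independent_subset)
  have KB: "vs1.span B = ?K" using B vs1.span_minimal[OF B(1) K] by blast
  have "B \<subseteq> V" using B by auto
  then obtain C where C: "B \<subseteq> C" "C \<subseteq> V" "vs1.independent C" "V \<subseteq> vs1.span C"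
    using vs1.maximal_independent_subset_extend[OF _ B(2)] by metis
  have VC: "vs1.span C = V" using C vs1.span_minimal[OF C(2) V] by blast
  have fin: "finite C" using vs1.independent_finite[OF T C(2,3)] .
  then have finB: "finite B" using C finite_subset by blast
  obtain g where g: "Vector_Spaces.linear s1 s2 g" "\<forall>x\<in>C. g x = f x"
    using linear_independent_extend[OF C(3)] by blast
  interpret g: Vector_Spaces.linear s1 s2 g by fact
  have "vs1.subspace {x \<in> V. f x = g x}"
    by (rule vs1.subspaceI)
      (use V f linear_on_subspaces(1)[OF V f] in \<open>auto simp: linear_on_def vs1.subspace_0 vs1.subspace_add vs1.subspace_scale g.add g.scale g.zero\<close>)
  then have "vs1.span C \<subseteq> {x \<in> V. f x = g x}"
    by (rule vs1.span_minimal[rotated]) (use g C in auto)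
  then have fg: "f x = g x" if "x \<in> V" for x using that VC by auto
  have inj: "inj_on g (vs1.span (C - B))"
  proof (subst g.inj_on_iff_eq_0[OF vs1.subspace_span], intro ballI impI)
    fix x assume x: "x \<in> vs1.span (C - B)" and gx: "g x = 0"
    have "x \<in> V" using x VC vs1.span_mono[of "C - B" C] by auto
    then have "x \<in> vs1.span B" using gx fg KB by auto
    then obtain a where a: "x = (\<Sum>v\<in>B. s1 (a v) v)" unfolding vs1.span_finite[OF finB] by blast
    have "finite (C - B)" using fin by simp
    from x obtain b where b: "x = (\<Sum>v\<in>C - B. s1 (b v) v)"
      unfolding vs1.span_finite[OF \<open>finite (C - B)\<close>] by blast
    \<comment> \<open>The difference of the two expansions of \<open>x\<close>, read as a single
      relation among the vectors of \<open>C\<close>.\<close>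
    let ?c = "\<lambda>v. if v \<in> B then a v else - b v"
    have "(\<Sum>v\<in>C - B. s1 (?c v) v) = (\<Sum>v\<in>C - B. - s1 (b v) v)"
      by (rule sum.cong) auto
    then have "(\<Sum>v\<in>C - B. s1 (?c v) v) = - x"
      unfolding sum_negf by (rule trans) (rule arg_cong[OF b[symmetric]])
    moreover have "(\<Sum>v\<in>B. s1 (?c v) v) = (\<Sum>v\<in>B. s1 (a v) v)"
      by (rule sum.cong) auto
    then have "(\<Sum>v\<in>B. s1 (?c v) v) = x" by (rule trans) (rule a[symmetric])
    ultimately have "(\<Sum>v\<in>C. s1 (?c v) v) = 0"
      using sum.subset_diff[OF C(1) fin, of "\<lambda>v. s1 (?c v) v"] by (simp only: add.left_inverse)
    then have "?c v = 0" if "v \<in> C" for v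
      by (rule vs1.independentD[OF C(3) fin subset_refl _ that, where u = ?c])
    then have "\<forall>v\<in>B. a v = 0" using C(1) by force
    then have "(\<Sum>v\<in>B. s1 (a v) v) = 0" by (intro sum.neutral) simp
    then show "x = 0" by (simp only: a)
  qed
  have ind: "vs2.independent (g ` (C - B))"
    by (rule linear_independent_injective_image[OF g(1) _ inj])
      (use C vs1.independent_mono in blast)
  have inj': "inj_on g (C - B)" using inj vs1.span_superset by (rule inj_on_subset)
  have img: "f ` V = vs2.span (g ` (C - B))"
  proof -
    have "f ` V = g ` V" using fg by auto
    also have "\<dots> = vs2.span (g ` C)" using VC g.span_image by metis
    also have "\<dots> = vs2.span (g ` (C - B))"
    proof -
      have "g x = 0" if "x \<in> B" for x using that B fg by force
      then have "g ` C \<subseteq> insert 0 (g ` (C - B))" by auto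
      then have "vs2.span (g ` C) \<subseteq> vs2.span (g ` (C - B))"
        by (metis vs2.span_insert_0 vs2.span_mono)
      then show ?thesis using vs2.span_mono[of "g ` (C - B)" "g ` C"] by auto
    qed
    finally show ?thesis .
  qed
  have "vs1.dim V = card C" using C VC vs1.dim_unique[of C V] by blast
  moreover have "vs1.dim ?K = card B" using B vs1.dim_unique[of B ?K] by blast
  moreover have "vs2.dim (f ` V) = card (g ` (C - B))"
    unfolding img using ind by (rule vs2.dim_span_eq_card_independent)
  moreover have "card (g ` (C - B)) = card (C - B)" using inj' by (rule card_image)
  moreover have "card (C - B) = card C - card B" using C finB by (simp add: card_Diff_subset)
  moreover have "card B \<le> card C" using C fin by (simp add: card_mono)
  ultimately show ?thesis by simp
qed

end

section \<open>Alternating sums of dimensions\<close>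

definition alt :: "int \<Rightarrow> int" where
  "alt i = (if even i then 1 else -1)"

text \<open>A shift of the index turns the second summand into the negative of the first. Terms can
  remain only at the ends of the blocks of \<open>I\<close>, and there \<open>e\<close> is zero;
  \<open>I\<close> itself may have holes.\<close>

lemma alt_sum_telescope:
  fixes e :: "int \<Rightarrow> int"
  assumes I: "finite I" and e: "\<And>i. i \<notin> I \<Longrightarrow> e i = 0" "\<And>i. i \<notin> I \<Longrightarrow> e (i + 1) = 0"
  shows "(\<Sum>i\<in>I. alt i * (e i + e (i + 1))) = 0"
proof -
  have "(\<Sum>i\<in>I. alt i * e (i + 1)) = (\<Sum>j\<in>(\<lambda>i. i + 1) ` I. - (alt j * e j))"
    by (subst sum.reindex) (auto simp: alt_def intro!: sum.cong)
  also have "\<dots> = (\<Sum>j\<in>(\<lambda>i. i + 1) ` I \<inter> I. - (alt j * e j))"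
    by (rule sum.mono_neutral_right) (use I e in auto)
  also have "\<dots> = (\<Sum>j\<in>I. - (alt j * e j))"
  proof (rule sum.mono_neutral_left)
    show "\<forall>i\<in>I - (\<lambda>i. i + 1) ` I \<inter> I. - (alt i * e i) = 0"
    proof
      fix i assume i: "i \<in> I - (\<lambda>i. i + 1) ` I \<inter> I"
      \<comment> \<open>\<open>i\<close> begins a block of \<open>I\<close>, so the second vanishing
        hypothesis applies at its predecessor.\<close>
      then have "i - 1 \<notin> I" by (auto simp: image_iff)
      then show "- (alt i * e i) = 0" using e(2)[of "i - 1"] by simp
    qed
  qed (use I in auto)
  finally show ?thesis by (simp add: distrib_left sum.distrib sum_negf)
qed

context vector_space_pair
begin

text \<open>Cohomology never appears as a space: \<open>inj\<close> and \<open>surj\<close> express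
  bijectivity on classes through elements, at position \<open>i + 1\<close> so that the coboundaries
  come from position \<open>i\<close>. Rank and nullity write each difference of dimensions as
  \<open>e i + e (i + 1)\<close>, and the alternating sum telescopes.\<close>

theorem euler_characteristic_quasi_iso:
  fixes V :: "int \<Rightarrow> 'b set" and W :: "int \<Rightarrow> 'c set"
  assumes I: "finite I" "\<And>i. i \<notin> I \<Longrightarrow> V i = {0}" "\<And>i. i \<notin> I \<Longrightarrow> W i = {0}"
    and V: "\<And>i. vs1.subspace (V i)" "\<And>i. \<exists>T. finite T \<and> V i \<subseteq> vs1.span T"
    and W: "\<And>i. vs2.subspace (W i)" "\<And>i. \<exists>T. finite T \<and> W i \<subseteq> vs2.span T"
    and d: "\<And>i. linear_on s1 s1 (V i) (d i)" "\<And>i. d i ` V i \<subseteq> V (i + 1)"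
      "\<And>i x. x \<in> V i \<Longrightarrow> d (i + 1) (d i x) = 0"
    and \<delta>: "\<And>i. linear_on s2 s2 (W i) (\<delta> i)" "\<And>i. \<delta> i ` W i \<subseteq> W (i + 1)"
      "\<And>i x. x \<in> W i \<Longrightarrow> \<delta> (i + 1) (\<delta> i x) = 0"
    and \<phi>: "\<And>i. linear_on s1 s2 (V i) (\<phi> i)" "\<And>i. \<phi> i ` V i \<subseteq> W i"
      "\<And>i x. x \<in> V i \<Longrightarrow> \<phi> (i + 1) (d i x) = \<delta> i (\<phi> i x)"
    and inj: "\<And>i x. x \<in> V (i + 1) \<Longrightarrow> d (i + 1) x = 0 \<Longrightarrow> \<phi> (i + 1) x \<in> \<delta> i ` W i \<Longrightarrow> x \<in> d i ` V i"
    and surj: "\<And>i y. y \<in> W (i + 1) \<Longrightarrow> \<delta> (i + 1) y = 0 \<Longrightarrow>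
      \<exists>x\<in>V (i + 1). d (i + 1) x = 0 \<and> y - \<phi> (i + 1) x \<in> \<delta> i ` W i"
  shows "(\<Sum>i\<in>I. alt i * int (vs1.dim (V i))) = (\<Sum>i\<in>I. alt i * int (vs2.dim (W i)))"
proof -
  interpret p1: vector_space_pair s1 s1 by unfold_locales
  interpret p2: vector_space_pair s2 s2 by unfold_locales
  define Z Z' where "Z i = {x \<in> V i. d i x = 0}" and "Z' i = {x \<in> W i. \<delta> i x = 0}" for i
  have subs: "vs1.subspace (Z i)" "vs2.subspace (Z' i)" "vs1.subspace (d i ` V i)" "vs2.subspace (\<delta> i ` W i)" for i
    unfolding Z_def Z'_def
    using p1.linear_on_subspaces[OF V(1) d(1)] p2.linear_on_subspaces[OF W(1) \<delta>(1)] by blast+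
  have cohom: "int (vs2.dim (Z' (i + 1))) - int (vs2.dim (\<delta> i ` W i))
      = int (vs1.dim (Z (i + 1))) - int (vs1.dim (d i ` V i))" for i
  proof -
    let ?j = "i + 1"
    \<comment> \<open>\<open>\<pi>\<close> models the passage to cohomology. On the cocycles of
      \<open>W\<close>, and after \<open>\<phi>\<close> on those of \<open>V\<close>, its kernel
      consists of the respective coboundaries, the second time by \<open>inj\<close>. The images
      agree by \<open>surj\<close>, so both cohomology dimensions do.\<close>
    obtain \<pi> where \<pi>: "Vector_Spaces.linear s2 s2 \<pi>" "{x. \<pi> x = 0} = \<delta> i ` W i"
      using vs2.subspace_kernel_linear[OF subs(4)] by blast
    interpret \<pi>: Vector_Spaces.linear s2 s2 \<pi> by fact
    obtain T where T: "finite T" "V ?j \<subseteq> vs1.span T" using V by blast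
    obtain T' where T': "finite T'" "W ?j \<subseteq> vs2.span T'" using W by blast
    have "linear_on s2 s2 (Z' ?j) \<pi>" by (simp add: linear_on_def \<pi>.add \<pi>.scale)
    then have "vs2.dim (Z' ?j) = vs2.dim {x \<in> Z' ?j. \<pi> x = 0} + vs2.dim (\<pi> ` Z' ?j)"
      by (rule p2.rank_nullity[OF subs(2) T'(1), rotated]) (use T' in \<open>auto simp: Z'_def\<close>)
    moreover have "\<delta> i ` W i \<subseteq> Z' ?j" using \<delta>(2,3) by (auto simp: Z'_def)
    then have "{x \<in> Z' ?j. \<pi> x = 0} = \<delta> i ` W i" using \<pi>(2) by blast
    moreover have "linear_on s1 s2 (Z ?j) (\<lambda>x. \<pi> (\<phi> ?j x))"
      using \<phi>(1)[of ?j] by (auto simp: linear_on_def Z_def \<pi>.add \<pi>.scale)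
    then have "vs1.dim (Z ?j) = vs1.dim {x \<in> Z ?j. \<pi> (\<phi> ?j x) = 0} + vs2.dim ((\<lambda>x. \<pi> (\<phi> ?j x)) ` Z ?j)"
      by (rule rank_nullity[OF subs(1) T(1), rotated]) (use T in \<open>auto simp: Z_def\<close>)
    moreover have "{x \<in> Z ?j. \<pi> (\<phi> ?j x) = 0} = d i ` V i"
    proof
      show "{x \<in> Z ?j. \<pi> (\<phi> ?j x) = 0} \<subseteq> d i ` V i"
      proof
        fix x assume "x \<in> {x \<in> Z ?j. \<pi> (\<phi> ?j x) = 0}"
        then have "x \<in> V ?j" "d ?j x = 0" "\<phi> ?j x \<in> \<delta> i ` W i"
          using \<pi>(2) by (auto simp: Z_def)
        then show "x \<in> d i ` V i" by (rule inj)
      qed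
      show "d i ` V i \<subseteq> {x \<in> Z ?j. \<pi> (\<phi> ?j x) = 0}"
      proof
        fix y assume "y \<in> d i ` V i"
        then obtain x where x: "x \<in> V i" "y = d i x" by blast
        then have "\<phi> ?j y = \<delta> i (\<phi> i x)" using \<phi>(3) by simp
        then have "\<pi> (\<phi> ?j y) = 0" using \<phi>(2) x \<pi>(2) by blast
        then show "y \<in> {x \<in> Z ?j. \<pi> (\<phi> ?j x) = 0}" using x d(2,3) by (auto simp: Z_def)
      qed
    qed
    moreover have "(\<lambda>x. \<pi> (\<phi> ?j x)) ` Z ?j = \<pi> ` Z' ?j"
    proof
      have "\<phi> ?j x \<in> Z' ?j" if "x \<in> Z ?j" for x
      proof -
        have "x \<in> V ?j" "d ?j x = 0" using that by (auto simp: Z_def)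
        then have "\<delta> ?j (\<phi> ?j x) = \<phi> (?j + 1) 0" using \<phi>(3) by metis
        also have "\<dots> = 0" using linear_on_subspaces(1)[OF V(1) \<phi>(1)] .
        finally show ?thesis using \<phi>(2) \<open>x \<in> V ?j\<close> by (auto simp: Z'_def)
      qed
      then show "(\<lambda>x. \<pi> (\<phi> ?j x)) ` Z ?j \<subseteq> \<pi> ` Z' ?j" by blast
      show "\<pi> ` Z' ?j \<subseteq> (\<lambda>x. \<pi> (\<phi> ?j x)) ` Z ?j"
      proof
        fix z assume "z \<in> \<pi> ` Z' ?j"
        then obtain y where y: "y \<in> W ?j" "\<delta> ?j y = 0" "z = \<pi> y" by (auto simp: Z'_def)
        then obtain x where x: "x \<in> V ?j" "d ?j x = 0" "y - \<phi> ?j x \<in> \<delta> i ` W i" using surj by blast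
        then have "\<pi> (y - \<phi> ?j x) = 0" using \<pi>(2) by blast
        then have "z = \<pi> (\<phi> ?j x)" using y by (simp add: \<pi>.diff)
        then show "z \<in> (\<lambda>x. \<pi> (\<phi> ?j x)) ` Z ?j" using x by (auto simp: Z_def)
      qed
    qed
    ultimately show ?thesis by simp
  qed
  \<comment> \<open>\<open>e i\<close> is the discrepancy between the coboundaries in position
    \<open>i\<close>, the part that equality of cohomology leaves free.\<close>
  define e where "e i = int (vs1.dim (d (i - 1) ` V (i - 1))) - int (vs2.dim (\<delta> (i - 1) ` W (i - 1)))" for i
  have dims: "int (vs1.dim (V i)) - int (vs2.dim (W i)) = e i + e (i + 1)" for i
  proof -
    obtain T where "finite T" "V i \<subseteq> vs1.span T" using V(2) by blast
    then have "vs1.dim (V i) = vs1.dim (Z i) + vs1.dim (d i ` V i)"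
      unfolding Z_def by (rule p1.rank_nullity[OF V(1) _ _ d(1)])
    moreover obtain T' where "finite T'" "W i \<subseteq> vs2.span T'" using W(2) by blast
    then have "vs2.dim (W i) = vs2.dim (Z' i) + vs2.dim (\<delta> i ` W i)"
      unfolding Z'_def by (rule p2.rank_nullity[OF W(1) _ _ \<delta>(1)])
    ultimately show ?thesis using cohom[of "i - 1"] by (simp add: e_def)
  qed
  have e1: "e (i + 1) = 0" if "i \<notin> I" for i
  proof -
    have "d i ` V i = {0}" "\<delta> i ` W i = {0}"
      using I(2,3)[OF that] p1.linear_on_subspaces(1)[OF V(1) d(1)] p2.linear_on_subspaces(1)[OF W(1) \<delta>(1)] by auto
    then show ?thesis by (simp add: e_def vs1.dim_zero_space vs2.dim_zero_space)
  qed
  \<comment> \<open>Position \<open>i - 1\<close> may lie in \<open>I\<close>, so this comes from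
    \<open>dims\<close> at \<open>i\<close> together with the vanishing of
    \<open>e (i + 1)\<close>.\<close>
  have e0: "e i = 0" if "i \<notin> I" for i
  proof -
    have "vs1.dim (V i) = 0" "vs2.dim (W i) = 0"
      using I(2,3)[OF that] vs1.dim_zero_space vs2.dim_zero_space by simp_all
    then show ?thesis using dims[of i] e1[OF that] by simp
  qed
  have "(\<Sum>i\<in>I. alt i * int (vs1.dim (V i))) - (\<Sum>i\<in>I. alt i * int (vs2.dim (W i)))
      = (\<Sum>i\<in>I. alt i * (e i + e (i + 1)))"
    unfolding sum_subtractf[symmetric] dims[symmetric] by (simp add: right_diff_distrib)
  then show ?thesis using alt_sum_telescope[where e = e, OF I(1) e0 e1] by simp
qed

end

section \<open>Free squarefree modules\<close>

lemma mdeg_of_zero: "mdeg_of 0 = 0"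
  by (simp add: mdeg_of_def fun_eq_iff)

lemma mdeg_of_add: "mdeg_of (a + b) = mdeg_of a + mdeg_of b"
  by (simp add: mdeg_of_def fun_eq_iff lookup_add)

definition expo :: "nat set \<Rightarrow> (nat \<Rightarrow>\<^sub>0 nat)" where
  "expo R = (\<Sum>i\<in>R. Poly_Mapping.single i 1)"

lemma lookup_expo:
  assumes "finite R"
  shows "Poly_Mapping.lookup (expo R) i = (if i \<in> R then 1 else 0)"
proof -
  have "Poly_Mapping.lookup (expo R) i = (\<Sum>k\<in>R. if k = i then 1 else 0)"
    unfolding expo_def lookup_sum by (intro sum.cong) (simp_all add: lookup_single when_def)
  then show ?thesis using assms by simp
qed

lemma mdeg_of_expo: "finite R \<Longrightarrow> mdeg_of (expo R) = ind R"
  by (simp add: mdeg_of_def ind_def lookup_expo fun_eq_iff)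

lemma keys_expo: "finite R \<Longrightarrow> Poly_Mapping.keys (expo R) = R"
  by (auto simp: in_keys_iff lookup_expo split: if_splits)

text \<open>A generator of degree \<open>R\<close> contributes at most one monomial to a squarefree
  degree. All dimension counts below, for free modules and for duals, rest on this.\<close>

lemma mdeg_of_add_ind_eq:
  assumes "finite T"
  shows "mdeg_of a + ind R = ind T \<longleftrightarrow> R \<subseteq> T \<and> a = expo (T - R)"
proof
  assume eq: "mdeg_of a + ind R = ind T"
  have at: "int (Poly_Mapping.lookup a i) + ind R i = ind T i" for i
    using fun_cong[OF eq, of i] by (simp add: mdeg_of_def)
  have RT: "R \<subseteq> T"
  proof
    fix i assume "i \<in> R"
    then show "i \<in> T" using at[of i] by (auto simp: ind_def split: if_splits)
  qed
  moreover have "a = expo (T - R)"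
  proof (rule poly_mapping_eqI)
    fix i
    have "int (Poly_Mapping.lookup a i) = int (Poly_Mapping.lookup (expo (T - R)) i)"
      using at[of i] RT assms by (auto simp: ind_def lookup_expo split: if_splits)
    then show "Poly_Mapping.lookup a i = Poly_Mapping.lookup (expo (T - R)) i" by simp
  qed
  ultimately show "R \<subseteq> T \<and> a = expo (T - R)" ..
next
  assume "R \<subseteq> T \<and> a = expo (T - R)"
  then show "mdeg_of a + ind R = ind T"
    using assms by (auto simp: mdeg_of_expo ind_def fun_eq_iff)
qed

lemma carrier_polyring: "carrier (polyring n) = {p. \<forall>a\<in>Poly_Mapping.keys p. Poly_Mapping.keys a \<subseteq> {1..n}}"
  by (simp add: polyring_def)

lemma polyring_zero: "0 \<in> carrier (polyring n)"
  by (simp add: carrier_polyring)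

lemma polyring_add: "p \<in> carrier (polyring n) \<Longrightarrow> q \<in> carrier (polyring n) \<Longrightarrow> p + q \<in> carrier (polyring n)"
  using Poly_Mapping.keys_add[of p q] by (force simp: carrier_polyring)

lemma polyring_uminus: "p \<in> carrier (polyring n) \<Longrightarrow> - p \<in> carrier (polyring n)"
  by (simp add: carrier_polyring in_keys_iff)

lemma polyring_mult:
  assumes "p \<in> carrier (polyring n)" "q \<in> carrier (polyring n)"
  shows "p * q \<in> carrier (polyring n)"
proof -
  have "Poly_Mapping.keys c \<subseteq> {1..n}" if c: "c \<in> Poly_Mapping.keys (p * q)" for c
  proof -
    obtain a b where "c = a + b" "a \<in> Poly_Mapping.keys p" "b \<in> Poly_Mapping.keys q"
      using c keys_mult[of p q] by auto
    then show ?thesis using assms Poly_Mapping.keys_add[of a b] by (fastforce simp: carrier_polyring)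
  qed
  then show ?thesis by (simp add: carrier_polyring)
qed

lemma polyring_single:
  "Poly_Mapping.keys a \<subseteq> {1..n} \<Longrightarrow> Poly_Mapping.single a c \<in> carrier (polyring n)"
  by (simp add: carrier_polyring)

lemma polyring_const: "const_poly c \<in> carrier (polyring n)"
  by (simp add: const_poly_def polyring_single)

lemma const_poly_mult_single: "const_poly c * Poly_Mapping.single a d = Poly_Mapping.single a (c * d)"
  by (simp add: const_poly_def mult_single)

lemma lookup_const_poly_mult: "Poly_Mapping.lookup (const_poly c * p) a = c * Poly_Mapping.lookup p a"
  unfolding const_poly_def by (simp flip: mult_map_scale_conv_mult) (simp add: map.rep_eq when_def)

section \<open>Graded pieces of free modules as vector spaces\<close>

definition fscale :: "'k::field \<Rightarrow> ('b \<Rightarrow> 'k mpoly) \<Rightarrow> ('b \<Rightarrow> 'k mpoly)" where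
  "fscale c f = (\<lambda>j. const_poly c * f j)"

lemma vector_space_fscale: "vector_space fscale"
  by unfold_locales
    (simp_all add: fscale_def fun_eq_iff const_poly_def distrib_left single_add distrib_right mult_single
      flip: mult.assoc)

lemma sum_apply: "(\<Sum>c\<in>C. g c) x = (\<Sum>c\<in>C. g c x)"
  by (induction C rule: infinite_finite_induct) auto

interpretation fs: vector_space fscale
  by (rule vector_space_fscale)

lemma carrier_free_module:
  "carrier (free_module n Rs) = {f. (\<forall>j<length Rs. f j \<in> carrier (polyring n)) \<and> (\<forall>j\<ge>length Rs. f j = 0)}"
  by (simp add: free_module_def)

lemma free_module_simps:
  "\<zero>\<^bsub>free_module n Rs\<^esub> = 0"
  "f \<oplus>\<^bsub>free_module n Rs\<^esub> g = f + g"
  "p \<odot>\<^bsub>free_module n Rs\<^esub> f = (\<lambda>j. p * f j)"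
  by (simp_all add: free_module_def fun_eq_iff)

lemma piece_free_module:
  "piece (free_module n Rs) b = {f \<in> carrier (free_module n Rs).
     \<forall>j<length Rs. \<forall>a\<in>Poly_Mapping.keys (f j). mdeg_of a + ind (Rs ! j) = b}"
  by (simp add: free_module_def)

lemma free_module_closed:
  assumes "f \<in> carrier (free_module n Rs)" "g \<in> carrier (free_module n Rs)"
  shows "f + g \<in> carrier (free_module n Rs)" "- f \<in> carrier (free_module n Rs)"
    "0 \<in> carrier (free_module n Rs)"
    "p \<in> carrier (polyring n) \<Longrightarrow> (\<lambda>j. p * f j) \<in> carrier (free_module n Rs)"
  using assms by (auto simp: carrier_free_module polyring_add polyring_uminus polyring_zero polyring_mult)

lemma free_module_zero: "0 \<in> carrier (free_module n Rs)"
  by (simp add: carrier_free_module polyring_zero)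

lemma fscale_closed: "f \<in> carrier (free_module n Rs) \<Longrightarrow> fscale c f \<in> carrier (free_module n Rs)"
  unfolding fscale_def by (rule free_module_closed(4)) (simp_all add: polyring_const)

lemma subspace_piece_free_module: "fs.subspace (piece (free_module n Rs) b)"
proof (rule fs.subspaceI)
  fix x y :: "nat \<Rightarrow> 'a mpoly" assume xy: "x \<in> piece (free_module n Rs) b" "y \<in> piece (free_module n Rs) b"
  have "Poly_Mapping.keys (x j + y j) \<subseteq> Poly_Mapping.keys (x j) \<union> Poly_Mapping.keys (y j)" for j
    by (rule Poly_Mapping.keys_add)
  then show "x + y \<in> piece (free_module n Rs) b"
    using xy unfolding piece_free_module by (fastforce simp: free_module_closed)
next
  fix c x assume "x \<in> piece (free_module n Rs) b"
  then show "fscale c x \<in> piece (free_module n Rs) b"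
    unfolding piece_free_module
    by (auto simp: fscale_closed in_keys_iff) (auto simp: fscale_def lookup_const_poly_mult in_keys_iff)
qed (simp add: piece_free_module free_module_zero)

text \<open>The monomials x^(T - R), one for each generator with \<open>R\<close> inside
  \<open>T\<close>, form a basis. It is indexed by list positions, so repeated generator degrees
  count with multiplicity.\<close>

lemma piece_free_module_ind:
  assumes T: "T \<subseteq> {1..n}"
  shows "fs.dim (piece (free_module n Rs :: ('k::field mpoly, _) gr_module) (ind T)) = length (filter (\<lambda>R. R \<subseteq> T) Rs)"
    "\<exists>S. finite S \<and> piece (free_module n Rs :: ('k mpoly, _) gr_module) (ind T) \<subseteq> fs.span S"
    "length (filter (\<lambda>R. R \<subseteq> T) Rs) = 0 \<Longrightarrow> piece (free_module n Rs :: ('k mpoly, _) gr_module) (ind T) = {0}"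
proof -
  let ?M = "free_module n Rs :: ('k mpoly, _) gr_module"
  let ?V = "piece ?M (ind T)"
  define J where "J = {j. j < length Rs \<and> Rs ! j \<subseteq> T}"
  have finJ: "finite J" by (simp add: J_def)
  have finT: "finite T" using T finite_subset by blast
  define v where "v j = (\<lambda>k. if k = j then Poly_Mapping.single (expo (T - Rs ! j)) (1::'k) else 0)" for j :: nat
  define u where "u j f = Poly_Mapping.lookup (f j) (expo (T - Rs ! j))" for j and f :: "nat \<Rightarrow> 'k mpoly"
  have v: "v j \<in> ?V" if "j \<in> J" for j
  proof -
    have "Poly_Mapping.keys (expo (T - Rs ! j)) \<subseteq> {1..n}"
      using finT T by (auto simp: keys_expo)
    then show ?thesis
      using that mdeg_of_add_ind_eq[OF finT]
      by (auto simp: v_def J_def piece_free_module carrier_free_module polyring_single polyring_zero)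
  qed
  have expand: "f = (\<Sum>j\<in>J. fscale (u j f) (v j))" if f: "f \<in> ?V" for f
  proof
    fix k
    have "(\<Sum>j\<in>J. fscale (u j f) (v j)) k = (\<Sum>j\<in>J. if j = k then Poly_Mapping.single (expo (T - Rs ! j)) (u j f) else 0)"
      unfolding sum_apply by (rule sum.cong) (simp_all add: fscale_def v_def const_poly_mult_single)
    also have "\<dots> = (if k \<in> J then Poly_Mapping.single (expo (T - Rs ! k)) (u k f) else 0)"
      using finJ by simp
    also have "\<dots> = f k"
    proof (cases "k < length Rs")
      case False
      then show ?thesis using f by (simp add: J_def piece_free_module carrier_free_module)
    next
      case True
      then have keys: "Rs ! k \<subseteq> T \<and> a = expo (T - Rs ! k)" if "a \<in> Poly_Mapping.keys (f k)" for a
        using f that mdeg_of_add_ind_eq[OF finT] by (auto simp: piece_free_module)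
      show ?thesis
      proof (rule poly_mapping_eqI)
        fix a
        show "Poly_Mapping.lookup (if k \<in> J then Poly_Mapping.single (expo (T - Rs ! k)) (u k f) else 0) a = Poly_Mapping.lookup (f k) a"
          using keys[of a] True
          by (auto simp: J_def u_def lookup_single when_def in_keys_iff)
      qed
    qed
    finally show "f k = (\<Sum>j\<in>J. fscale (u j f) (v j)) k" by simp
  qed
  have "fs.dim ?V = card J \<and> ?V \<subseteq> fs.span (v ` J)"
    by (intro conjI; rule fs.dim_eq_card_coordinates[where u = u and v = v and J = J])
      (use finJ v expand in \<open>auto simp: subspace_piece_free_module u_def v_def fscale_def lookup_add lookup_const_poly_mult\<close>)
  moreover have "length (filter (\<lambda>R. R \<subseteq> T) Rs) = card J"
    by (simp add: J_def length_filter_conv_card)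
  ultimately show "fs.dim ?V = length (filter (\<lambda>R. R \<subseteq> T) Rs)" "\<exists>S. finite S \<and> ?V \<subseteq> fs.span S"
    using finJ by auto
  assume "length (filter (\<lambda>R. R \<subseteq> T) Rs) = 0"
  then have "J = {}" using finJ \<open>length (filter (\<lambda>R. R \<subseteq> T) Rs) = card J\<close> by simp
  then show "?V = {0}" using expand fs.subspace_0[OF subspace_piece_free_module] by auto
qed

section \<open>Homogeneous components\<close>

definition restrict_poly :: "((nat \<Rightarrow>\<^sub>0 nat) \<Rightarrow> bool) \<Rightarrow> 'k::field mpoly \<Rightarrow> 'k mpoly" where
  "restrict_poly P p = (\<Sum>a\<in>{a \<in> Poly_Mapping.keys p. P a}. Poly_Mapping.single a (Poly_Mapping.lookup p a))"

lemma lookup_restrict_poly: "Poly_Mapping.lookup (restrict_poly P p) a = (if P a then Poly_Mapping.lookup p a else 0)"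
proof -
  have "Poly_Mapping.lookup (restrict_poly P p) a = (\<Sum>c\<in>{a \<in> Poly_Mapping.keys p. P a}. if c = a then Poly_Mapping.lookup p c else 0)"
    unfolding restrict_poly_def lookup_sum by (intro sum.cong) (simp_all add: lookup_single when_def)
  then show ?thesis by (auto simp: in_keys_iff)
qed

text \<open>Cohomology is formed from whole carriers, so a preimage of a homogeneous element under a
  differential need not be homogeneous. Projection to one degree repairs this.\<close>

definition component :: "nat set list \<Rightarrow> mdeg \<Rightarrow> (nat \<Rightarrow> 'k::field mpoly) \<Rightarrow> nat \<Rightarrow> 'k mpoly" where
  "component Rs b f = (\<lambda>j. if j < length Rs then restrict_poly (\<lambda>a. mdeg_of a + ind (Rs ! j) = b) (f j) else 0)"

lemma component_piece: "f \<in> carrier (free_module n Rs) \<Longrightarrow> component Rs b f \<in> piece (free_module n Rs) b"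
  by (auto simp: piece_free_module carrier_free_module carrier_polyring component_def in_keys_iff lookup_restrict_poly
      subset_iff split: if_splits)

lemma component_of_piece:
  assumes "f \<in> piece (free_module n Rs) c"
  shows "component Rs b f = (if c = b then f else 0)"
proof
  fix j
  show "component Rs b f j = (if c = b then f else 0) j"
  proof (rule poly_mapping_eqI)
    fix a
    show "Poly_Mapping.lookup (component Rs b f j) a = Poly_Mapping.lookup ((if c = b then f else 0) j) a"
    proof (cases "Poly_Mapping.lookup (f j) a = 0 \<or> j \<ge> length Rs")
      case True
      then show ?thesis
        using assms by (auto simp: component_def lookup_restrict_poly piece_free_module carrier_free_module)
    next
      case False
      then have "mdeg_of a + ind (Rs ! j) = c" using assms by (auto simp: piece_free_module in_keys_iff)
      then show ?thesis using False by (auto simp: component_def lookup_restrict_poly)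
    qed
  qed
qed

lemma component_add: "component Rs b (f + g) = component Rs b f + component Rs b g"
  unfolding component_def
  by (rule ext) (auto simp: lookup_restrict_poly lookup_add intro!: poly_mapping_eqI)

lemma component_zero: "component Rs b 0 = 0"
  unfolding component_def
  by (rule ext) (auto simp: lookup_restrict_poly intro!: poly_mapping_eqI)

lemma component_sum: "component Rs b (\<Sum>c\<in>C. g c) = (\<Sum>c\<in>C. component Rs b (g c))"
  using sum_comp_morphism[of "component Rs b" g C, OF component_zero component_add] by (simp add: comp_def)

lemma sum_components:
  assumes f: "f \<in> carrier (free_module n Rs)"
  obtains C where "finite C" "b \<in> C" "f = (\<Sum>c\<in>C. component Rs c f)"
proof
  \<comment> \<open>Inserting \<open>b\<close> guarantees that the component of interest is a
    summand; in a degree that does not occur the component is zero.\<close>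
  define C where "C = insert b (\<Union>j<length Rs. (\<lambda>a. mdeg_of a + ind (Rs ! j)) ` Poly_Mapping.keys (f j))"
  show "finite C" "b \<in> C" by (simp_all add: C_def)
  show "f = (\<Sum>c\<in>C. component Rs c f)"
  proof
    fix j
    have "(\<Sum>c\<in>C. component Rs c f) j = (\<Sum>c\<in>C. component Rs c f j)" by (rule sum_apply)
    also have "\<dots> = f j"
    proof (rule poly_mapping_eqI)
      fix a
      show "Poly_Mapping.lookup (\<Sum>c\<in>C. component Rs c f j) a = Poly_Mapping.lookup (f j) a"
      proof (cases "j < length Rs \<and> Poly_Mapping.lookup (f j) a \<noteq> 0")
        case False
        then have "Poly_Mapping.lookup (f j) a = 0" using f by (auto simp: carrier_free_module)
        then show ?thesis by (auto simp: lookup_sum component_def lookup_restrict_poly intro!: sum.neutral)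
      next
        case True
        let ?c = "mdeg_of a + ind (Rs ! j)"
        have "a \<in> Poly_Mapping.keys (f j)" using True by (simp add: in_keys_iff)
        then have "?c \<in> C" using True unfolding C_def by blast
        have "Poly_Mapping.lookup (\<Sum>c\<in>C. component Rs c f j) a = (\<Sum>c\<in>C. if ?c = c then Poly_Mapping.lookup (f j) a else 0)"
          unfolding lookup_sum using True by (intro sum.cong) (auto simp: component_def lookup_restrict_poly)
        then show ?thesis using \<open>?c \<in> C\<close> \<open>finite C\<close> by simp
      qed
    qed
    finally show "f j = (\<Sum>c\<in>C. component Rs c f) j" by simp
  qed
qed

lemma free_module_sum:
  "finite C \<Longrightarrow> (\<And>c. c \<in> C \<Longrightarrow> g c \<in> carrier (free_module n Rs)) \<Longrightarrow> (\<Sum>c\<in>C. g c) \<in> carrier (free_module n Rs)"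
  by (induction C rule: finite_induct) (simp_all add: free_module_zero free_module_closed)

lemma additive_sum_free_module:
  fixes \<psi> :: "(nat \<Rightarrow> 'k::field mpoly) \<Rightarrow> 'c::ab_group_add"
  assumes add: "\<And>x y. x \<in> carrier (free_module n Rs) \<Longrightarrow> y \<in> carrier (free_module n Rs) \<Longrightarrow> \<psi> (x + y) = \<psi> x + \<psi> y"
    and "finite C" "\<And>c. c \<in> C \<Longrightarrow> g c \<in> carrier (free_module n Rs)"
  shows "\<psi> (\<Sum>c\<in>C. g c) = (\<Sum>c\<in>C. \<psi> (g c))"
  using assms(2,3)
proof (induction C rule: finite_induct)
  case empty
  have "\<psi> (0 + 0) = \<psi> 0 + \<psi> 0" by (intro add free_module_zero)
  then have "\<psi> 0 = 0" by simp
  then show ?case by (simp only: sum.empty)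
next
  case (insert c C)
  then have "\<psi> (g c + (\<Sum>c\<in>C. g c)) = \<psi> (g c) + \<psi> (\<Sum>c\<in>C. g c)"
    by (intro add free_module_sum) auto
  then show ?case using insert by (simp only: sum.insert insert_iff simp_thms)
qed

lemma graded_mapsD:
  assumes "f \<in> graded_maps n M N"
  shows "x \<in> carrier M \<Longrightarrow> f x \<in> carrier N"
    "x \<in> carrier M \<Longrightarrow> y \<in> carrier M \<Longrightarrow> f (x \<oplus>\<^bsub>M\<^esub> y) = f x \<oplus>\<^bsub>N\<^esub> f y"
    "p \<in> carrier (polyring n) \<Longrightarrow> x \<in> carrier M \<Longrightarrow> f (p \<odot>\<^bsub>M\<^esub> x) = p \<odot>\<^bsub>N\<^esub> f x"
    "x \<in> piece M b \<Longrightarrow> f x \<in> piece N b"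
  using assms unfolding graded_maps_def lin_maps_def by blast+

text \<open>After expanding \<open>f\<close> into components, only the image of the one of degree
  \<open>b\<close> survives the projection, because \<open>d\<close> preserves degrees.\<close>

lemma component_graded_map:
  assumes d: "d \<in> graded_maps n (free_module n Rs) (free_module n Rs')"
    and f: "f \<in> carrier (free_module n Rs)"
  shows "component Rs' b (d f) = d (component Rs b f)"
proof -
  obtain C where C: "finite C" "b \<in> C" "f = (\<Sum>c\<in>C. component Rs c f)"
    using sum_components[OF f] by blast
  have comp: "component Rs c f \<in> carrier (free_module n Rs)" for c
    using component_piece[OF f] by (simp add: piece_free_module)
  have "d f = d (\<Sum>c\<in>C. component Rs c f)" using C(3) by simp
  also have "\<dots> = (\<Sum>c\<in>C. d (component Rs c f))"
    by (rule additive_sum_free_module) (use graded_mapsD(2)[OF d, unfolded free_module_simps] C comp in blast)+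
  finally have "component Rs' b (d f) = (\<Sum>c\<in>C. component Rs' b (d (component Rs c f)))"
    by (simp add: component_sum)
  also have "\<dots> = (\<Sum>c\<in>C. if c = b then d (component Rs c f) else 0)"
    by (rule sum.cong) (simp_all add: component_of_piece[OF graded_mapsD(4)[OF d component_piece[OF f]]])
  also have "\<dots> = d (component Rs b f)" using C by simp
  finally show ?thesis .
qed

section \<open>Alexander duals\<close>

definition dscale :: "'k::field \<Rightarrow> ('b \<Rightarrow> 'm \<Rightarrow> 'k) \<Rightarrow> ('b \<Rightarrow> 'm \<Rightarrow> 'k)" where
  "dscale c g = (\<lambda>b m. c * g b m)"

lemma vector_space_dscale: "vector_space dscale"
  by unfold_locales (simp_all add: dscale_def fun_eq_iff algebra_simps)

interpretation ds: vector_space dscale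
  by (rule vector_space_dscale)

lemma carrier_alexander_dual:
  "carrier (alexander_dual n M) = {g. finite {b. g b \<noteq> 0} \<and>
     (\<forall>b\<in>nonneg_mdeg_set n. g b \<in> piece_dual M (ind ({1..n} - supp b))) \<and>
     (\<forall>b. b \<notin> nonneg_mdeg_set n \<longrightarrow> g b = 0)}"
  by (simp add: alexander_dual_def Let_def zero_fun_def)

lemma alexander_dual_simps:
  "\<zero>\<^bsub>alexander_dual n M\<^esub> = 0"
  "f \<oplus>\<^bsub>alexander_dual n M\<^esub> g = f + g"
  by (simp_all add: alexander_dual_def Let_def fun_eq_iff)

lemma piece_alexander_dual:
  "piece (alexander_dual n M) b = {g \<in> carrier (alexander_dual n M). \<forall>c. c \<noteq> b \<longrightarrow> g c = 0}"
  by (simp add: carrier_alexander_dual) (simp add: alexander_dual_def Let_def zero_fun_def)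

lemma piece_dual_closed:
  "0 \<in> piece_dual M b"
  "f \<in> piece_dual M b \<Longrightarrow> g \<in> piece_dual M b \<Longrightarrow> f + g \<in> piece_dual M b"
  "f \<in> piece_dual M b \<Longrightarrow> - f \<in> piece_dual M b"
  "f \<in> piece_dual M b \<Longrightarrow> (\<lambda>m. c * f m) \<in> piece_dual M b"
  by (simp_all add: piece_dual_def algebra_simps)

lemma alexander_dual_closed:
  assumes "f \<in> carrier (alexander_dual n M)"
  shows "g \<in> carrier (alexander_dual n M) \<Longrightarrow> f + g \<in> carrier (alexander_dual n M)"
    "- f \<in> carrier (alexander_dual n M)"
    "dscale c f \<in> carrier (alexander_dual n M)"
proof -
  have fin: "finite {b. f b \<noteq> 0}" using assms by (simp add: carrier_alexander_dual)
  show "f + g \<in> carrier (alexander_dual n M)" if g: "g \<in> carrier (alexander_dual n M)"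
  proof -
    have "finite {b. g b \<noteq> 0}" using g by (simp add: carrier_alexander_dual)
    then have "finite {b. (f + g) b \<noteq> 0}"
      by (rule finite_subset[rotated, OF finite_UnI[OF fin]]) auto
    then show ?thesis using assms g by (simp add: carrier_alexander_dual piece_dual_closed)
  qed
  show "- f \<in> carrier (alexander_dual n M)"
    using assms by (simp add: carrier_alexander_dual piece_dual_closed)
  have "finite {b. dscale c f b \<noteq> 0}"
    by (rule finite_subset[OF _ fin]) (auto simp: dscale_def fun_eq_iff)
  then show "dscale c f \<in> carrier (alexander_dual n M)"
    using assms by (simp add: carrier_alexander_dual dscale_def piece_dual_closed) (simp add: zero_fun_def)
qed

lemma alexander_dual_zero: "0 \<in> carrier (alexander_dual n M)"
  by (simp add: carrier_alexander_dual piece_dual_closed)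

lemma subspace_piece_alexander_dual: "ds.subspace (piece (alexander_dual n M) b)"
  by (rule ds.subspaceI)
    (auto simp: piece_alexander_dual alexander_dual_closed alexander_dual_zero, simp add: dscale_def zero_fun_def)

text \<open>For a constant, the defining sum has at most the exponent 0, whose multiplier is an
  empty product. Off the piece both sides are zero by the normalisation of functionals.\<close>

lemma alexander_dual_smult_const:
  assumes g: "g \<in> carrier (alexander_dual n M)" and one: "\<And>m. 1 \<odot>\<^bsub>M\<^esub> m = m"
  shows "const_poly c \<odot>\<^bsub>alexander_dual n M\<^esub> g = dscale c g"
proof (intro ext)
  fix b m
  have off: "g b m = 0" if "m \<notin> piece M (ind ({1..n} - supp b))"
    using g that by (cases "b \<in> nonneg_mdeg_set n") (auto simp: carrier_alexander_dual piece_dual_def)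
  have "(const_poly c \<odot>\<^bsub>alexander_dual n M\<^esub> g) b m =
     (if m \<in> piece M (ind ({1..n} - supp b)) then \<Sum>a\<in>Poly_Mapping.keys (const_poly c).
        Poly_Mapping.lookup (const_poly c) a * g (b - mdeg_of a) (sqfree_monom (supp b - supp (b - mdeg_of a)) \<odot>\<^bsub>M\<^esub> m)
      else 0)"
    by (simp add: alexander_dual_def Let_def)
  also have "\<dots> = dscale c g b m"
    using off by (simp add: const_poly_def dscale_def mdeg_of_zero sqfree_monom_def one)
  finally show "(const_poly c \<odot>\<^bsub>alexander_dual n M\<^esub> g) b m = dscale c g b m" .
qed

lemma supp_ind: "supp (ind T) = T"
  by (auto simp: supp_def ind_def)

lemma ind_nonneg: "T \<subseteq> {1..n} \<Longrightarrow> ind T \<in> nonneg_mdeg_set n"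
  by (auto simp: nonneg_mdeg_set_def mdeg_set_def ind_def)

section \<open>The modules Hom(F, S(-1)) and the Alexander duals of their pieces\<close>

definition dual_module :: "nat \<Rightarrow> nat set list
    \<Rightarrow> ('k::field mpoly, (nat \<Rightarrow> 'k mpoly) \<Rightarrow> nat \<Rightarrow> 'k mpoly) gr_module" where
  "dual_module n Rs = hom_module n (free_module n Rs) (free_module n [{1..n}])"

lemma dual_module_simps:
  "\<zero>\<^bsub>dual_module n Rs\<^esub> = 0"
  "f \<oplus>\<^bsub>dual_module n Rs\<^esub> g = f + g"
  "p \<odot>\<^bsub>dual_module n Rs\<^esub> f = (\<lambda>x j. p * f x j)"
  by (simp_all add: dual_module_def hom_module_def Let_def free_module_simps fun_eq_iff)

lemma carrier_dual_module:
  "f \<in> carrier (dual_module n Rs) \<longleftrightarrow>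
     f \<in> lin_maps n (free_module n Rs) (free_module n [{1..n}]) \<and> (\<forall>x. x \<notin> carrier (free_module n Rs) \<longrightarrow> f x = 0)"
  by (simp add: dual_module_def hom_module_def Let_def free_module_simps)

lemma piece_dual_module:
  "piece (dual_module n Rs) b = {f \<in> carrier (dual_module n Rs).
     \<forall>c. f ` piece (free_module n Rs) c \<subseteq> piece (free_module n [{1..n}]) (c + b)}"
  by (simp add: dual_module_def hom_module_def Let_def)

lemma dual_moduleD:
  assumes "m \<in> carrier (dual_module n Rs)"
  shows "x \<in> carrier (free_module n Rs) \<Longrightarrow> m x \<in> carrier (free_module n [{1..n}])"
    "x \<in> carrier (free_module n Rs) \<Longrightarrow> y \<in> carrier (free_module n Rs) \<Longrightarrow> m (x + y) = m x + m y"
    "p \<in> carrier (polyring n) \<Longrightarrow> x \<in> carrier (free_module n Rs) \<Longrightarrow> m (\<lambda>j. p * x j) = (\<lambda>j. p * m x j)"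
    "x \<notin> carrier (free_module n Rs) \<Longrightarrow> m x = 0"
  using assms unfolding carrier_dual_module lin_maps_def free_module_simps by blast+

lemma dual_moduleI:
  assumes "\<And>x. x \<in> carrier (free_module n Rs) \<Longrightarrow> m x \<in> carrier (free_module n [{1..n}])"
    "\<And>x y. x \<in> carrier (free_module n Rs) \<Longrightarrow> y \<in> carrier (free_module n Rs) \<Longrightarrow> m (x + y) = m x + m y"
    "\<And>p x. p \<in> carrier (polyring n) \<Longrightarrow> x \<in> carrier (free_module n Rs) \<Longrightarrow> m (\<lambda>j. p * x j) = (\<lambda>j. p * m x j)"
    "\<And>x. x \<notin> carrier (free_module n Rs) \<Longrightarrow> m x = 0"
  shows "m \<in> carrier (dual_module n Rs)"
  using assms unfolding carrier_dual_module lin_maps_def free_module_simps by blast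

lemma dual_module_zero_arg: "m \<in> carrier (dual_module n Rs) \<Longrightarrow> m 0 = 0"
  using dual_moduleD(2)[of m n Rs 0 0] free_module_zero[of n Rs] by simp

lemma dual_piece_closed:
  fixes m m' :: "(nat \<Rightarrow> 'k::field mpoly) \<Rightarrow> nat \<Rightarrow> 'k mpoly"
  shows "(0 :: (nat \<Rightarrow> 'k mpoly) \<Rightarrow> nat \<Rightarrow> 'k mpoly) \<in> piece (dual_module n Rs) b"
  "m \<in> piece (dual_module n Rs) b \<Longrightarrow> m' \<in> piece (dual_module n Rs) b \<Longrightarrow> m + m' \<in> piece (dual_module n Rs) b"
  "m \<in> piece (dual_module n Rs) b \<Longrightarrow> (\<lambda>x j. const_poly c * m x j) \<in> piece (dual_module n Rs) b"
proof -
  have "(0 :: (nat \<Rightarrow> 'k mpoly) \<Rightarrow> nat \<Rightarrow> 'k mpoly) \<in> carrier (dual_module n Rs)"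
    by (rule dual_moduleI) (auto simp: free_module_zero)
  then show "(0 :: (nat \<Rightarrow> 'k mpoly) \<Rightarrow> nat \<Rightarrow> 'k mpoly) \<in> piece (dual_module n Rs) b"
    using fs.subspace_0[OF subspace_piece_free_module] by (auto simp: piece_dual_module)
next
  assume m: "m \<in> piece (dual_module n Rs) b" "m' \<in> piece (dual_module n Rs) b"
  then have c: "m \<in> carrier (dual_module n Rs)" "m' \<in> carrier (dual_module n Rs)"
    by (auto simp: piece_dual_module)
  have "m + m' \<in> carrier (dual_module n Rs)"
  proof (rule dual_moduleI)
    fix x :: "nat \<Rightarrow> 'k mpoly" assume "x \<in> carrier (free_module n Rs)"
    then show "(m + m') x \<in> carrier (free_module n [{1..n}])"
      by (subst plus_fun_apply) (rule free_module_closed(1)[OF dual_moduleD(1)[OF c(1)] dual_moduleD(1)[OF c(2)]])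
  qed (simp_all add: dual_moduleD(2-4)[OF c(1)] dual_moduleD(2-4)[OF c(2)] fun_eq_iff algebra_simps)
  moreover have "(m + m') x \<in> piece (free_module n [{1..n}]) (d + b)" if "x \<in> piece (free_module n Rs) d" for x d
  proof -
    have "m x \<in> piece (free_module n [{1..n}]) (d + b)" "m' x \<in> piece (free_module n [{1..n}]) (d + b)"
      using m that unfolding piece_dual_module by blast+
    then show ?thesis
      by (subst plus_fun_apply) (rule fs.subspace_add[OF subspace_piece_free_module])
  qed
  ultimately show "m + m' \<in> piece (dual_module n Rs) b"
    unfolding piece_dual_module by blast
next
  assume m: "m \<in> piece (dual_module n Rs) b"
  then have c: "m \<in> carrier (dual_module n Rs)" by (auto simp: piece_dual_module)
  have "(\<lambda>x j. const_poly c * m x j) \<in> carrier (dual_module n Rs)"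
  proof (rule dual_moduleI)
    fix x :: "nat \<Rightarrow> 'k mpoly" assume "x \<in> carrier (free_module n Rs)"
    then show "(\<lambda>j. const_poly c * m x j) \<in> carrier (free_module n [{1..n}])"
      by (rule fscale_closed[OF dual_moduleD(1)[OF c], unfolded fscale_def])
  qed (simp_all add: dual_moduleD(2-4)[OF c] fun_eq_iff algebra_simps)
  moreover have "(\<lambda>j. const_poly c * m x j) \<in> piece (free_module n [{1..n}]) (d + b)"
    if "x \<in> piece (free_module n Rs) d" for x d
  proof -
    have "m x \<in> piece (free_module n [{1..n}]) (d + b)"
      using m that unfolding piece_dual_module by blast
    then show ?thesis
      by (rule fs.subspace_scale[OF subspace_piece_free_module, unfolded fscale_def])
  qed
  ultimately show "(\<lambda>x j. const_poly c * m x j) \<in> piece (dual_module n Rs) b"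
    unfolding piece_dual_module by blast
qed

lemma piece_dual_dual_module:
  "g \<in> piece_dual (dual_module n Rs) b \<longleftrightarrow>
     (\<forall>x\<in>piece (dual_module n Rs) b. \<forall>y\<in>piece (dual_module n Rs) b. g (x + y) = g x + g y) \<and>
     (\<forall>c. \<forall>x\<in>piece (dual_module n Rs) b. g (\<lambda>y j. const_poly c * x y j) = c * g x) \<and>
     (\<forall>x. x \<notin> piece (dual_module n Rs) b \<longrightarrow> g x = 0)"
  by (simp add: piece_dual_def dual_module_simps)

lemma piece_dual_zero_arg: "g \<in> piece_dual (dual_module n Rs) b \<Longrightarrow> g 0 = 0"
proof -
  assume "g \<in> piece_dual (dual_module n Rs) b"
  then have "g (0 + 0) = g 0 + g 0" unfolding piece_dual_dual_module using dual_piece_closed(1) by blast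
  then show ?thesis using add_cancel_right_right[of "g 0" "g 0"] by (simp only: add_0_left)
qed

text \<open>Membership of the sum is carried along because \<open>g\<close> is additive only inside
  the piece.\<close>

lemma piece_dual_sum:
  assumes g: "g \<in> piece_dual (dual_module n Rs) b" and "finite J"
    and "\<And>j. j \<in> J \<Longrightarrow> h j \<in> piece (dual_module n Rs) b"
  shows "g (\<Sum>j\<in>J. (\<lambda>x k. const_poly (a j) * h j x k)) = (\<Sum>j\<in>J. a j * g (h j)) \<and>
    (\<Sum>j\<in>J. (\<lambda>x k. const_poly (a j) * h j x k)) \<in> piece (dual_module n Rs) b"
  using assms(2,3)
proof (induction J rule: finite_induct)
  case empty
  show ?case unfolding sum.empty using piece_dual_zero_arg[OF g] dual_piece_closed(1) by blast
next
  case (insert j J)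
  let ?s = "\<Sum>j\<in>J. (\<lambda>x k. const_poly (a j) * h j x k)"
  have hj: "h j \<in> piece (dual_module n Rs) b" using insert by blast
  then have hj': "(\<lambda>x k. const_poly (a j) * h j x k) \<in> piece (dual_module n Rs) b"
    by (rule dual_piece_closed(3))
  have IH: "g ?s = (\<Sum>j\<in>J. a j * g (h j))" "?s \<in> piece (dual_module n Rs) b" using insert by auto
  have "g ((\<lambda>x k. const_poly (a j) * h j x k) + ?s) = a j * g (h j) + g ?s"
  proof -
    have "g ((\<lambda>x k. const_poly (a j) * h j x k) + ?s) = g (\<lambda>x k. const_poly (a j) * h j x k) + g ?s"
      using g hj' IH(2) unfolding piece_dual_dual_module by blast
    also have "g (\<lambda>x k. const_poly (a j) * h j x k) = a j * g (h j)"
      using g hj unfolding piece_dual_dual_module by blast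
    finally show ?thesis .
  qed
  then show ?case
    unfolding sum.insert[OF insert.hyps] IH(1) using dual_piece_closed(2)[OF hj' IH(2)] by blast
qed

definition unit_vec :: "nat \<Rightarrow> nat \<Rightarrow> 'k::field mpoly" where
  "unit_vec j = (\<lambda>k. if k = j then 1 else 0)"

lemma unit_vec_carrier:
  assumes "j < length Rs"
  shows "unit_vec j \<in> piece (free_module n Rs) (ind (Rs ! j))" "unit_vec j \<in> carrier (free_module n Rs)"
  using assms by (auto simp: unit_vec_def piece_free_module carrier_free_module carrier_polyring mdeg_of_zero)

lemma dual_module_expand:
  assumes m: "m \<in> carrier (dual_module n Rs)" and x: "x \<in> carrier (free_module n Rs)"
  shows "m x = (\<Sum>j<length Rs. (\<lambda>k. x j * m (unit_vec j) k))"
proof -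
  have px: "x j \<in> carrier (polyring n)" if "j < length Rs" for j using x that by (simp add: carrier_free_module)
  have "x = (\<Sum>j<length Rs. (\<lambda>k. x j * unit_vec j k))"
  proof
    fix k
    have "(\<Sum>j<length Rs. (\<lambda>k. x j * unit_vec j k)) k = (\<Sum>j<length Rs. if j = k then x j else 0)"
      unfolding sum_apply by (rule sum.cong) (simp_all add: unit_vec_def)
    also have "\<dots> = x k" using x by (auto simp: carrier_free_module)
    finally show "x k = (\<Sum>j<length Rs. (\<lambda>k. x j * unit_vec j k)) k" by simp
  qed
  then have "m x = m (\<Sum>j<length Rs. (\<lambda>k. x j * unit_vec j k))" by simp
  also have "\<dots> = (\<Sum>j<length Rs. m (\<lambda>k. x j * unit_vec j k))"
    by (rule additive_sum_free_module[OF dual_moduleD(2)[OF m]])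
      (auto intro!: free_module_closed(4) unit_vec_carrier px)
  also have "\<dots> = (\<Sum>j<length Rs. (\<lambda>k. x j * m (unit_vec j) k))"
    by (rule sum.cong) (auto simp: dual_moduleD(3)[OF m px unit_vec_carrier(2)])
  finally show ?thesis .
qed

text \<open>With R the degree of the j-th generator, that generator goes to x^(R - T) and the others
  to 0. In the target, shifted by the all-ones vector, this value has degree R plus the complement
  of \<open>T\<close> whenever \<open>T\<close> is inside R. So the map is homogeneous of degree
  \<open>ind ({1..n} - T)\<close>.\<close>

definition dual_basis :: "nat \<Rightarrow> nat set list \<Rightarrow> nat set \<Rightarrow> nat \<Rightarrow> (nat \<Rightarrow> 'k::field mpoly) \<Rightarrow> nat \<Rightarrow> 'k mpoly" where
  "dual_basis n Rs T j = (\<lambda>x k. if x \<in> carrier (free_module n Rs) \<and> k = 0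
     then x j * Poly_Mapping.single (expo (Rs ! j - T)) 1 else 0)"

definition dual_coord :: "nat set list \<Rightarrow> nat set \<Rightarrow> nat \<Rightarrow> ((nat \<Rightarrow> 'k::field mpoly) \<Rightarrow> nat \<Rightarrow> 'k mpoly) \<Rightarrow> 'k" where
  "dual_coord Rs T j m = Poly_Mapping.lookup (m (unit_vec j) 0) (expo (Rs ! j - T))"

lemma dual_basis_piece:
  assumes R: "\<And>R. R \<in> set Rs \<Longrightarrow> R \<subseteq> {1..n}" and T: "T \<subseteq> {1..n}"
    and j: "j < length Rs" "T \<subseteq> Rs ! j"
  shows "(dual_basis n Rs T j :: (nat \<Rightarrow> 'k::field mpoly) \<Rightarrow> _) \<in> piece (dual_module n Rs) (ind ({1..n} - T))"
proof -
  let ?b = "dual_basis n Rs T j :: (nat \<Rightarrow> 'k mpoly) \<Rightarrow> nat \<Rightarrow> 'k mpoly"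
  let ?q = "Poly_Mapping.single (expo (Rs ! j - T)) (1::'k)"
  have Rj: "Rs ! j \<subseteq> {1..n}" using R j by simp
  then have fin: "finite (Rs ! j - T)" using finite_subset by blast
  have q: "?q \<in> carrier (polyring n)"
    by (rule polyring_single) (use Rj fin in \<open>auto simp: keys_expo\<close>)
  have carrier: "?b \<in> carrier (dual_module n Rs)"
  proof (rule dual_moduleI)
    fix x :: "nat \<Rightarrow> 'k mpoly" assume x: "x \<in> carrier (free_module n Rs)"
    then have "x j \<in> carrier (polyring n)" using j by (simp add: carrier_free_module)
    then show "?b x \<in> carrier (free_module n [{1..n}])"
      using q by (auto simp: dual_basis_def carrier_free_module polyring_mult polyring_zero)
  qed (auto simp: dual_basis_def fun_eq_iff free_module_closed distrib_right mult.assoc)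
  have "?b x \<in> piece (free_module n [{1..n}]) (c + ind ({1..n} - T))"
    if x: "x \<in> piece (free_module n Rs) c" for x c
  proof -
    have "mdeg_of a' + ind {1..n} = c + ind ({1..n} - T)" if a': "a' \<in> Poly_Mapping.keys (x j * ?q)" for a'
    proof -
      obtain a where a: "a' = a + expo (Rs ! j - T)" "a \<in> Poly_Mapping.keys (x j)"
        using a' keys_mult[of "x j" ?q] by auto
      have c: "mdeg_of a + ind (Rs ! j) = c" using x a j by (simp add: piece_free_module)
      show ?thesis
        unfolding a(1) mdeg_of_add mdeg_of_expo[OF fin] c[symmetric]
        using j(2) T Rj by (auto simp: ind_def fun_eq_iff)
    qed
    moreover have xc: "x \<in> carrier (free_module n Rs)" using x by (simp add: piece_free_module)
    then have "?b x 0 = x j * ?q" by (simp add: dual_basis_def)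
    ultimately show ?thesis
      using dual_moduleD(1)[OF carrier xc] by (simp add: piece_free_module)
  qed
  with carrier show ?thesis by (auto simp: piece_dual_module)
qed

text \<open>A linear map is determined by its values on the unit vectors, and homogeneity leaves at
  most one possible monomial for each of these values.\<close>

lemma dual_piece_expand:
  assumes R: "\<And>R. R \<in> set Rs \<Longrightarrow> R \<subseteq> {1..n}" and T: "T \<subseteq> {1..n}"
    and m: "m \<in> piece (dual_module n Rs) (ind ({1..n} - T))"
  shows "m = (\<Sum>j\<in>{j. j < length Rs \<and> T \<subseteq> Rs ! j}. (\<lambda>x k. const_poly (dual_coord Rs T j m) * dual_basis n Rs T j x k))"
proof (intro ext)
  fix x k
  let ?J = "{j. j < length Rs \<and> T \<subseteq> Rs ! j}"
  have mc: "m \<in> carrier (dual_module n Rs)" using m by (simp add: piece_dual_module)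
  have sum: "(\<Sum>j\<in>?J. (\<lambda>x k. const_poly (dual_coord Rs T j m) * dual_basis n Rs T j x k)) x k
    = (\<Sum>j\<in>?J. const_poly (dual_coord Rs T j m) * dual_basis n Rs T j x k)"
    by (simp add: sum_apply)
  have unit: "m (unit_vec j) 0 = (if T \<subseteq> Rs ! j then Poly_Mapping.single (expo (Rs ! j - T)) (dual_coord Rs T j m) else 0)"
    if j: "j < length Rs" for j
  proof -
    have fin: "finite (Rs ! j)" "Rs ! j \<subseteq> {1..n}" using R j finite_subset[of "Rs ! j" "{1..n}"] by auto
    have pc: "m (unit_vec j) \<in> piece (free_module n [{1..n}]) (ind (Rs ! j) + ind ({1..n} - T))"
      using m unit_vec_carrier(1)[OF j] by (auto simp: piece_dual_module)
    have keys: "T \<subseteq> Rs ! j \<and> a = expo (Rs ! j - T)" if a: "a \<in> Poly_Mapping.keys (m (unit_vec j) 0)" for a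
    proof -
      have eq: "mdeg_of a + ind {1..n} = ind (Rs ! j) + ind ({1..n} - T)"
        using pc a by (auto simp: piece_free_module)
      \<comment> \<open>Cancelling the complement of \<open>T\<close> against the all-ones shift
        brings the degree condition into the form of \<open>mdeg_of_add_ind_eq\<close>, where now
        \<open>T\<close> is the smaller set.\<close>
      have "mdeg_of a + ind T = ind (Rs ! j)"
      proof
        fix i
        show "(mdeg_of a + ind T) i = ind (Rs ! j) i"
          using fun_cong[OF eq, of i] T by (auto simp: ind_def split: if_splits)
      qed
      then show ?thesis using mdeg_of_add_ind_eq[OF fin(1)] by blast
    qed
    show ?thesis
      by (rule poly_mapping_eqI) (use keys in \<open>auto simp: dual_coord_def lookup_single when_def in_keys_iff\<close>)
  qed
  show "m x k = (\<Sum>j\<in>?J. (\<lambda>x k. const_poly (dual_coord Rs T j m) * dual_basis n Rs T j x k)) x k"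
  proof (cases "x \<in> carrier (free_module n Rs) \<and> k = 0")
    case False
    then have "m x k = 0"
      using dual_moduleD(1,4)[OF mc, of x] by (cases "x \<in> carrier (free_module n Rs)") (auto simp: carrier_free_module)
    then show ?thesis unfolding sum using False by (auto simp: dual_basis_def intro!: sum.neutral)
  next
    case True
    then have "m x k = (\<Sum>j<length Rs. x j * m (unit_vec j) 0)"
      using dual_module_expand[OF mc] by (simp add: sum_apply)
    also have "\<dots> = (\<Sum>j\<in>?J. const_poly (dual_coord Rs T j m) * dual_basis n Rs T j x k)"
    proof (rule sum.mono_neutral_cong_right)
      fix j assume "j \<in> ?J"
      then have "m (unit_vec j) 0 = const_poly (dual_coord Rs T j m) * Poly_Mapping.single (expo (Rs ! j - T)) 1"
        using unit by (simp add: const_poly_mult_single)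
      then show "x j * m (unit_vec j) 0 = const_poly (dual_coord Rs T j m) * dual_basis n Rs T j x k"
        using True by (simp add: dual_basis_def mult_ac)
    qed (use unit in auto)
    finally show ?thesis unfolding sum .
  qed
qed

lemma dual_coord_basis:
  assumes "j < length Rs" "k < length Rs"
  shows "dual_coord Rs T k (dual_basis n Rs T j) = (if j = k then 1 else 0)"
  using unit_vec_carrier(2)[OF assms(2), of n]
  by (auto simp: dual_coord_def dual_basis_def) (auto simp: unit_vec_def)

lemma dual_coord_linear:
  "dual_coord Rs T j (m + m') = dual_coord Rs T j m + dual_coord Rs T j m'"
  "dual_coord Rs T j (\<lambda>x k. const_poly c * m x k) = c * dual_coord Rs T j m"
  by (simp_all add: dual_coord_def lookup_add lookup_const_poly_mult)

text \<open>This piece is the dual space of the piece of Hom(F, S(-1)) in the complementary degree.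
  Compared with the free module itself the containment between \<open>R\<close> and \<open>T\<close>
  is reversed, and this reversal is the whole numerical content of the duality.\<close>

lemma piece_alexander_dual_ind:
  fixes Rs :: "nat set list"
  assumes R: "\<And>R. R \<in> set Rs \<Longrightarrow> R \<subseteq> {1..n}" and T: "T \<subseteq> {1..n}"
  defines "V \<equiv> piece (alexander_dual n (dual_module n Rs :: ('k::field mpoly, _) gr_module)) (ind T)"
  shows "ds.dim V = length (filter (\<lambda>R. T \<subseteq> R) Rs)"
    "\<exists>S. finite S \<and> V \<subseteq> ds.span S"
    "length (filter (\<lambda>R. T \<subseteq> R) Rs) = 0 \<Longrightarrow> V = {0}"
proof -
  let ?M = "dual_module n Rs :: ('k::field mpoly, _) gr_module"
  let ?P = "piece ?M (ind ({1..n} - T))"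
  define J where "J = {j. j < length Rs \<and> T \<subseteq> Rs ! j}"
  have finJ: "finite J" by (simp add: J_def)
  have V: "ds.subspace V" unfolding V_def by (rule subspace_piece_alexander_dual)
  \<comment> \<open>Coordinate functionals placed in degree \<open>T\<close>, zero off the piece as
    the normalisation demands. \<open>u\<close> evaluates a functional at the basis dual to
    them.\<close>
  define v where "v j = (\<lambda>c m. if c = ind T \<and> m \<in> ?P then dual_coord Rs T j m else 0)" for j :: nat
  define u where "u j g = g (ind T) (dual_basis n Rs T j)" for j and g :: "mdeg \<Rightarrow> ((nat \<Rightarrow> 'k mpoly) \<Rightarrow> nat \<Rightarrow> 'k mpoly) \<Rightarrow> 'k"
  have v: "v j \<in> V" for j
  proof -
    have "{b. v j b \<noteq> 0} \<subseteq> {ind T}" by (auto simp: v_def fun_eq_iff)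
    then have "finite {b. v j b \<noteq> 0}" by (rule finite_subset) simp
    moreover have "v j (ind T) \<in> piece_dual ?M (ind ({1..n} - T))"
      unfolding piece_dual_dual_module
      by (auto simp: v_def dual_piece_closed dual_coord_linear)
    moreover have off: "v j c = 0" if "c \<noteq> ind T" for c
      using that by (auto simp: v_def fun_eq_iff)
    moreover have "v j c \<in> piece_dual ?M (ind ({1..n} - supp c))" for c
    proof (cases "c = ind T")
      case True
      then show ?thesis using calculation(2) by (simp only: supp_ind)
    next
      case False
      then show ?thesis using off piece_dual_closed(1) by simp
    qed
    moreover have "v j c = 0" if "c \<notin> nonneg_mdeg_set n" for c
      by (rule off) (use that ind_nonneg[OF T] in blast)
    ultimately show ?thesis
      unfolding V_def piece_alexander_dual carrier_alexander_dual by blast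
  qed
  have gP: "g (ind T) \<in> piece_dual ?M (ind ({1..n} - T))" if "g \<in> V" for g
  proof -
    have "g (ind T) \<in> piece_dual ?M (ind ({1..n} - supp (ind T)))"
      using that ind_nonneg[OF T] unfolding V_def piece_alexander_dual carrier_alexander_dual by blast
    then show ?thesis by (simp only: supp_ind)
  qed
  have basis: "dual_basis n Rs T j \<in> ?P" if "j \<in> J" for j
    using dual_basis_piece[OF R T] that by (auto simp: J_def)
  have expand: "g = (\<Sum>j\<in>J. dscale (u j g) (v j))" if g: "g \<in> V" for g
  proof (intro ext)
    fix c m
    have s: "(\<Sum>j\<in>J. dscale (u j g) (v j)) c m = (\<Sum>j\<in>J. u j g * v j c m)"
      by (simp add: sum_apply dscale_def)
    show "g c m = (\<Sum>j\<in>J. dscale (u j g) (v j)) c m"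
    proof (cases "c = ind T \<and> m \<in> ?P")
      case False
      then have "g c m = 0"
        using g gP[OF g] by (cases "c = ind T") (auto simp: V_def piece_alexander_dual piece_dual_dual_module)
      then show ?thesis unfolding s using False by (auto simp: v_def intro!: sum.neutral)
    next
      case True
      have "g c m = g (ind T) (\<Sum>j\<in>J. (\<lambda>x k. const_poly (dual_coord Rs T j m) * dual_basis n Rs T j x k))"
        using dual_piece_expand[OF R T, where m = m] True unfolding J_def by simp
      also have "\<dots> = (\<Sum>j\<in>J. dual_coord Rs T j m * g (ind T) (dual_basis n Rs T j))"
        by (rule piece_dual_sum[THEN conjunct1, OF gP[OF g] finJ basis])
      also have "\<dots> = (\<Sum>j\<in>J. u j g * v j c m)"
        by (rule sum.cong) (use True in \<open>simp_all add: u_def v_def\<close>)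
      finally show ?thesis unfolding s .
    qed
  qed
  have "ds.dim V = card J \<and> V \<subseteq> ds.span (v ` J)"
  proof (intro conjI; rule ds.dim_eq_card_coordinates[where u = u and v = v and J = J])
    fix j k assume "j \<in> J" "k \<in> J"
    then show "u j (v k) = (if j = k then 1 else 0)" "u j (v k) = (if j = k then 1 else 0)"
      using basis[of j] dual_coord_basis[of j Rs k T n] by (auto simp: u_def v_def J_def)
  qed (use finJ v expand V in \<open>auto simp: u_def dscale_def\<close>)
  moreover have len: "length (filter (\<lambda>R. T \<subseteq> R) Rs) = card J"
    by (simp add: J_def length_filter_conv_card)
  ultimately show "ds.dim V = length (filter (\<lambda>R. T \<subseteq> R) Rs)" "\<exists>S. finite S \<and> V \<subseteq> ds.span S"
    using finJ by auto
  assume "length (filter (\<lambda>R. T \<subseteq> R) Rs) = 0"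
  then have "J = {}" using finJ len by simp
  then have "V \<subseteq> {0}" using expand by auto
  then show "V = {0}" using ds.subspace_0[OF V] by auto
qed

section \<open>The numerical effect of the duality functors\<close>

lemma carrier_cohomology:
  fixes X :: "('k::field mpoly, 'm::ab_group_add) cochain"
  assumes "\<And>x y. x \<oplus>\<^bsub>cmod X i\<^esub> y = x + y"
  shows "carrier (cohomology X i) = (\<lambda>x. (\<lambda>h. h + x) ` coboundaries X i) ` cocycles X i"
  unfolding cohomology_def A_FactGroup_def FactGroup_def RCOSETS_def r_coset_def
  by (auto simp: assms image_def)

text \<open>Bijectivity on cosets is brought down to elements. The induced map sends the coset of
  \<open>x\<close> to that of \<open>\<phi> i x\<close>; hence an \<open>x\<close> mapped to a
  coboundary shares its image with the coset of 0, and every cocycle of \<open>Y\<close> lies in the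
  coset of some image.\<close>

lemma
  fixes X :: "('k::field mpoly, 'm::ab_group_add) cochain" and Y :: "('k mpoly, 'l::ab_group_add) cochain"
  assumes q: "quasi_iso n X Y \<phi>"
    and addX: "\<And>x y. x \<oplus>\<^bsub>cmod X i\<^esub> y = x + y" and addY: "\<And>x y. x \<oplus>\<^bsub>cmod Y i\<^esub> y = x + y"
    and zero: "0 \<in> coboundaries X i" "0 \<in> coboundaries Y i" "0 \<in> cocycles X i"
    and addB: "\<And>x y. x \<in> coboundaries Y i \<Longrightarrow> y \<in> coboundaries Y i \<Longrightarrow> x + y \<in> coboundaries Y i"
      "\<And>x. x \<in> coboundaries Y i \<Longrightarrow> - x \<in> coboundaries Y i"
    and sub: "coboundaries X i \<subseteq> carrier (cmod X i)"
    and add: "\<And>x y. x \<in> carrier (cmod X i) \<Longrightarrow> y \<in> carrier (cmod X i) \<Longrightarrow> \<phi> i (x + y) = \<phi> i x + \<phi> i y"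
    and img: "\<phi> i ` coboundaries X i \<subseteq> coboundaries Y i"
  shows quasi_iso_inj: "x \<in> cocycles X i \<Longrightarrow> \<phi> i x \<in> coboundaries Y i \<Longrightarrow> x \<in> coboundaries X i"
    and quasi_iso_surj: "y \<in> cocycles Y i \<Longrightarrow> \<exists>x\<in>cocycles X i. y - \<phi> i x \<in> coboundaries Y i"
proof -
  define cl where "cl x = (\<lambda>h. h + x) ` coboundaries X i" for x
  define cl' where "cl' y = (\<lambda>h. h + y) ` coboundaries Y i" for y
  define f where "f Q = \<phi> i ` Q <+>\<^bsub>cmod Y i\<^esub> coboundaries Y i" for Q
  have f: "f Q = {a + b | a b. a \<in> \<phi> i ` Q \<and> b \<in> coboundaries Y i}" for Q
    unfolding f_def set_add_def set_mult_def by (auto simp: addY)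
  have bij: "bij_betw f (cl ` cocycles X i) (cl' ` cocycles Y i)"
  proof -
    have "bij_betw f (carrier (cohomology X i)) (carrier (cohomology Y i))"
      using q unfolding quasi_iso_def iso_def f_def[abs_def] by simp
    then show ?thesis
      unfolding carrier_cohomology[of X, OF addX] carrier_cohomology[of Y, OF addY] cl_def cl'_def .
  qed
  have car: "x \<in> carrier (cmod X i)" if "x \<in> cocycles X i" for x
    using that by (simp add: cocycles_def)
  have fcl: "f (cl x) = cl' (\<phi> i x)" if x: "x \<in> cocycles X i" for x
  proof
    show "f (cl x) \<subseteq> cl' (\<phi> i x)"
    proof
      fix z assume "z \<in> f (cl x)"
      then obtain h b where hb: "h \<in> coboundaries X i" "b \<in> coboundaries Y i" "z = \<phi> i (h + x) + b"
        unfolding f cl_def by blast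
      then have "z = (\<phi> i h + b) + \<phi> i x" using add sub car[OF x] by auto
      moreover have "\<phi> i h + b \<in> coboundaries Y i" using hb img addB by blast
      ultimately show "z \<in> cl' (\<phi> i x)" unfolding cl'_def by blast
    qed
    show "cl' (\<phi> i x) \<subseteq> f (cl x)"
    proof
      fix z assume "z \<in> cl' (\<phi> i x)"
      then obtain b where "b \<in> coboundaries Y i" "z = b + \<phi> i x" unfolding cl'_def by blast
      moreover have "0 + x \<in> cl x" unfolding cl_def using zero(1) by blast
      then have "x \<in> cl x" by simp
      ultimately show "z \<in> f (cl x)" unfolding f using add.commute by blast
    qed
  qed
  have mem: "x \<in> cl x" for x
  proof -
    have "0 + x \<in> cl x" unfolding cl_def using zero(1) by blast
    then show ?thesis by simp
  qed
  have mem': "y \<in> cl' y" for y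
  proof -
    have "0 + y \<in> cl' y" unfolding cl'_def using zero(2) by blast
    then show ?thesis by simp
  qed
  have phi0: "\<phi> i 0 = 0" using add[OF car[OF zero(3)] car[OF zero(3)]] by simp
  show "x \<in> coboundaries X i" if x: "x \<in> cocycles X i" "\<phi> i x \<in> coboundaries Y i"
  proof -
    have "cl' (\<phi> i x) = cl' 0"
    proof
      show "cl' (\<phi> i x) \<subseteq> cl' 0" unfolding cl'_def using x addB by (auto intro!: image_eqI)
      show "cl' 0 \<subseteq> cl' (\<phi> i x)"
      proof
        fix z assume "z \<in> cl' 0"
        then have "z \<in> coboundaries Y i" unfolding cl'_def by auto
        then have "z + - \<phi> i x \<in> coboundaries Y i" using x addB by blast
        moreover have "z = (z + - \<phi> i x) + \<phi> i x" by simp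
        ultimately show "z \<in> cl' (\<phi> i x)" unfolding cl'_def by blast
      qed
    qed
    then have "f (cl x) = f (cl 0)" using fcl x zero(3) phi0 by simp
    then have "cl x = cl 0"
      using bij x zero(3) unfolding bij_betw_def inj_on_def by blast
    then show ?thesis using mem[of x] unfolding cl_def by auto
  qed
  show "\<exists>x\<in>cocycles X i. y - \<phi> i x \<in> coboundaries Y i" if y: "y \<in> cocycles Y i"
  proof -
    have "cl' y \<in> f ` cl ` cocycles X i" using bij y unfolding bij_betw_def by blast
    then obtain x where x: "x \<in> cocycles X i" "cl' y = f (cl x)" by blast
    then have "y \<in> cl' (\<phi> i x)" using mem'[of y] fcl by simp
    then obtain h where h: "h \<in> coboundaries Y i" "y = h + \<phi> i x" unfolding cl'_def by blast
    have "y - \<phi> i x = h" unfolding h(2) by (rule add_diff_cancel_right')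
    then show ?thesis using x(1) h(1) by blast
  qed
qed

section \<open>The differentials of D(F) and of A(D(F))\<close>

definition pullback :: "nat \<Rightarrow> nat set list \<Rightarrow> ((nat \<Rightarrow> 'k::field mpoly) \<Rightarrow> nat \<Rightarrow> 'k mpoly)
    \<Rightarrow> ((nat \<Rightarrow> 'k mpoly) \<Rightarrow> nat \<Rightarrow> 'k mpoly) \<Rightarrow> (nat \<Rightarrow> 'k mpoly) \<Rightarrow> nat \<Rightarrow> 'k mpoly" where
  "pullback n Rs d m = (\<lambda>x. if x \<in> carrier (free_module n Rs) then m (d x) else 0)"

text \<open>The transpose of \<open>pullback\<close> in every multidegree. Two contravariant steps
  make it covariant, so it points the same way as \<open>d\<close>.\<close>

definition pushforward :: "nat \<Rightarrow> nat set list \<Rightarrow> nat set list \<Rightarrow> ((nat \<Rightarrow> 'k::field mpoly) \<Rightarrow> nat \<Rightarrow> 'k mpoly)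
    \<Rightarrow> (mdeg \<Rightarrow> ((nat \<Rightarrow> 'k mpoly) \<Rightarrow> nat \<Rightarrow> 'k mpoly) \<Rightarrow> 'k)
    \<Rightarrow> mdeg \<Rightarrow> ((nat \<Rightarrow> 'k mpoly) \<Rightarrow> nat \<Rightarrow> 'k mpoly) \<Rightarrow> 'k" where
  "pushforward n Rs Rs' d g = (\<lambda>b m. if m \<in> piece (dual_module n Rs') (ind ({1..n} - supp b))
     then g b (pullback n Rs d m) else 0)"

lemma pullback_add: "pullback n Rs d (m + m') = pullback n Rs d m + pullback n Rs d m'"
  by (rule ext) (simp add: pullback_def)

lemma pullback_scale: "pullback n Rs d (\<lambda>x j. p * m x j) = (\<lambda>x j. p * pullback n Rs d m x j)"
  by (intro ext) (simp add: pullback_def)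

lemma pushforward_linear:
  "pushforward n Rs Rs' d (g + h) = pushforward n Rs Rs' d g + pushforward n Rs Rs' d h"
  "pushforward n Rs Rs' d (- g) = - pushforward n Rs Rs' d g"
  "pushforward n Rs Rs' d (dscale c g) = dscale c (pushforward n Rs Rs' d g)"
  "pushforward n Rs Rs' d 0 = 0"
  by (intro ext; simp add: pushforward_def dscale_def)+

text \<open>The map acts within each multidegree separately, which permits cutting a family down to
  a single degree.\<close>

lemma pushforward_cong: "g b = h b \<Longrightarrow> pushforward n Rs Rs' d g b = pushforward n Rs Rs' d h b"
  by (rule ext) (simp add: pushforward_def)

lemma free_graded_mapsD:
  assumes "d \<in> graded_maps n (free_module n Rs) (free_module n Rs')"
  shows "x \<in> carrier (free_module n Rs) \<Longrightarrow> d x \<in> carrier (free_module n Rs')"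
    "x \<in> carrier (free_module n Rs) \<Longrightarrow> y \<in> carrier (free_module n Rs) \<Longrightarrow> d (x + y) = d x + d y"
    "p \<in> carrier (polyring n) \<Longrightarrow> x \<in> carrier (free_module n Rs) \<Longrightarrow> d (\<lambda>j. p * x j) = (\<lambda>j. p * d x j)"
    "x \<in> piece (free_module n Rs) b \<Longrightarrow> d x \<in> piece (free_module n Rs') b"
  using graded_mapsD[OF assms] unfolding free_module_simps by blast+

lemma pullback_piece:
  fixes d :: "(nat \<Rightarrow> 'k::field mpoly) \<Rightarrow> nat \<Rightarrow> 'k mpoly"
  assumes d: "d \<in> graded_maps n (free_module n Rs) (free_module n Rs')"
    and m: "m \<in> piece (dual_module n Rs') b"
  shows "pullback n Rs d m \<in> piece (dual_module n Rs) b"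
proof -
  have mc: "m \<in> carrier (dual_module n Rs')" using m by (simp add: piece_dual_module)
  have eq: "pullback n Rs d m x = m (d x)" if "x \<in> carrier (free_module n Rs)" for x
    using that by (simp add: pullback_def)
  have "pullback n Rs d m \<in> carrier (dual_module n Rs)"
  proof (rule dual_moduleI)
    fix x :: "nat \<Rightarrow> 'k mpoly" assume "x \<in> carrier (free_module n Rs)"
    then show "pullback n Rs d m x \<in> carrier (free_module n [{1..n}])"
      by (subst eq) (auto intro!: dual_moduleD(1)[OF mc, unfolded One_nat_def] free_graded_mapsD(1)[OF d])
  next
    fix x y :: "nat \<Rightarrow> 'k mpoly" assume xy: "x \<in> carrier (free_module n Rs)" "y \<in> carrier (free_module n Rs)"
    have "pullback n Rs d m (x + y) = m (d (x + y))" by (rule eq[OF free_module_closed(1)[OF xy]])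
    also have "d (x + y) = d x + d y" by (rule free_graded_mapsD(2)[OF d xy])
    also have "m (d x + d y) = m (d x) + m (d y)"
      by (rule dual_moduleD(2)[OF mc free_graded_mapsD(1)[OF d xy(1)] free_graded_mapsD(1)[OF d xy(2)]])
    finally show "pullback n Rs d m (x + y) = pullback n Rs d m x + pullback n Rs d m y"
      unfolding eq[OF xy(1)] eq[OF xy(2)] .
  next
    fix p :: "'k mpoly" and x :: "nat \<Rightarrow> 'k mpoly" assume p: "p \<in> carrier (polyring n)" and x: "x \<in> carrier (free_module n Rs)"
    have "pullback n Rs d m (\<lambda>j. p * x j) = m (d (\<lambda>j. p * x j))" by (rule eq[OF free_module_closed(4)[OF x x p]])
    also have "d (\<lambda>j. p * x j) = (\<lambda>j. p * d x j)" by (rule free_graded_mapsD(3)[OF d p x])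
    also have "m \<dots> = (\<lambda>j. p * m (d x) j)" by (rule dual_moduleD(3)[OF mc p free_graded_mapsD(1)[OF d x]])
    finally show "pullback n Rs d m (\<lambda>j. p * x j) = (\<lambda>j. p * pullback n Rs d m x j)"
      unfolding eq[OF x] .
  qed (simp add: pullback_def)
  moreover have "pullback n Rs d m x \<in> piece (free_module n [{1..n}]) (c + b)"
    if x: "x \<in> piece (free_module n Rs) c" for x c
  proof -
    have "x \<in> carrier (free_module n Rs)" using x by (simp add: piece_free_module)
    moreover have "m (d x) \<in> piece (free_module n [{1..n}]) (c + b)"
      using m free_graded_mapsD(4)[OF d x] unfolding piece_dual_module by blast
    ultimately show ?thesis by (simp only: eq)
  qed
  ultimately show ?thesis unfolding piece_dual_module by blast
qed

lemma pushforward_carrier: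
  fixes d :: "(nat \<Rightarrow> 'k::field mpoly) \<Rightarrow> nat \<Rightarrow> 'k mpoly"
  assumes d: "d \<in> graded_maps n (free_module n Rs) (free_module n Rs')"
    and g: "g \<in> carrier (alexander_dual n (dual_module n Rs))"
  shows "pushforward n Rs Rs' d g \<in> carrier (alexander_dual n (dual_module n Rs'))"
proof -
  let ?h = "pushforward n Rs Rs' d g"
  have "finite {b. g b \<noteq> 0}" using g by (simp add: carrier_alexander_dual)
  moreover have zero: "?h b = 0" if "g b = 0" for b
    by (rule ext) (simp add: pushforward_def that)
  then have "{b. ?h b \<noteq> 0} \<subseteq> {b. g b \<noteq> 0}" by blast
  ultimately have "finite {b. ?h b \<noteq> 0}" using finite_subset by blast
  moreover have "?h b \<in> piece_dual (dual_module n Rs') (ind ({1..n} - supp b))" if b: "b \<in> nonneg_mdeg_set n" for b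
  proof -
    let ?P' = "piece (dual_module n Rs') (ind ({1..n} - supp b)) :: ((nat \<Rightarrow> 'k mpoly) \<Rightarrow> nat \<Rightarrow> 'k mpoly) set"
    have gb: "g b \<in> piece_dual (dual_module n Rs) (ind ({1..n} - supp b))"
      using g b by (simp add: carrier_alexander_dual)
    have eq: "?h b m = g b (pullback n Rs d m)" if "m \<in> ?P'" for m
      using that by (simp add: pushforward_def)
    show ?thesis
      unfolding piece_dual_dual_module
    proof (intro conjI ballI allI impI)
      fix x y assume xy: "x \<in> ?P'" "y \<in> ?P'"
      show "?h b (x + y) = ?h b x + ?h b y"
        unfolding eq[OF xy(1)] eq[OF xy(2)] eq[OF dual_piece_closed(2)[OF xy]] pullback_add
        using gb pullback_piece[OF d xy(1)] pullback_piece[OF d xy(2)] unfolding piece_dual_dual_module by blast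
    next
      fix c x assume x: "x \<in> ?P'"
      show "?h b (\<lambda>y j. const_poly c * x y j) = c * ?h b x"
        unfolding eq[OF x] eq[OF dual_piece_closed(3)[OF x]] pullback_scale
        using gb pullback_piece[OF d x] unfolding piece_dual_dual_module by blast
    qed (simp add: pushforward_def)
  qed
  moreover have "?h b = 0" if "b \<notin> nonneg_mdeg_set n" for b
    by (rule zero) (use g that in \<open>simp add: carrier_alexander_dual\<close>)
  ultimately show ?thesis by (simp add: carrier_alexander_dual)
qed

lemma pushforward_piece:
  assumes d: "d \<in> graded_maps n (free_module n Rs) (free_module n Rs')"
    and g: "g \<in> piece (alexander_dual n (dual_module n Rs)) b"
  shows "pushforward n Rs Rs' d g \<in> piece (alexander_dual n (dual_module n Rs')) b"
proof -
  have "pushforward n Rs Rs' d g c = 0" if "c \<noteq> b" for c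
    by (rule ext) (use g that in \<open>simp add: pushforward_def piece_alexander_dual\<close>)
  then show ?thesis using g pushforward_carrier[OF d] by (simp add: piece_alexander_dual)
qed

text \<open>Pulling back along both maps evaluates at \<open>d' (d x)\<close>, which is zero, so the
  functional is applied to the zero map.\<close>

lemma pushforward_pushforward:
  assumes d: "d \<in> graded_maps n (free_module n Rs) (free_module n Rs')"
    and d': "d' \<in> graded_maps n (free_module n Rs') (free_module n Rs'')"
    and dd: "\<And>x. x \<in> carrier (free_module n Rs) \<Longrightarrow> d' (d x) = 0"
    and g: "g \<in> carrier (alexander_dual n (dual_module n Rs))"
  shows "pushforward n Rs' Rs'' d' (pushforward n Rs Rs' d g) = 0"
proof (intro ext)
  fix b m
  show "pushforward n Rs' Rs'' d' (pushforward n Rs Rs' d g) b m = 0 b m"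
  proof (cases "m \<in> piece (dual_module n Rs'') (ind ({1..n} - supp b))")
    case True
    have mc: "m \<in> carrier (dual_module n Rs'')" using True by (simp add: piece_dual_module)
    have "pullback n Rs d (pullback n Rs' d' m) = 0"
      by (rule ext) (simp add: pullback_def dd free_graded_mapsD(1)[OF d] dual_module_zero_arg[OF mc])
    moreover have "g b 0 = 0"
    proof (cases "b \<in> nonneg_mdeg_set n")
      case True
      then show ?thesis
        using g by (intro piece_dual_zero_arg[of _ n Rs "ind ({1..n} - supp b)"]) (simp add: carrier_alexander_dual)
    qed (use g in \<open>simp add: carrier_alexander_dual\<close>)
    ultimately show ?thesis using pullback_piece[OF d' True] True by (simp add: pushforward_def)
  qed (simp add: pushforward_def)
qed

lemma AD_complex_simps:
  "cmod (alexander_dual_complex n (std_dual_complex n F)) i = alexander_dual n (dual_module n (gens F i))"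
  "cdiff (alexander_dual_complex n (std_dual_complex n F)) i = pushforward n (gens F i) (gens F (i + 1)) (fdiff F i)"
proof -
  show "cmod (alexander_dual_complex n (std_dual_complex n F)) i = alexander_dual n (dual_module n (gens F i))"
    by (simp add: alexander_dual_complex_def std_dual_complex_def dual_module_def)
  \<comment> \<open>The position changes sign twice, so A(D(F)) occupies the positions of
    \<open>F\<close> itself.\<close>
  have idx: "- (- i - 1) = i + 1" "i + 1 - 1 = i" by simp_all
  have 1: "cmod (std_dual_complex n F) (- i - 1) = dual_module n (gens F (i + 1))"
    by (simp only: std_dual_complex_def cochain.simps dual_module_def idx)
  have 2: "cdiff (std_dual_complex n F) (- i - 1) = pullback n (gens F i) (fdiff F i)"
    by (intro ext) (simp only: std_dual_complex_def cochain.simps pullback_def idx zero_fun_def)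
  show "cdiff (alexander_dual_complex n (std_dual_complex n F)) i = pushforward n (gens F i) (gens F (i + 1)) (fdiff F i)"
    by (intro ext) (simp only: alexander_dual_complex_def cochain.simps pushforward_def 1 2)
qed

lemma cochain_of_simps:
  "cmod (cochain_of n F) i = free_module n (gens F i)"
  "cdiff (cochain_of n F) i = fdiff F i"
  by (simp_all add: cochain_of_def)

lemma free_sqfree_complexD:
  assumes "free_sqfree_complex n F"
  shows "R \<in> set (gens F i) \<Longrightarrow> R \<subseteq> {1..n}"
    "fdiff F i \<in> graded_maps n (free_module n (gens F i)) (free_module n (gens F (i + 1)))"
    "x \<in> carrier (free_module n (gens F i)) \<Longrightarrow> fdiff F (i + 1) (fdiff F i x) = 0"
  using assms unfolding free_sqfree_complex_def bounded_complex_def cochain_of_simps free_module_simps by blast+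

lemma coboundaries_closed:
  fixes X :: "('k::field mpoly, 'm::ab_group_add) cochain"
  assumes d: "\<And>x y. x \<in> carrier (cmod X (i - 1)) \<Longrightarrow> y \<in> carrier (cmod X (i - 1)) \<Longrightarrow>
      cdiff X (i - 1) (x + y) = cdiff X (i - 1) x + cdiff X (i - 1) y"
    and closed: "0 \<in> carrier (cmod X (i - 1))"
      "\<And>x y. x \<in> carrier (cmod X (i - 1)) \<Longrightarrow> y \<in> carrier (cmod X (i - 1)) \<Longrightarrow> x + y \<in> carrier (cmod X (i - 1))"
      "\<And>x. x \<in> carrier (cmod X (i - 1)) \<Longrightarrow> - x \<in> carrier (cmod X (i - 1))"
  shows "0 \<in> coboundaries X i"
    and "x \<in> coboundaries X i \<Longrightarrow> y \<in> coboundaries X i \<Longrightarrow> x + y \<in> coboundaries X i"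
    and "x \<in> coboundaries X i \<Longrightarrow> - x \<in> coboundaries X i"
proof -
  have "cdiff X (i - 1) (0 + 0) = cdiff X (i - 1) 0 + cdiff X (i - 1) 0" by (rule d[OF closed(1) closed(1)])
  then have 0: "cdiff X (i - 1) 0 = 0"
    using add_cancel_right_right[of "cdiff X (i - 1) 0" "cdiff X (i - 1) 0"] by (simp only: add_0_left)
  show "0 \<in> coboundaries X i" unfolding coboundaries_def using closed(1) 0[symmetric] by (rule rev_image_eqI)
  show "x + y \<in> coboundaries X i" if xy: "x \<in> coboundaries X i" "y \<in> coboundaries X i"
  proof -
    obtain x' where x': "x' \<in> carrier (cmod X (i - 1))" "x = cdiff X (i - 1) x'"
      using xy(1) unfolding coboundaries_def by blast
    obtain y' where y': "y' \<in> carrier (cmod X (i - 1))" "y = cdiff X (i - 1) y'"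
      using xy(2) unfolding coboundaries_def by blast
    have "x + y = cdiff X (i - 1) (x' + y')" "x' + y' \<in> carrier (cmod X (i - 1))"
      using d[OF x'(1) y'(1)] closed(2)[OF x'(1) y'(1)] x'(2) y'(2) by simp_all
    then show ?thesis unfolding coboundaries_def by blast
  qed
  show "- x \<in> coboundaries X i" if x: "x \<in> coboundaries X i"
  proof -
    obtain x' where x': "x' \<in> carrier (cmod X (i - 1))" "x = cdiff X (i - 1) x'"
      using x unfolding coboundaries_def by blast
    have "cdiff X (i - 1) (x' + - x') = cdiff X (i - 1) x' + cdiff X (i - 1) (- x')"
      by (rule d[OF x'(1) closed(3)[OF x'(1)]])
    then have "x + cdiff X (i - 1) (- x') = 0" using 0 x' by (simp only: add.right_inverse)
    then have "- x = cdiff X (i - 1) (- x')" by (rule minus_unique)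
    then show ?thesis using closed(3)[OF x'(1)] unfolding coboundaries_def by blast
  qed
qed

text \<open>Both sides are Euler characteristics of the strands in degree \<open>ind T\<close>:
  generators of \<open>G\<close> count if they lie inside \<open>T\<close>, generators of
  \<open>F\<close> if they contain it. The work lies in passing from \<open>quasi_iso\<close>, a
  statement on full modules, to this one strand.\<close>

theorem is_AD_euler_characteristic:
  fixes F G :: "'k::field mpoly free_cochain"
  assumes F: "free_sqfree_complex n F" and AD: "is_AD n F G" and T: "T \<subseteq> {1..n}"
    and I: "finite I" "\<And>i. i \<notin> I \<Longrightarrow> gens F i = []" "\<And>i. i \<notin> I \<Longrightarrow> gens G i = []"
  shows "(\<Sum>i\<in>I. alt i * int (length (filter (\<lambda>R. R \<subseteq> T) (gens G i))))
    = (\<Sum>i\<in>I. alt i * int (length (filter (\<lambda>R. T \<subseteq> R) (gens F i))))"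
proof -
  have G: "free_sqfree_complex n G"
    using AD by (simp add: is_AD_def minimal_free_resolution_def)
  define X where "X = cochain_of n G"
  define Y where "Y = alexander_dual_complex n (std_dual_complex n F)"
  obtain \<phi> where q: "quasi_iso n X Y \<phi>"
    using AD unfolding is_AD_def minimal_free_resolution_def X_def Y_def by blast
  let ?FG = "\<lambda>i. free_module n (gens G i) :: ('k mpoly, nat \<Rightarrow> 'k mpoly) gr_module"
  let ?AF = "\<lambda>i. alexander_dual n (dual_module n (gens F i)) :: ('k mpoly, _) gr_module"
  let ?d = "fdiff G"
  let ?\<delta> = "\<lambda>i. pushforward n (gens F i) (gens F (i + 1)) (fdiff F i)"
  let ?b = "ind T"
  have X: "cmod X i = ?FG i" "cdiff X i = ?d i" for i
    by (simp_all add: X_def cochain_of_simps)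
  have Y: "cmod Y i = ?AF i" "cdiff Y i = ?\<delta> i" for i
    by (simp_all only: Y_def AD_complex_simps)
  note Gd = free_graded_mapsD[OF free_sqfree_complexD(2)[OF G]]
  have pieceG: "x \<in> carrier (?FG i)" if "x \<in> piece (?FG i) c" for i x c
    using that by (simp add: piece_free_module)
  have \<phi>: "\<phi> i \<in> graded_maps n (?FG i) (?AF i)" for i
    using q unfolding quasi_iso_def X Y by blast
  have \<phi>_car: "\<phi> i x \<in> carrier (?AF i)" if "x \<in> carrier (?FG i)" for i x
    using graded_mapsD(1)[OF \<phi>] that .
  have \<phi>_add: "\<phi> i (x + y) = \<phi> i x + \<phi> i y" if "x \<in> carrier (?FG i)" "y \<in> carrier (?FG i)" for i x y
    using graded_mapsD(2)[OF \<phi>] that unfolding free_module_simps alexander_dual_simps by blast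
  have \<phi>_scale: "\<phi> i (fscale c x) = dscale c (\<phi> i x)" if x: "x \<in> carrier (?FG i)" for i c x
  proof -
    have "\<phi> i (fscale c x) = const_poly c \<odot>\<^bsub>?AF i\<^esub> \<phi> i x"
      using graded_mapsD(3)[OF \<phi> polyring_const x] unfolding free_module_simps fscale_def .
    also have "\<dots> = dscale c (\<phi> i x)"
      by (rule alexander_dual_smult_const[OF \<phi>_car[OF x]]) (simp add: dual_module_simps)
    finally show ?thesis .
  qed
  have \<phi>_piece: "\<phi> i x \<in> piece (?AF i) c" if "x \<in> piece (?FG i) c" for i x c
    using graded_mapsD(4)[OF \<phi>] that .
  have \<phi>_comm: "\<phi> (i + 1) (?d i x) = ?\<delta> i (\<phi> i x)" if "x \<in> carrier (?FG i)" for i x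
    using q that unfolding quasi_iso_def X Y by blast
  \<comment> \<open>An element of the Alexander dual is a family over degrees, so its value at
    \<open>c\<close> depends only on the component of degree \<open>c\<close> of the
    argument.\<close>
  have \<phi>_comp: "\<phi> i x c = \<phi> i (component (gens G i) c x) c" if x: "x \<in> carrier (?FG i)" for i x c
  proof -
    obtain C where C: "finite C" "c \<in> C" "x = (\<Sum>e\<in>C. component (gens G i) e x)"
      using sum_components[OF x] by blast
    have "\<phi> i x = \<phi> i (\<Sum>e\<in>C. component (gens G i) e x)" using C(3) by simp
    also have "\<dots> = (\<Sum>e\<in>C. \<phi> i (component (gens G i) e x))"
      by (rule additive_sum_free_module[where \<psi> = "\<phi> i" and n = n and Rs = "gens G i", OF \<phi>_add C(1)])
        (assumption | rule pieceG[OF component_piece[OF x]])+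
    finally have "\<phi> i x c = (\<Sum>e\<in>C. \<phi> i (component (gens G i) e x) c)" by (simp add: sum_apply)
    also have "\<dots> = (\<Sum>e\<in>C. if e = c then \<phi> i (component (gens G i) e x) c else 0)"
      by (rule sum.cong) (use \<phi>_piece[OF component_piece[OF x]] in \<open>auto simp: piece_alexander_dual\<close>)
    also have "\<dots> = \<phi> i (component (gens G i) c x) c" using C by simp
    finally show ?thesis .
  qed
  have pieceA: "x \<in> carrier (?AF i)" if "x \<in> piece (?AF i) c" for i x c
    using that by (simp add: piece_alexander_dual)
  have \<delta>_piece: "?\<delta> i g \<in> piece (?AF (i + 1)) c" if "g \<in> piece (?AF i) c" for i g c
    using pushforward_piece[OF free_sqfree_complexD(2)[OF F] that] .
  have \<delta>\<delta>: "?\<delta> (i + 1) (?\<delta> i g) = 0" if "g \<in> carrier (?AF i)" for i g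
    by (rule pushforward_pushforward[OF free_sqfree_complexD(2)[OF F] free_sqfree_complexD(2)[OF F]
        free_sqfree_complexD(3)[OF F] that])
  have XB: "0 \<in> coboundaries X i" for i
    by (rule coboundaries_closed(1)) (simp_all only: X Gd(2) free_module_zero free_module_closed)
  have YB: "0 \<in> coboundaries Y i"
    "x \<in> coboundaries Y i \<Longrightarrow> y \<in> coboundaries Y i \<Longrightarrow> x + y \<in> coboundaries Y i"
    "x \<in> coboundaries Y i \<Longrightarrow> - x \<in> coboundaries Y i" for i x y
    by (rule coboundaries_closed[of Y i];
        simp only: Y pushforward_linear alexander_dual_zero alexander_dual_closed)+
  have cob: "coboundaries X (i + 1) = ?d i ` carrier (?FG i)" "coboundaries Y (i + 1) = ?\<delta> i ` carrier (?AF i)" for i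
    unfolding coboundaries_def X Y by simp_all
  have coc: "cocycles X i = {x \<in> carrier (?FG i). ?d i x = 0}" "cocycles Y i = {x \<in> carrier (?AF i). ?\<delta> i x = 0}" for i
    unfolding cocycles_def X Y free_module_simps alexander_dual_simps by simp_all
  have d0: "?d i 0 = 0" for i
    using Gd(2)[OF free_module_zero free_module_zero] by simp
  have sub: "coboundaries X (i + 1) \<subseteq> carrier (cmod X (i + 1))" for i
    unfolding cob X using Gd(1) by blast
  have img: "\<phi> (i + 1) ` coboundaries X (i + 1) \<subseteq> coboundaries Y (i + 1)" for i
    unfolding cob using \<phi>_comm \<phi>_car by auto
  have zc: "0 \<in> cocycles X i" for i unfolding coc using free_module_zero d0 by blast
  have add_eq: "x \<oplus>\<^bsub>cmod X i\<^esub> y = x + y" "x' \<oplus>\<^bsub>cmod Y i\<^esub> y' = x' + y'" for i x y x' y'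
    unfolding X Y free_module_simps alexander_dual_simps by simp_all
  have \<phi>_add': "\<phi> i (x + y) = \<phi> i x + \<phi> i y" if "x \<in> carrier (cmod X i)" "y \<in> carrier (cmod X i)" for i x y
    using \<phi>_add that unfolding X by blast
  have qi_inj: "x \<in> coboundaries X (i + 1)"
    if "x \<in> cocycles X (i + 1)" "\<phi> (i + 1) x \<in> coboundaries Y (i + 1)" for i x
    by (rule quasi_iso_inj[where i = "i + 1", OF q])
      (assumption | rule add_eq XB YB(1) zc YB(2,3) sub \<phi>_add' img that)+
  have qi_surj: "\<exists>x\<in>cocycles X (i + 1). y - \<phi> (i + 1) x \<in> coboundaries Y (i + 1)"
    if "y \<in> cocycles Y (i + 1)" for i y
    by (rule quasi_iso_surj[where i = "i + 1", OF q])
      (assumption | rule add_eq XB YB(1) zc YB(2,3) sub \<phi>_add' img that)+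
  interpret vector_space_pair "fscale :: 'k \<Rightarrow> (nat \<Rightarrow> 'k mpoly) \<Rightarrow> _"
    "dscale :: 'k \<Rightarrow> (mdeg \<Rightarrow> ((nat \<Rightarrow> 'k mpoly) \<Rightarrow> nat \<Rightarrow> 'k mpoly) \<Rightarrow> 'k) \<Rightarrow> _"
    by unfold_locales
  have "(\<Sum>i\<in>I. alt i * int (fs.dim (piece (?FG i) ?b))) = (\<Sum>i\<in>I. alt i * int (ds.dim (piece (?AF i) ?b)))"
  proof (rule euler_characteristic_quasi_iso[where d = ?d and \<delta> = ?\<delta> and \<phi> = \<phi>])
    fix i
    show "piece (?FG i) ?b = {0}" "piece (?AF i) ?b = {0}" if "i \<notin> I"
      using I(2,3)[OF that] T piece_free_module_ind(3)[of T n "[]"] piece_alexander_dual_ind(3)[of "[]" n T]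
      by simp_all
    show "\<exists>S. finite S \<and> piece (?FG i) ?b \<subseteq> fs.span S"
      by (rule piece_free_module_ind(2)[OF T])
    show "\<exists>S. finite S \<and> piece (?AF i) ?b \<subseteq> ds.span S"
      by (rule piece_alexander_dual_ind(2)[OF free_sqfree_complexD(1)[OF F] T])
    show "linear_on fscale fscale (piece (?FG i) ?b) (?d i)"
      unfolding linear_on_def
      using Gd(2)[OF pieceG pieceG] Gd(3)[OF polyring_const pieceG] by (auto simp: fscale_def)
    show "?d i ` piece (?FG i) ?b \<subseteq> piece (?FG (i + 1)) ?b" using Gd(4) by blast
    show "?d (i + 1) (?d i x) = 0" if "x \<in> piece (?FG i) ?b" for x
      by (rule free_sqfree_complexD(3)[OF G pieceG[OF that]])
    show "linear_on dscale dscale (piece (?AF i) ?b) (?\<delta> i)"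
      unfolding linear_on_def by (simp add: pushforward_linear)
    show "?\<delta> i ` piece (?AF i) ?b \<subseteq> piece (?AF (i + 1)) ?b" using \<delta>_piece by blast
    show "?\<delta> (i + 1) (?\<delta> i x) = 0" if "x \<in> piece (?AF i) ?b" for x
      by (rule \<delta>\<delta>[OF pieceA[OF that]])
    show "linear_on fscale dscale (piece (?FG i) ?b) (\<phi> i)"
      unfolding linear_on_def using \<phi>_add[OF pieceG pieceG] \<phi>_scale[OF pieceG] by blast
    show "\<phi> i ` piece (?FG i) ?b \<subseteq> piece (?AF i) ?b" using \<phi>_piece by blast
    show "\<phi> (i + 1) (?d i x) = ?\<delta> i (\<phi> i x)" if "x \<in> piece (?FG i) ?b" for x
      by (rule \<phi>_comm[OF pieceG[OF that]])
    show "x \<in> ?d i ` piece (?FG i) ?b"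
      if x: "x \<in> piece (?FG (i + 1)) ?b" "?d (i + 1) x = 0" "\<phi> (i + 1) x \<in> ?\<delta> i ` piece (?AF i) ?b" for x
    proof -
      have "x \<in> cocycles X (i + 1)" using x pieceG unfolding coc by blast
      moreover have "\<phi> (i + 1) x \<in> coboundaries Y (i + 1)" using x(3) pieceA unfolding cob by blast
      ultimately have "x \<in> coboundaries X (i + 1)" by (rule qi_inj)
      \<comment> \<open>This \<open>z\<close> may be inhomogeneous. As \<open>x\<close> is
        homogeneous, the component of \<open>z\<close> in degree \<open>?b\<close> has the same
        image.\<close>
      then obtain z where z: "z \<in> carrier (?FG i)" "x = ?d i z" unfolding cob by blast
      have "x = component (gens G (i + 1)) ?b x" using component_of_piece[OF x(1), of ?b] by simp
      also have "\<dots> = ?d i (component (gens G i) ?b z)"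
        unfolding z(2) by (rule component_graded_map[OF free_sqfree_complexD(2)[OF G] z(1)])
      finally show ?thesis using component_piece[OF z(1)] by blast
    qed
    show "\<exists>x\<in>piece (?FG (i + 1)) ?b. ?d (i + 1) x = 0 \<and> y - \<phi> (i + 1) x \<in> ?\<delta> i ` piece (?AF i) ?b"
      if y: "y \<in> piece (?AF (i + 1)) ?b" "?\<delta> (i + 1) y = 0" for y
    proof -
      have "y \<in> cocycles Y (i + 1)" using y pieceA unfolding coc by blast
      then obtain z where z: "z \<in> cocycles X (i + 1)" "y - \<phi> (i + 1) z \<in> coboundaries Y (i + 1)"
        using qi_surj by blast
      then obtain w where w: "w \<in> carrier (?AF i)" "y - \<phi> (i + 1) z = ?\<delta> i w" unfolding cob by blast
      have zc: "z \<in> carrier (?FG (i + 1))" "?d (i + 1) z = 0" using z unfolding coc by blast+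
      define x where "x = component (gens G (i + 1)) ?b z"
      have x: "x \<in> piece (?FG (i + 1)) ?b" unfolding x_def by (rule component_piece[OF zc(1)])
      have "?d (i + 1) x = component (gens G (i + 1 + 1)) ?b (?d (i + 1) z)"
        unfolding x_def by (rule component_graded_map[OF free_sqfree_complexD(2)[OF G] zc(1), symmetric])
      then have dx: "?d (i + 1) x = 0" using zc(2) by (simp add: component_zero)
      \<comment> \<open>On the Alexander dual, taking a component means truncating the
        family.\<close>
      define w' where "w' c = (if c = ?b then w c else 0)" for c
      have w': "w' \<in> piece (?AF i) ?b"
      proof -
        have "finite {c. w' c \<noteq> 0}" by (rule finite_subset[of _ "{?b}"]) (auto simp: w'_def)
        then show ?thesis
          using w(1) by (simp add: piece_alexander_dual carrier_alexander_dual w'_def piece_dual_closed)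
      qed
      have "y - \<phi> (i + 1) x = ?\<delta> i w'"
      proof
        fix c
        show "(y - \<phi> (i + 1) x) c = ?\<delta> i w' c"
        proof (cases "c = ?b")
          case True
          have "(y - \<phi> (i + 1) x) c = (y - \<phi> (i + 1) z) c"
            using \<phi>_comp[OF zc(1), of ?b] True by (simp add: x_def)
          also have "\<dots> = ?\<delta> i w' c"
            unfolding w(2) by (rule pushforward_cong) (simp add: w'_def True)
          finally show ?thesis .
        next
          case False
          then have "y c = 0" "\<phi> (i + 1) x c = 0" "?\<delta> i w' c = 0"
            using y(1) \<phi>_piece[OF x] \<delta>_piece[OF w'] by (auto simp: piece_alexander_dual)
          then show ?thesis by simp
        qed
      qed
      then show ?thesis using x dx w' by blast
    qed
  qed (use I in \<open>simp_all add: subspace_piece_free_module subspace_piece_alexander_dual\<close>)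
  then show ?thesis
    by (simp only: piece_free_module_ind(1)[OF T]
        piece_alexander_dual_ind(1)[OF free_sqfree_complexD(1)[OF F] T])
qed

section \<open>Degree polynomials\<close>

lemma smult_sum_right: "smult c (\<Sum>i\<in>A. g i) = (\<Sum>i\<in>A. smult c (g i))"
  by (rule poly_eqI) (simp add: coeff_sum sum_distrib_left)

lemma transf_sum: "transf n (\<Sum>i\<in>A. g i) = (\<Sum>i\<in>A. transf n (g i))"
  by (simp add: transf_def coeff_sum smult_sum sum.swap[of _ A])

lemma transf_monom:
  assumes "d \<le> n"
  shows "transf n (monom 1 d) = [:1, -1:] ^ (n - d)"
proof -
  have "transf n (monom 1 d) = (\<Sum>e\<le>n. if d = e then [:1, -1:] ^ (n - e) else 0)"
    unfolding transf_def by (rule sum.cong) auto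
  then show ?thesis using assms by simp
qed

text \<open>
  Summing the Euler characteristic identity over all \<open>T\<close> with these weights turns the generators
  of degree \<open>R\<close> on its two sides into $t^{|R|}$ and $(1-t)^{n-|R|}$.
\<close>

definition weight :: "nat \<Rightarrow> nat set \<Rightarrow> rat poly" where
  "weight n T = monom 1 (card T) * [:1, -1:] ^ (n - card T)"

lemma sum_Pow_powers:
  fixes x y :: "'a :: comm_ring_1"
  assumes "finite S"
  shows "(\<Sum>U\<in>Pow S. x ^ card U * y ^ (card S - card U)) = (x + y) ^ card S"
proof -
  have "(x + y) ^ card S = (\<Prod>i\<in>S. x + y)" by simp
  also have "\<dots> = (\<Sum>U\<in>Pow S. (\<Prod>i\<in>U. x) * (\<Prod>i\<in>S - U. y))"
    using assms by (rule prod_add)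
  also have "\<dots> = (\<Sum>U\<in>Pow S. x ^ card U * y ^ (card S - card U))"
    by (rule sum.cong) (use assms in \<open>auto simp: card_Diff_subset finite_subset\<close>)
  finally show ?thesis ..
qed

text \<open>The binomial theorem for t + (1 - t) = 1.\<close>

lemma sum_weight_Pow:
  assumes "finite S"
  shows "(\<Sum>U\<in>Pow S. monom 1 (card U) * [:1, -1:] ^ (card S - card U)) = (1 :: rat poly)"
proof -
  have "monom 1 1 + [:1, -1:] = (1 :: rat poly)" by (simp add: monom_altdef one_pCons)
  then show ?thesis
    using sum_Pow_powers[OF assms, of "monom 1 1 :: rat poly" "[:1, -1:]"] by (simp add: monom_power)
qed

text \<open>The exponents with support \<open>T\<close> have generating function t^|T|/(1-t)^|T|,
  and multiplication by (1-t)^n gives \<open>weight n T\<close>. The sum is therefore the Hilbert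
  numerator of S(-R). For the computation \<open>T\<close> is written as \<open>R\<close> with a
  disjoint \<open>U\<close> added, and the part in \<open>U\<close> sums to one.\<close>

lemma sum_weight_supersets:
  assumes R: "R \<subseteq> {1..n}"
  shows "(\<Sum>T\<in>Pow {1..n}. if R \<subseteq> T then weight n T else 0) = monom 1 (card R)"
proof -
  let ?S = "{1..n} - R"
  have fin: "finite R" using R finite_subset by blast
  have S: "card ?S = n - card R" using R fin by (simp add: card_Diff_subset)
  have "(\<Sum>T\<in>Pow {1..n}. if R \<subseteq> T then weight n T else 0) = (\<Sum>T\<in>{T \<in> Pow {1..n}. R \<subseteq> T}. weight n T)"
    by (rule sum.inter_filter[symmetric]) simp
  also have "\<dots> = (\<Sum>U\<in>Pow ?S. weight n (R \<union> U))"
    by (rule sum.reindex_bij_witness[of _ "\<lambda>U. R \<union> U" "\<lambda>T. T - R"]) (use R in \<open>auto simp: Un_absorb1\<close>)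
  also have "\<dots> = (\<Sum>U\<in>Pow ?S. monom 1 (card R) * (monom 1 (card U) * [:1, -1:] ^ (card ?S - card U)))"
  proof (rule sum.cong)
    fix U assume U: "U \<in> Pow ?S"
    then have "finite U" using finite_subset by blast
    then have c: "card (R \<union> U) = card R + card U" using U fin by (intro card_Un_disjoint) auto
    have e: "n - card (R \<union> U) = card ?S - card U" by (simp only: c S diff_diff_left)
    have m: "monom (1 :: rat) (card (R \<union> U)) = monom 1 (card R) * monom 1 (card U)"
      by (simp add: c mult_monom)
    show "weight n (R \<union> U) = monom 1 (card R) * (monom 1 (card U) * [:1, -1:] ^ (card ?S - card U))"
      by (simp only: weight_def e m mult.assoc)
  qed simp
  also have "\<dots> = monom 1 (card R)"
    unfolding sum_distrib_left[symmetric] by (subst sum_weight_Pow) simp_all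
  finally show ?thesis .
qed

text \<open>The Hilbert numerator of S/(x_i : i not in R), the module to which the duality sends
  S(-R). All weights involved share the factor (1-t)^(n - |R|), and the rest sums to one.\<close>

lemma sum_weight_subsets:
  assumes R: "R \<subseteq> {1..n}"
  shows "(\<Sum>T\<in>Pow {1..n}. if T \<subseteq> R then weight n T else 0) = [:1, -1:] ^ (n - card R)"
proof -
  have fin: "finite R" using R finite_subset by blast
  have cR: "card R \<le> n" using card_mono[OF _ R] by simp
  have "(\<Sum>T\<in>Pow {1..n}. if T \<subseteq> R then weight n T else 0) = (\<Sum>T\<in>{T \<in> Pow {1..n}. T \<subseteq> R}. weight n T)"
    by (rule sum.inter_filter[symmetric]) simp
  also have "{T \<in> Pow {1..n}. T \<subseteq> R} = Pow R" using R by auto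
  also have "(\<Sum>T\<in>Pow R. weight n T)
      = (\<Sum>T\<in>Pow R. (monom 1 (card T) * [:1, -1:] ^ (card R - card T)) * [:1, -1:] ^ (n - card R))"
  proof (rule sum.cong)
    fix T assume "T \<in> Pow R"
    then have "card T \<le> card R" using fin by (simp add: card_mono)
    then have "n - card T = (card R - card T) + (n - card R)" using cR by simp
    then show "weight n T = (monom 1 (card T) * [:1, -1:] ^ (card R - card T)) * [:1, -1:] ^ (n - card R)"
      by (simp only: weight_def power_add mult.assoc)
  qed simp
  also have "\<dots> = [:1, -1:] ^ (n - card R)"
    unfolding sum_distrib_right[symmetric] sum_weight_Pow[OF fin] by simp
  finally show ?thesis .
qed

text \<open>The position set is a parameter, so that several complexes can be compared over one
  finite set containing all their nonempty positions.\<close>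

definition degree_poly :: "int set \<Rightarrow> 'k::field mpoly free_cochain \<Rightarrow> rat poly" where
  "degree_poly I F = (\<Sum>i\<in>I. \<Sum>j<length (gens F i). smult (of_int (alt i)) (monom 1 (card (gens F i ! j))))"

lemma length_filter_sum: "of_nat (length (filter P xs)) = (\<Sum>j<length xs. if P (xs ! j) then 1 else (0 :: 'a :: semiring_1))"
  by (induction xs) (simp_all add: sum.lessThan_Suc_shift del: sum.lessThan_Suc)

text \<open>An exchange of summations, abstract in the relation \<open>P\<close> so that it serves
  both directions of containment.\<close>

lemma weighted_sum:
  assumes "\<And>i j. j < length (gens F i) \<Longrightarrow> (\<Sum>T\<in>Pow {1..n}. if P (gens F i ! j) T then weight n T else 0) = h (gens F i ! j)"
  shows "(\<Sum>T\<in>Pow {1..n}. smult (of_int (\<Sum>i\<in>I. alt i * int (length (filter (\<lambda>R. P R T) (gens F i))))) (weight n T))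
    = (\<Sum>i\<in>I. \<Sum>j<length (gens F i). smult (of_int (alt i)) (h (gens F i ! j)))"
proof -
  have "(\<Sum>T\<in>Pow {1..n}. smult (of_int (\<Sum>i\<in>I. alt i * int (length (filter (\<lambda>R. P R T) (gens F i))))) (weight n T))
    = (\<Sum>T\<in>Pow {1..n}. \<Sum>i\<in>I. \<Sum>j<length (gens F i).
        smult (of_int (alt i)) (if P (gens F i ! j) T then weight n T else 0))"
  proof (rule sum.cong)
    fix T
    have "smult (of_int (alt i * int (length (filter (\<lambda>R. P R T) (gens F i))))) (weight n T)
      = (\<Sum>j<length (gens F i). smult (of_int (alt i)) (if P (gens F i ! j) T then weight n T else 0))" for i
    proof -
      have "(of_int (alt i * int (length (filter (\<lambda>R. P R T) (gens F i)))) :: rat)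
        = (\<Sum>j<length (gens F i). of_int (alt i) * (if P (gens F i ! j) T then 1 else 0))"
        by (simp add: length_filter_sum[where 'a = rat] sum_distrib_left)
      then show ?thesis by (auto simp: smult_sum intro!: sum.cong)
    qed
    then show "smult (of_int (\<Sum>i\<in>I. alt i * int (length (filter (\<lambda>R. P R T) (gens F i))))) (weight n T)
      = (\<Sum>i\<in>I. \<Sum>j<length (gens F i). smult (of_int (alt i)) (if P (gens F i ! j) T then weight n T else 0))"
      by (simp only: of_int_sum smult_sum)
  qed simp
  also have "\<dots> = (\<Sum>i\<in>I. \<Sum>T\<in>Pow {1..n}. \<Sum>j<length (gens F i).
        smult (of_int (alt i)) (if P (gens F i ! j) T then weight n T else 0))"
    by (rule sum.swap)
  also have "\<dots> = (\<Sum>i\<in>I. \<Sum>j<length (gens F i). \<Sum>T\<in>Pow {1..n}.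
        smult (of_int (alt i)) (if P (gens F i ! j) T then weight n T else 0))"
    by (intro sum.cong refl sum.swap)
  also have "\<dots> = (\<Sum>i\<in>I. \<Sum>j<length (gens F i). smult (of_int (alt i)) (h (gens F i ! j)))"
  proof (intro sum.cong refl)
    fix i j assume "j \<in> {..<length (gens F i)}"
    then show "(\<Sum>T\<in>Pow {1..n}. smult (of_int (alt i)) (if P (gens F i ! j) T then weight n T else 0))
      = smult (of_int (alt i)) (h (gens F i ! j))"
      using assms[of j i] by (simp add: smult_sum_right[symmetric])
  qed
  finally show ?thesis .
qed

lemma degree_poly_is_AD:
  fixes F G :: "'k::field mpoly free_cochain"
  assumes F: "free_sqfree_complex n F" and AD: "is_AD n F G"
    and I: "finite I" "\<And>i. i \<notin> I \<Longrightarrow> gens F i = []" "\<And>i. i \<notin> I \<Longrightarrow> gens G i = []"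
  shows "degree_poly I G = transf n (degree_poly I F)"
proof -
  have G: "free_sqfree_complex n G"
    using AD by (simp add: is_AD_def minimal_free_resolution_def)
  have sub: "gens F i ! j \<subseteq> {1..n}" if "j < length (gens F i)" for i j
    by (rule free_sqfree_complexD(1)[OF F nth_mem[OF that]])
  have subG: "gens G i ! j \<subseteq> {1..n}" if "j < length (gens G i)" for i j
    by (rule free_sqfree_complexD(1)[OF G nth_mem[OF that]])
  have "degree_poly I G = (\<Sum>T\<in>Pow {1..n}. smult (of_int (\<Sum>i\<in>I. alt i * int (length (filter (\<lambda>R. R \<subseteq> T) (gens G i))))) (weight n T))"
    unfolding degree_poly_def
    by (rule weighted_sum[symmetric, where P = "\<lambda>R T. R \<subseteq> T" and h = "\<lambda>R. monom 1 (card R)"])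
      (rule sum_weight_supersets[OF subG])
  also have "\<dots> = (\<Sum>T\<in>Pow {1..n}. smult (of_int (\<Sum>i\<in>I. alt i * int (length (filter (\<lambda>R. T \<subseteq> R) (gens F i))))) (weight n T))"
    by (rule sum.cong) (use is_AD_euler_characteristic[OF F AD _ I] in simp_all)
  also have "\<dots> = (\<Sum>i\<in>I. \<Sum>j<length (gens F i). smult (of_int (alt i)) ([:1, -1:] ^ (n - card (gens F i ! j))))"
    by (rule weighted_sum[where P = "\<lambda>R T. T \<subseteq> R" and h = "\<lambda>R. [:1, -1:] ^ (n - card R)"])
      (rule sum_weight_subsets[OF sub])
  also have "\<dots> = transf n (degree_poly I F)"
    unfolding degree_poly_def transf_sum transf_smult
  proof (intro sum.cong refl)
    fix i j assume "j \<in> {..<length (gens F i)}"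
    then have "card (gens F i ! j) \<le> n" using card_mono[OF _ sub[of j i]] by simp
    then show "smult (of_int (alt i)) ([:1, -1:] ^ (n - card (gens F i ! j)))
      = smult (of_int (alt i)) (transf n (monom 1 (card (gens F i ! j))))"
      by (simp add: transf_monom)
  qed
  finally show ?thesis .
qed

section \<open>Degree polynomials of pure complexes and of triplets\<close>

lemma coeff_degree_poly:
  "coeff (degree_poly I F) e = (\<Sum>i\<in>I. of_int (alt i) * of_nat (length (filter (\<lambda>R. card R = e) (gens F i))))"
  unfolding degree_poly_def coeff_sum length_filter_sum sum_distrib_left
  by (intro sum.cong refl) simp

lemma pure_complex_finite:
  assumes "pure_complex F D \<beta>"
  shows "finite {i. gens F i \<noteq> []}"
proof -
  obtain p r where "\<forall>j. j \<notin> {p - int r..p} \<longrightarrow> gens F j = []"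
    using assms unfolding pure_complex_def by blast
  then have "{i. gens F i \<noteq> []} \<subseteq> {p - int r..p}" by blast
  then show ?thesis by (rule finite_subset) simp
qed

text \<open>In a pure complex every degree occurs in one position only, so nothing cancels and the
  coefficients are the Betti numbers up to sign. The position \<open>p\<close> of the smallest
  degree is made available because it fixes these signs.\<close>

lemma coeff_degree_poly_pure:
  assumes pure: "pure_complex F D \<beta>" and I: "finite I" "\<And>i. i \<notin> I \<Longrightarrow> gens F i = []"
  obtains p where "finite D" "\<And>e. e \<notin> D \<Longrightarrow> coeff (degree_poly I F) e = 0"
    "\<And>k. k < card D \<Longrightarrow> coeff (degree_poly I F) (sorted_list_of_set D ! k) = of_int (alt (p - int k)) * of_nat (\<beta> k)"
    "\<And>k. k < card D \<Longrightarrow> \<beta> k \<ge> 1"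
proof -
  obtain p :: int and r d where d: "strict_mono_on {..r} d" "D = d ` {..r}"
    and b: "\<And>k. k \<le> r \<Longrightarrow> \<beta> k \<ge> 1 \<and> length (gens F (p - int k)) = \<beta> k \<and> (\<forall>R\<in>set (gens F (p - int k)). card R = d k)"
    and out: "\<And>j. j \<notin> {p - int r..p} \<Longrightarrow> gens F j = []"
    using pure unfolding pure_complex_def by blast
  have inj: "inj_on d {..r}" using d(1) by (rule strict_mono_on_imp_inj_on)
  have card: "card D = Suc r" unfolding d(2) using inj by (simp add: card_image)
  have deg: "\<exists>k\<le>r. i = p - int k \<and> (\<forall>R\<in>set (gens F i). card R = d k)" if "gens F i \<noteq> []" for i
  proof -
    have i: "i \<in> {p - int r..p}" using that out by blast
    then have "nat (p - i) \<le> r" "i = p - int (nat (p - i))" by auto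
    then show ?thesis using b by metis
  qed
  \<comment> \<open>The enumeration \<open>d\<close> is thereby determined by \<open>D\<close>,
    which aligns the Betti numbers of two complexes with the same degree set.\<close>
  have sorted: "sorted_list_of_set D = map d [0..<Suc r]"
  proof (rule sorted_distinct_set_unique)
    show "sorted (map d [0..<Suc r])"
      unfolding sorted_iff_nth_mono
    proof (intro allI impI)
      fix i j assume ij: "i \<le> j" "j < length (map d [0..<Suc r])"
      then have "d i \<le> d j"
        using strict_mono_onD[OF d(1), of i j] by (cases "i = j") (simp_all del: upt_Suc)
      then show "map d [0..<Suc r] ! i \<le> map d [0..<Suc r] ! j" using ij by (simp del: upt_Suc)
    qed
    show "distinct (map d [0..<Suc r])"
      using inj by (simp only: distinct_map distinct_upt set_upt simp_thms) (simp add: atLeast0LessThan lessThan_Suc_atMost)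
  qed (use d in \<open>auto simp del: upt_Suc simp: atLeast0LessThan lessThan_Suc_atMost\<close>)
  show thesis
  proof
    show "finite D" using d by simp
    fix e assume e: "e \<notin> D"
    have "filter (\<lambda>R. card R = e) (gens F i) = []" for i
      using deg[of i] e d(2) by (cases "gens F i = []") (auto simp: filter_empty_conv)
    then show "coeff (degree_poly I F) e = 0" by (simp add: coeff_degree_poly)
  next
    fix k assume k: "k < card D"
    then have kr: "k \<le> r" using card by simp
    show "\<beta> k \<ge> 1" using b[OF kr] by blast
    have "sorted_list_of_set D ! k = d k" using kr unfolding sorted by (simp del: upt_Suc)
    moreover have "coeff (degree_poly I F) (d k) = (\<Sum>i\<in>I. if i = p - int k then of_int (alt i) * of_nat (\<beta> k) else 0)"
      unfolding coeff_degree_poly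
    proof (rule sum.cong)
      fix i
      show "of_int (alt i) * of_nat (length (filter (\<lambda>R. card R = d k) (gens F i)))
        = (if i = p - int k then of_int (alt i) * of_nat (\<beta> k) else (0 :: rat))"
      proof (cases "i = p - int k")
        case True
        then have "filter (\<lambda>R. card R = d k) (gens F i) = gens F i" using b[OF kr] by (simp add: filter_id_conv)
        then show ?thesis using True b[OF kr] by simp
      next
        case False
        have "filter (\<lambda>R. card R = d k) (gens F i) = []"
        proof (cases "gens F i = []")
          case nonempty: False
          then obtain l where l: "l \<le> r" "i = p - int l" "\<forall>R\<in>set (gens F i). card R = d l" using deg by blast
          then have "d l \<noteq> d k" using False inj kr by (auto simp: inj_on_eq_iff)
          then show ?thesis using l by (auto simp: filter_empty_conv)
        qed simp
        then show ?thesis using False by simp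
      qed
    qed simp
    moreover have "p - int k \<in> I"
    proof (rule ccontr)
      assume "p - int k \<notin> I"
      then have "gens F (p - int k) = []" by (rule I(2))
      then show False using b[OF kr] by auto
    qed
    ultimately show "coeff (degree_poly I F) (sorted_list_of_set D ! k) = of_int (alt (p - int k)) * of_nat (\<beta> k)"
      using I(1) by simp
  qed
qed

lemma alt_nonzero: "alt i \<noteq> 0"
  by (simp add: alt_def)

lemma degree_poly_pure_nonzero:
  assumes pure: "pure_complex F D \<beta>" and I: "finite I" "\<And>i. i \<notin> I \<Longrightarrow> gens F i = []" and e: "e \<in> D"
  shows "coeff (degree_poly I F) e \<noteq> 0"
proof -
  obtain p where p: "finite D"
    "\<And>k. k < card D \<Longrightarrow> coeff (degree_poly I F) (sorted_list_of_set D ! k) = of_int (alt (p - int k)) * of_nat (\<beta> k)"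
    "\<And>k. k < card D \<Longrightarrow> \<beta> k \<ge> 1"
    using coeff_degree_poly_pure[OF pure I] by metis
  have "e \<in> set (sorted_list_of_set D)" using p(1) e by simp
  then obtain k where k: "k < card D" "e = sorted_list_of_set D ! k" by (auto simp: in_set_conv_nth)
  then show ?thesis using p(2,3)[OF k(1)] alt_nonzero by simp
qed

lemma pure_triplet_sol:
  assumes tr: "pure_triplet n A B C F G H" and A: "A \<subseteq> {..n}"
    and I: "finite I" "\<And>i. i \<notin> I \<Longrightarrow> gens F i = [] \<and> gens G i = [] \<and> gens H i = []"
  shows "sol n A B C (degree_poly I F)" "degree_poly I G = transf n (degree_poly I F)"
    "degree_poly I H = transf n (transf n (degree_poly I F))"
proof -
  obtain \<alpha> \<beta> \<gamma> where pure: "pure_complex F A \<alpha>" "pure_complex G B \<beta>" "pure_complex H C \<gamma>"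
    and F: "free_sqfree_complex n F" and AD: "is_AD n F G" "is_AD n G H"
    using tr unfolding pure_triplet_def by blast
  have G: "free_sqfree_complex n G"
    using AD by (simp add: is_AD_def minimal_free_resolution_def)
  show g: "degree_poly I G = transf n (degree_poly I F)"
    by (rule degree_poly_is_AD[OF F AD(1) I(1)]) (use I in auto)
  show h: "degree_poly I H = transf n (transf n (degree_poly I F))"
    unfolding g[symmetric] by (rule degree_poly_is_AD[OF G AD(2) I(1)]) (use I in auto)
  have 1: "coeff (degree_poly I F) e = 0" if "e \<notin> A" for e
    by (rule coeff_degree_poly_pure[OF pure(1) I(1)]) (use I that in auto)
  have 2: "coeff (degree_poly I G) e = 0" if "e \<notin> B" for e
    by (rule coeff_degree_poly_pure[OF pure(2) I(1)]) (use I that in auto)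
  have 3: "coeff (degree_poly I H) e = 0" if "e \<notin> C" for e
    by (rule coeff_degree_poly_pure[OF pure(3) I(1)]) (use I that in auto)
  have "degree (degree_poly I F) \<le> n"
    by (rule degree_le) (use A 1 in force)
  then show "sol n A B C (degree_poly I F)"
    unfolding sol_def g[symmetric] h[symmetric] using 1 2 3 by (simp add: g h)
qed

lemma pure_triplet_finite:
  assumes "pure_triplet n A B C F G H"
  shows "finite {i. gens F i \<noteq> [] \<or> gens G i \<noteq> [] \<or> gens H i \<noteq> []}"
proof -
  have "finite {i. gens F i \<noteq> []}" "finite {i. gens G i \<noteq> []}" "finite {i. gens H i \<noteq> []}"
    using assms pure_complex_finite unfolding pure_triplet_def by blast+
  then have "finite ({i. gens F i \<noteq> []} \<union> {i. gens G i \<noteq> []} \<union> {i. gens H i \<noteq> []})"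
    by (simp only: finite_Un)
  then show ?thesis by (rule rev_finite_subset) blast
qed

text \<open>The two complexes may sit in positions of different parity, so \<open>\<mu>\<close> can
  be negative. Absolute values remove the alternating signs on both sides.\<close>

lemma betti_proportional:
  assumes pure: "pure_complex F D \<beta>" "pure_complex F' D \<beta>'"
    and I: "finite I" "\<And>i. i \<notin> I \<Longrightarrow> gens F i = []" "\<And>i. i \<notin> I \<Longrightarrow> gens F' i = []"
    and multiple: "degree_poly I F' = smult \<mu> (degree_poly I F)" and k: "k < card D"
  shows "of_nat (\<beta>' k) = \<bar>\<mu>\<bar> * of_nat (\<beta> k)"
proof -
  obtain p where p: "coeff (degree_poly I F) (sorted_list_of_set D ! k) = of_int (alt (p - int k)) * of_nat (\<beta> k)"
    using coeff_degree_poly_pure[OF pure(1) I(1,2)] k by metis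
  obtain p' where p': "coeff (degree_poly I F') (sorted_list_of_set D ! k) = of_int (alt (p' - int k)) * of_nat (\<beta>' k)"
    using coeff_degree_poly_pure[OF pure(2) I(1,3)] k by metis
  have "of_int (alt (p' - int k)) * of_nat (\<beta>' k) = \<mu> * (of_int (alt (p - int k)) * of_nat (\<beta> k))"
    unfolding p[symmetric] p'[symmetric] multiple by simp
  then have "\<bar>of_int (alt (p' - int k)) * of_nat (\<beta>' k)\<bar> = \<bar>\<mu> * (of_int (alt (p - int k)) * of_nat (\<beta> k))\<bar>"
    by (rule arg_cong)
  moreover have "\<bar>of_int (alt i) :: rat\<bar> = 1" for i by (simp add: alt_def)
  ultimately show ?thesis by (simp add: abs_mult)
qed

theorem theorem3p9:
  fixes F G H F' G' H' :: "'k::field mpoly free_cochain"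
  assumes existence: "\<And>m A B C. balanced_degree_triplet m A B C \<Longrightarrow>
      \<exists>F G H :: 'k mpoly free_cochain. pure_triplet m A B C F G H"
    and balanced: "balanced_degree_triplet n A B C"
    and triplet: "pure_triplet n A B C F G H"
    and betti: "pure_complex F A \<alpha>" "pure_complex G B \<beta>" "pure_complex H C \<gamma>"
    and triplet': "pure_triplet n A B C F' G' H'"
    and betti': "pure_complex F' A \<alpha>'" "pure_complex G' B \<beta>'" "pure_complex H' C \<gamma>'"
  shows "\<exists>q::rat.
      (\<forall>i<card A. of_nat (\<alpha>' i) = q * of_nat (\<alpha> i)) \<and>
      (\<forall>i<card B. of_nat (\<beta>' i) = q * of_nat (\<beta> i)) \<and>
      (\<forall>i<card C. of_nat (\<gamma>' i) = q * of_nat (\<gamma> i))"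
proof -
  have sub: "A \<subseteq> {..n}" if "balanced_degree_triplet n A B C" for A B C
    using that subset_atMost unfolding balanced_degree_triplet_def by blast
  \<comment> \<open>Needed for every balanced triplet of type \<open>n\<close>, since the induction
    leaves the given one. Purity is what turns into nonvanishing coefficients.\<close>
  have "\<exists>f. sol n A B C f \<and> (\<forall>i\<in>A. coeff f i \<noteq> 0) \<and> (\<forall>i\<in>B. coeff (transf n f) i \<noteq> 0)"
    if bal: "balanced_degree_triplet n A B C" for A B C
  proof -
    obtain F G H :: "'k mpoly free_cochain" where tr: "pure_triplet n A B C F G H"
      using existence[OF bal] by blast
    define I where "I = {i. gens F i \<noteq> [] \<or> gens G i \<noteq> [] \<or> gens H i \<noteq> []}"
    have I: "finite I" "\<And>i. i \<notin> I \<Longrightarrow> gens F i = [] \<and> gens G i = [] \<and> gens H i = []"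
      using pure_triplet_finite[OF tr] by (simp_all add: I_def)
    note s = pure_triplet_sol[OF tr sub[OF bal] I]
    obtain \<alpha> \<beta> where "pure_complex F A \<alpha>" "pure_complex G B \<beta>" using tr unfolding pure_triplet_def by blast
    then have "\<forall>i\<in>A. coeff (degree_poly I F) i \<noteq> 0" "\<forall>i\<in>B. coeff (degree_poly I G) i \<noteq> 0"
      using degree_poly_pure_nonzero I by blast+
    then show ?thesis using s by metis
  qed
  then have uniq: "unique_sol n A B C" using balanced by (rule unique_sol_balanced)
  \<comment> \<open>One position set for all six complexes makes their degree polynomials
    comparable.\<close>
  define I where "I = {i. gens F i \<noteq> [] \<or> gens G i \<noteq> [] \<or> gens H i \<noteq> []}
    \<union> {i. gens F' i \<noteq> [] \<or> gens G' i \<noteq> [] \<or> gens H' i \<noteq> []}"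
  have I: "finite I" using pure_triplet_finite[OF triplet] pure_triplet_finite[OF triplet'] by (simp add: I_def)
  have out: "gens F i = [] \<and> gens G i = [] \<and> gens H i = []" "gens F' i = [] \<and> gens G' i = [] \<and> gens H' i = []"
    if "i \<notin> I" for i
    using that by (simp_all add: I_def)
  have s: "sol n A B C (degree_poly I F)" "degree_poly I G = transf n (degree_poly I F)"
    "degree_poly I H = transf n (transf n (degree_poly I F))"
    by (rule pure_triplet_sol[OF triplet sub[OF balanced] I out(1)]; assumption)+
  have s': "sol n A B C (degree_poly I F')" "degree_poly I G' = transf n (degree_poly I F')"
    "degree_poly I H' = transf n (transf n (degree_poly I F'))"
    by (rule pure_triplet_sol[OF triplet' sub[OF balanced] I out(2)]; assumption)+
  obtain e where "e \<in> A" using balanced unfolding balanced_degree_triplet_def by blast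
  then have "coeff (degree_poly I F) e \<noteq> 0" using degree_poly_pure_nonzero[OF betti(1) I] out by blast
  then have "degree_poly I F \<noteq> 0" by auto
  then obtain \<mu> where \<mu>: "degree_poly I F' = smult \<mu> (degree_poly I F)"
    using uniq s(1) s'(1) unfolding unique_sol_def by blast
  \<comment> \<open>Linearity of \<open>transf n\<close> hands the same \<open>\<mu>\<close> on to
    the other two members of the triplet, so one factor serves all three.\<close>
  have "degree_poly I G' = transf n (smult \<mu> (degree_poly I F))" by (rule s'(2)[unfolded \<mu>])
  then have \<mu>G: "degree_poly I G' = smult \<mu> (degree_poly I G)" by (simp only: transf_smult s(2))
  have "degree_poly I H' = transf n (transf n (smult \<mu> (degree_poly I F)))" by (rule s'(3)[unfolded \<mu>])
  then have \<mu>H: "degree_poly I H' = smult \<mu> (degree_poly I H)" by (simp only: transf_smult s(3))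
  show ?thesis
    using betti_proportional[OF betti(1) betti'(1) I _ _ \<mu>] betti_proportional[OF betti(2) betti'(2) I _ _ \<mu>G]
      betti_proportional[OF betti(3) betti'(3) I _ _ \<mu>H] out
    by (intro exI[of _ "\<bar>\<mu>\<bar>"]) blast
qed

end
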